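(* Let $d\ge 1$, $p>0$, $\alpha\in(0,2)$ and $T>0$. Let $\sigma$, $Q(\cdot\mid u)$, $q$, $M$ and the measure $Q$ on $\mathbb{R}^d$ be as in the context. Let $\{E_j\}_{j\ge1}$ and $\{E'_j\}_{j\ge1}$ be i.i.d. sequences of standard exponential random variables, $\Gamma_j:=E'_1+\cdots+E'_j$, $\{T_j\}$ an i.i.d. sequence of uniform random variables on $(0,T)$, $\{U_j\}$ an i.i.d. sequence of uniform random variables on $(0,1)$, and $\{V_j\}$ an i.i.d. sequence of random vectors in $\mathbb{R}^d$ with distribution $Q/\|\sigma\|$; all these sequences are mutually independent. Assume that either $\alpha\in(0,1)$, or $\alpha\in[1,2)$ and $Q$ is symmetric (i.e. $Q(-A)=Q(A)$ for all Borel $A$). Define $$L_t:=\sum_{j=1}^{\infty}\mathbf{1}_{(0,t]}(T_j)\left(\left(\frac{\alpha\Gamma_j}{\|\sigma\|T}\right)^{-1/\alpha}\wedge\frac{E_j^{1/p}U_j^{1/\alpha}}{\|V_j\|^{1/p}}\right)\frac{V_j}{\|V_j\|},\qquad t\in[0,T].$$ Then this series converges almost surely, uniformly in $t\in[0,T]$, to a Lévy process $L=\{L_t\}_{t\in[0,T]}$ such that $L_1$ has a proper $p$-tempered $\alpha$-stable distribution, i.e. an infinitely divisible distribution with no Gaussian part and Lévy measure $M$.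
   Context: Let $\mathbb{S}^{d-1}$ be the unit sphere in $\mathbb{R}^d$ and $\sigma$ a finite nonzero Borel measure on $\mathbb{S}^{d-1}$ with total mass $\|\sigma\|:=\sigma(\mathbb{S}^{d-1})$. Let $\{Q(\cdot\mid u)\}_{u\in\mathbb{S}^{d-1}}$ be a measurable family of Borel probability measures on $(0,\infty)$ and define the tempering function $q(r,u):=\int_{(0,\infty)}e^{-rs}\,Q(ds\mid u)$ for $r>0$ (so $q(\cdot,u)$ is completely monotone with $\lim_{r\downarrow0}q(r,u)=1$). The Lévy measure is $$M(A):=\int_{\mathbb{S}^{d-1}}\int_0^\infty \mathbf{1}_A(ru)\,q(r^p,u)\,r^{-\alpha-1}\,dr\,\sigma(du),\qquad A\in\mathcal{B}(\mathbb{R}^d).$$ An infinitely divisible distribution with no Gaussian part and Lévy measure of this form is called a proper $p$-tempered $\alpha$-stable distribution. The Borel measure $Q$ on $\mathbb{R}^d$ is $Q(A):=\int_{\mathbb{S}^{d-1}}\int_{(0,\infty)}\mathbf{1}_A(su)\,Q(ds\mid u)\,\sigma(du)$; it has total mass $\|\sigma\|$, so $Q/\|\sigma\|$ is a probability measure. *)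

theory Defs
  imports "HOL-Probability.Probability"
begin

definition temper_fun :: "('a \<Rightarrow> real measure) \<Rightarrow> real \<Rightarrow> 'a \<Rightarrow> real" where
  "temper_fun Qk r u = (\<integral>s. exp (- r * s) \<partial>(Qk u))"

definition tempered_levy_measure ::
  "'a::euclidean_space measure \<Rightarrow> ('a \<Rightarrow> real measure) \<Rightarrow> real \<Rightarrow> real \<Rightarrow> 'a measure" where
  "tempered_levy_measure sg Qk p \<alpha> =
     measure_of UNIV (sets borel)
       (\<lambda>A. \<integral>\<^sup>+ u. indicator (sphere 0 1) u *
              (\<integral>\<^sup>+ r. indicator {0<..} r * indicator A (r *\<^sub>R u) *
                  ennreal (temper_fun Qk (r powr p) u * r powr (- \<alpha> - 1)) \<partial>lborel) \<partial>sg)"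

definition Q_measure ::
  "'a::euclidean_space measure \<Rightarrow> ('a \<Rightarrow> real measure) \<Rightarrow> 'a measure" where
  "Q_measure sg Qk =
     measure_of UNIV (sets borel)
       (\<lambda>A. \<integral>\<^sup>+ u. indicator (sphere 0 1) u *
              (\<integral>\<^sup>+ s. indicator A (s *\<^sub>R u) \<partial>(Qk u)) \<partial>sg)"

definition gen_events :: "'w measure \<Rightarrow> ('w \<Rightarrow> 'b::topological_space) \<Rightarrow> 'w set set" where
  "gen_events P X = {X -` A \<inter> space P | A. A \<in> sets borel}"

definition char_fun :: "'a::euclidean_space measure \<Rightarrow> 'a \<Rightarrow> complex" where
  "char_fun \<mu> z = (CLINT x|\<mu>. exp (\<i> * complex_of_real (z \<bullet> x)))"

definition lk_exponent :: "'a::euclidean_space measure \<Rightarrow> 'a \<Rightarrow> 'a \<Rightarrow> complex" where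
  "lk_exponent Mv b z =
     \<i> * complex_of_real (b \<bullet> z) +
     (CLINT x|Mv. exp (\<i> * complex_of_real (z \<bullet> x)) - 1
                  - \<i> * complex_of_real (z \<bullet> x) * indicator (cball 0 1) x)"

(* Levy process on [0,T] (Sato, Def. 1.6, restricted to the time interval [0,T]) *)
definition levy_process_on :: "'w measure \<Rightarrow> real \<Rightarrow> (real \<Rightarrow> 'w \<Rightarrow> 'a::euclidean_space) \<Rightarrow> bool" where
  "levy_process_on P T L \<longleftrightarrow>
     (\<forall>t\<in>{0..T}. L t \<in> borel_measurable P) \<and>
     (AE \<omega> in P. L 0 \<omega> = 0) \<and>
     (\<forall>n ts. (\<forall>k<n. ts k < ts (Suc k)) \<and> 0 \<le> ts 0 \<and> ts n \<le> T \<longrightarrow>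
        prob_space.indep_vars P (\<lambda>_. borel) (\<lambda>k \<omega>. L (ts (Suc k)) \<omega> - L (ts k) \<omega>) {..<n}) \<and>
     (\<forall>s t. 0 \<le> s \<and> s \<le> t \<and> t \<le> T \<longrightarrow>
        distr P borel (\<lambda>\<omega>. L t \<omega> - L s \<omega>) = distr P borel (\<lambda>\<omega>. L (t - s) \<omega>)) \<and>
     (\<forall>s\<in>{0..T}. \<forall>e>0.
        ((\<lambda>t. measure P {\<omega>\<in>space P. e < norm (L t \<omega> - L s \<omega>)}) \<longlongrightarrow> 0) (at s within {0..T})) \<and>
     (AE \<omega> in P. (\<forall>t\<in>{0..<T}. continuous (at_right t) (\<lambda>s. L s \<omega>)) \<and>
                  (\<forall>t\<in>{0<..T}. \<exists>l. ((\<lambda>s. L s \<omega>) \<longlongrightarrow> l) (at_left t)))"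

(* j-th summand of the series (indices start at 0; Gamma_j = E'_0 + ... + E'_j) *)
definition series_term ::
  "real \<Rightarrow> real \<Rightarrow> real \<Rightarrow> real \<Rightarrow>
   (nat \<Rightarrow> 'w \<Rightarrow> real) \<Rightarrow> (nat \<Rightarrow> 'w \<Rightarrow> real) \<Rightarrow> (nat \<Rightarrow> 'w \<Rightarrow> real) \<Rightarrow>
   (nat \<Rightarrow> 'w \<Rightarrow> real) \<Rightarrow> (nat \<Rightarrow> 'w \<Rightarrow> 'a::euclidean_space) \<Rightarrow> nat \<Rightarrow> real \<Rightarrow> 'w \<Rightarrow> 'a" where
  "series_term p \<alpha> T ns E E' Tj U V j t \<omega> =
     (indicator {0<..t} (Tj j \<omega>) *
      min ((\<alpha> * (\<Sum>i\<le>j. E' i \<omega>) / (ns * T)) powr (- 1 / \<alpha>))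
          (E j \<omega> powr (1 / p) * U j \<omega> powr (1 / \<alpha>) / norm (V j \<omega>) powr (1 / p)))
     *\<^sub>R (V j \<omega> /\<^sub>R norm (V j \<omega>))"

end

theory Submission
  imports Defs
begin

text \<open>Let \<open>\<Gamma>\<^sub>j\<close> be the arrival times and \<open>h\<close> a function of an arrival and its mark with modulus at most 1; put
  \<open>H \<gamma> = E (h (\<gamma>, mark))\<close> and \<open>K \<gamma> = exp (\<integral>\<^sub>\<gamma>\<^sup>\<infinity> (H - 1))\<close>. The products of the \<open>h (\<Gamma>\<^sub>j, mark\<^sub>j)\<close> for
  \<open>j < n\<close>, multiplied by \<open>K\<close> at the last arrival, have mean \<open>K 0\<close> for every \<open>n\<close>, hence
  \<open>E (\<Prod>j. h (\<Gamma>\<^sub>j, mark\<^sub>j)) = exp (\<integral>\<^sub>0\<^sup>\<infinity> (H - 1))\<close>. With \<open>h\<close> the exponential of a step function of the time mark,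
  paired with the jump, this is the joint characteristic function of the increments. It factorises over
  disjoint time intervals, which gives independent and stationary increments by uniqueness of
  characteristic functions. The image of Lebesgue measure times the mark law under the jump map is \<open>T\<close> times the
  tempered Levy measure: along a ray both have the tail
  \<open>c * \<integral>\<^sub>y\<^sup>\<infinity> exp (- s x\<^sup>p) x\<^bsup>- \<alpha> - 1\<^esup> dx\<close>.

  For \<open>\<alpha> < 1\<close> the series converges absolutely because \<open>\<Gamma>\<^sub>j \<ge> j / 2\<close> eventually. In the symmetric case
  the jumps may be given arbitrary signs without changing the law; averaging over the signs, Levy's reflection
  argument, applied once to the number of terms and once to time, bounds the probability that some
  partial sum at some time is large by the sum of the squares of the jumps.\<close>

section \<open>Uniqueness and independence from characteristic functions\<close>

text \<open>The jumps share the partial sums of the gaps and are therefore dependent. The factor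
  \<open>K\<close> at the last arrival stands for the mean of the factors still to come: it solves
  \<open>K' = - (H - 1) * K\<close>, which is exactly the condition that one more exponential gap
  leaves the mean unchanged. Only \<open>H - 1\<close> has to be integrable on the half-line, not
  \<open>h - 1\<close> jointly in arrival and mark; this matters for \<alpha> \<ge> 1, where the
  exponent converges only after averaging over opposite directions. The series is not compensated
  whereas \<open>lk_exponent\<close> is, so the drift has to be the integral of the truncated mean
  jumps. It is finite for \<alpha> < 1 and vanishes under symmetry. In the symmetric case the jumps
  have no deterministic square-summable bound; those arriving no later than
  \<open>(j + 1) / 2\<close> are replaced by 0, which almost surely changes finitely many terms. The
  signs are placed in the vectors \<open>V j\<close>, since the law of the independent pairs of gap
  and mark is visibly invariant under them.\<close>

lemma char_fun_real_eq_char: "char_fun (\<mu> :: real measure) = char \<mu>"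
  by (simp add: char_fun_def char_def fun_eq_iff)

text \<open>\<open>Levy_uniqueness\<close> is about probability measures. The value at
  \<open>z = 0\<close> shows that the two masses agree, so both measures can be divided by the same
  constant; mass zero is settled separately.\<close>

lemma finite_measure_eqI_char_real:
  fixes \<mu> \<nu> :: "real measure"
  assumes fin: "finite_measure \<mu>" "finite_measure \<nu>"
    and sets: "sets \<mu> = sets borel" "sets \<nu> = sets borel"
    and cf: "\<And>z. char_fun \<mu> z = char_fun \<nu> z"
  shows "\<mu> = \<nu>"
proof -
  interpret m: finite_measure \<mu> by fact
  interpret n: finite_measure \<nu> by fact
  have sp: "space \<mu> = UNIV" "space \<nu> = UNIV"
    using sets[THEN sets_eq_imp_space_eq] by auto
  have mass: "measure \<mu> UNIV = measure \<nu> UNIV"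
    using cf[of 0] by (simp add: char_fun_def sp complex_eq_iff)
  show ?thesis
  proof (cases "measure \<mu> UNIV = 0")
    case True
    have "emeasure \<mu> UNIV = 0" "emeasure \<nu> UNIV = 0"
      using True mass by (auto simp: m.emeasure_eq_measure n.emeasure_eq_measure)
    then have "emeasure \<mu> A = 0" "emeasure \<nu> A = 0" for A
      using emeasure_mono[of A UNIV \<mu>] emeasure_mono[of A UNIV \<nu>] sets by auto
    then show ?thesis by (intro measure_eqI) (auto simp: sets)
  next
    case False
    define c where "c = measure \<mu> UNIV"
    have c: "c > 0" using False by (simp add: c_def less_le)
    have rd: "real_distribution (scale_measure (ennreal (1/c)) M)"
      if "sets M = sets borel" "finite_measure M" "measure M UNIV = c" for M :: "real measure"
    proof -
      interpret M: finite_measure M by fact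
      have "space M = UNIV" using that sets_eq_imp_space_eq by fastforce
      with that c show ?thesis
        by (intro real_distribution.intro real_distribution_axioms.intro prob_spaceI)
           (auto simp: M.emeasure_eq_measure ennreal_mult[symmetric] space_scale_measure)
    qed
    have sc: "char (scale_measure (ennreal (1/c)) M) z = (1/c) *\<^sub>R char_fun M z" if [measurable_cong]: "sets M = sets borel" for M :: "real measure" and z
    proof -
      have "scale_measure (ennreal (1/c)) M = density M (\<lambda>_. ennreal (1/c))"
        by (intro measure_eqI) (auto simp: emeasure_density_const)
      then show ?thesis
        unfolding char_def char_fun_real_eq_char
        using c by (simp add: integral_density less_imp_le)
    qed
    have "char (scale_measure (ennreal (1/c)) \<mu>) = char (scale_measure (ennreal (1/c)) \<nu>)"
      unfolding fun_eq_iff sc[OF sets(1)] sc[OF sets(2)] using cf by simp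
    then have eq: "scale_measure (ennreal (1/c)) \<mu> = scale_measure (ennreal (1/c)) \<nu>"
      using mass by (intro Levy_uniqueness rd fin sets) (auto simp: c_def)
    have "emeasure \<mu> A = emeasure \<nu> A" for A
    proof -
      have "ennreal (1/c) * emeasure \<mu> A = ennreal (1/c) * emeasure \<nu> A"
        using arg_cong[OF eq, of "\<lambda>M. emeasure M A"] by simp
      then show ?thesis using c by (simp add: ennreal_mult_cancel_left)
    qed
    then show ?thesis by (intro measure_eqI) (auto simp: sets)
  qed
qed

lemma integral_indicator_complex:
  "(CLINT x|M. indicator A x) = complex_of_real (measure M (A \<inter> space M))"
proof -
  have "(CLINT x|M. indicator A x) = (CLINT x|M. complex_of_real (indicator A x))"
    by (simp only: of_real_indicator)
  also have "\<dots> = complex_of_real (measure M (A \<inter> space M))" by simp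
  finally show ?thesis .
qed

lemma norm_iexp[simp]: "norm (exp (\<i> * complex_of_real r)) = 1"
  by (simp add: norm_exp_i_times)

lemma (in finite_measure) integrable_norm_le_1:
  fixes f :: "'a \<Rightarrow> complex"
  assumes [measurable]: "f \<in> borel_measurable M" and "\<And>x. x \<in> space M \<Longrightarrow> norm (f x) \<le> 1"
  shows "integrable M f"
  by (rule integrable_const_bound[of _ 1]) (use assms in auto)

text \<open>A signed weight is not a density, but \<open>v + 1\<close> is nonnegative. The images of
  the measures with densities \<open>v + 1\<close> and \<open>v' + 1\<close> have as characteristic
  function the weighted transform plus the plain one, so they coincide by \<open>uniq\<close>.
  Subtracting the equality of the unweighted images leaves the claim.\<close>

lemma weighted_real_char_transfer:
  fixes X :: "'m \<Rightarrow> 'b::euclidean_space" and Y :: "'n \<Rightarrow> 'b" and v :: "'m \<Rightarrow> real" and v' :: "'n \<Rightarrow> real"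
  assumes uniq: "\<And>\<mu> \<nu> :: 'b measure. finite_measure \<mu> \<Longrightarrow> finite_measure \<nu> \<Longrightarrow> sets \<mu> = sets borel \<Longrightarrow>
      sets \<nu> = sets borel \<Longrightarrow> (\<And>z. char_fun \<mu> z = char_fun \<nu> z) \<Longrightarrow> \<mu> = \<nu>"
    and fin: "finite_measure M" "finite_measure N"
    and [measurable]: "X \<in> borel_measurable M" "Y \<in> borel_measurable N"
      "v \<in> borel_measurable M" "v' \<in> borel_measurable N"
    and bd: "\<And>x. \<bar>v x\<bar> \<le> 1" "\<And>x. \<bar>v' x\<bar> \<le> 1"
    and base: "\<And>z. (CLINT x|M. iexp (z \<bullet> X x)) = (CLINT x|N. iexp (z \<bullet> Y x))"
    and weighted: "\<And>z. (CLINT x|M. v x *\<^sub>R iexp (z \<bullet> X x)) = (CLINT x|N. v' x *\<^sub>R iexp (z \<bullet> Y x))"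
    and B[measurable]: "B \<in> sets borel"
  shows "(LINT x|M. v x * indicator B (X x)) = (LINT x|N. v' x * indicator B (Y x))"
proof -
  have one: "measure (distr (density M0 (\<lambda>x. ennreal (u x + 1))) borel X0) B = (LINT x|M0. (u x + 1) * indicator B (X0 x))"
    "finite_measure (distr (density M0 (\<lambda>x. ennreal (u x + 1))) borel X0)"
    "char_fun (distr (density M0 (\<lambda>x. ennreal (u x + 1))) borel X0) z
      = (CLINT x|M0. u x *\<^sub>R iexp (z \<bullet> X0 x)) + (CLINT x|M0. iexp (z \<bullet> X0 x))"
    "(LINT x|M0. (u x + 1) * indicator B (X0 x)) =
       (LINT x|M0. u x * indicator B (X0 x)) + measure (distr M0 borel X0) B"
    "char_fun (distr M0 borel X0) z = (CLINT x|M0. iexp (z \<bullet> X0 x))"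
    if "finite_measure M0" and [measurable]: "X0 \<in> borel_measurable M0" "u \<in> borel_measurable M0"
      and b: "\<And>x. \<bar>u x\<bar> \<le> 1" for M0 :: "'c measure" and X0 :: "'c \<Rightarrow> 'b" and u z
  proof -
    interpret finite_measure M0 by fact
    have nn: "0 \<le> u x + 1" for x using b[of x] by linarith
    have i1: "integrable M0 (\<lambda>x. u x * indicator B (X0 x))"
      by (rule integrable_const_bound[of _ 1]) (use b in \<open>auto simp: indicator_def\<close>)
    have i2: "integrable M0 (\<lambda>x. indicator B (X0 x) :: real)"
      by (rule integrable_const_bound[of _ 1]) (auto simp: indicator_def)
    have i3: "integrable M0 (\<lambda>x. u x *\<^sub>R iexp (z \<bullet> X0 x))"
      by (rule integrable_const_bound[of _ 1]) (use b in \<open>auto simp: indicator_def\<close>)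
    have i4: "integrable M0 (\<lambda>x. iexp (z \<bullet> X0 x))"
      by (rule integrable_const_bound[of _ 1]) auto
    have i5: "integrable M0 (\<lambda>x. u x + 1)"
      using b by (intro integrable_const_bound[of _ 2]) (auto intro!: AE_I2 intro: order_trans[OF abs_triangle_ineq])
    have fin2: "finite_measure (density M0 (\<lambda>x. ennreal (u x + 1)))"
    proof
      have "(\<integral>\<^sup>+ x. ennreal (u x + 1) \<partial>M0) < \<infinity>"
        using i5 nn by (subst nn_integral_eq_integral) auto
      then show "emeasure (density M0 (\<lambda>x. ennreal (u x + 1))) (space (density M0 (\<lambda>x. ennreal (u x + 1)))) \<noteq> \<infinity>"
        by (subst emeasure_density) (auto cong: nn_integral_cong)
    qed
    then show f: "finite_measure (distr (density M0 (\<lambda>x. ennreal (u x + 1))) borel X0)"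
      by (rule finite_measure.finite_measure_distr) auto
    have "measure (distr (density M0 (\<lambda>x. ennreal (u x + 1))) borel X0) B
        = (LINT x|distr (density M0 (\<lambda>x. ennreal (u x + 1))) borel X0. indicator B x)"
      using finite_measure.emeasure_eq_measure[OF f] by simp
    also have "\<dots> = (LINT x|M0. (u x + 1) * indicator B (X0 x))"
      by (subst integral_distr, simp, simp, subst integral_density) (use nn in auto)
    finally show "measure (distr (density M0 (\<lambda>x. ennreal (u x + 1))) borel X0) B = \<dots>" .
    have "char_fun (distr (density M0 (\<lambda>x. ennreal (u x + 1))) borel X0) z =
       (CLINT x|M0. (u x + 1) *\<^sub>R iexp (z \<bullet> X0 x))"
      unfolding char_fun_def by (subst integral_distr, simp, simp, subst integral_density) (use nn in auto)
    also have "\<dots> = (CLINT x|M0. u x *\<^sub>R iexp (z \<bullet> X0 x) + iexp (z \<bullet> X0 x))"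
      by (simp add: scaleR_add_left)
    also have "\<dots> = (CLINT x|M0. u x *\<^sub>R iexp (z \<bullet> X0 x)) + (CLINT x|M0. iexp (z \<bullet> X0 x))"
      by (rule Bochner_Integration.integral_add[OF i3 i4])
    finally show "char_fun (distr (density M0 (\<lambda>x. ennreal (u x + 1))) borel X0) z
      = (CLINT x|M0. u x *\<^sub>R iexp (z \<bullet> X0 x)) + (CLINT x|M0. iexp (z \<bullet> X0 x))" .
    show "char_fun (distr M0 borel X0) z = (CLINT x|M0. iexp (z \<bullet> X0 x))"
      unfolding char_fun_def by (subst integral_distr) auto
    have "measure (distr M0 borel X0) B = (LINT x|M0. indicator B (X0 x))"
      using finite_measure.emeasure_eq_measure[OF finite_measure_distr, of X0 borel]
      by (subst integral_distr[of X0 M0 borel "indicator B", symmetric]) auto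
    then show "(LINT x|M0. (u x + 1) * indicator B (X0 x)) =
       (LINT x|M0. u x * indicator B (X0 x)) + measure (distr M0 borel X0) B"
      using i1 i2 by (simp add: distrib_right)
  qed
  note oM = one[OF fin(1) \<open>X \<in> borel_measurable M\<close> \<open>v \<in> borel_measurable M\<close> bd(1)]
  note oN = one[OF fin(2) \<open>Y \<in> borel_measurable N\<close> \<open>v' \<in> borel_measurable N\<close> bd(2)]
  have e1: "distr (density M (\<lambda>x. ennreal (v x + 1))) borel X = distr (density N (\<lambda>x. ennreal (v' x + 1))) borel Y"
    by (rule uniq) (use base weighted in \<open>auto simp: oM oN\<close>)
  have e2: "distr M borel X = distr N borel Y"
    by (rule uniq) (use base fin in \<open>auto simp: oM oN intro!: finite_measure.finite_measure_distr\<close>)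
  show ?thesis
    using oM(1) oN(1) e1 e2 unfolding oM(4) oN(4) by simp
qed

text \<open>Conjugating the transform at \<open>- z\<close> replaces \<open>w\<close> by its
  conjugate, so the transforms of \<open>Re w\<close> and \<open>Im w\<close> are combinations of
  those of \<open>w\<close> at \<open>z\<close> and \<open>- z\<close>, and the real case applies to
  each. Uniqueness enters as the hypothesis \<open>uniq\<close> because it is needed first for the
  real line and then for the Euclidean space that it helps to treat.\<close>

lemma weighted_char_transfer:
  fixes X :: "'m \<Rightarrow> 'b::euclidean_space" and Y :: "'n \<Rightarrow> 'b" and w :: "'m \<Rightarrow> complex" and w' :: "'n \<Rightarrow> complex"
  assumes uniq: "\<And>\<mu> \<nu> :: 'b measure. finite_measure \<mu> \<Longrightarrow> finite_measure \<nu> \<Longrightarrow> sets \<mu> = sets borel \<Longrightarrow>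
      sets \<nu> = sets borel \<Longrightarrow> (\<And>z. char_fun \<mu> z = char_fun \<nu> z) \<Longrightarrow> \<mu> = \<nu>"
    and fin: "finite_measure M" "finite_measure N"
    and [measurable]: "X \<in> borel_measurable M" "Y \<in> borel_measurable N"
      "w \<in> borel_measurable M" "w' \<in> borel_measurable N"
    and bd: "\<And>x. norm (w x) \<le> 1" "\<And>x. norm (w' x) \<le> 1"
    and base: "\<And>z. (CLINT x|M. iexp (z \<bullet> X x)) = (CLINT x|N. iexp (z \<bullet> Y x))"
    and weighted: "\<And>z. (CLINT x|M. w x * iexp (z \<bullet> X x)) = (CLINT x|N. w' x * iexp (z \<bullet> Y x))"
    and B[measurable]: "B \<in> sets borel"
  shows "(CLINT x|M. w x * indicator B (X x)) = (CLINT x|N. w' x * indicator B (Y x))"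
proof -
  have split: "(CLINT x|M0. Re (u x) *\<^sub>R iexp (z \<bullet> X0 x)) =
        ((CLINT x|M0. u x * iexp (z \<bullet> X0 x)) + cnj (CLINT x|M0. u x * iexp ((- z) \<bullet> X0 x))) / 2"
      "(CLINT x|M0. Im (u x) *\<^sub>R iexp (z \<bullet> X0 x)) =
        ((CLINT x|M0. u x * iexp (z \<bullet> X0 x)) - cnj (CLINT x|M0. u x * iexp ((- z) \<bullet> X0 x))) / (2 * \<i>)"
      "(CLINT x|M0. u x * indicator B (X0 x)) =
        complex_of_real (LINT x|M0. Re (u x) * indicator B (X0 x)) + \<i> * complex_of_real (LINT x|M0. Im (u x) * indicator B (X0 x))"
    if "finite_measure M0" and [measurable]: "X0 \<in> borel_measurable M0" "u \<in> borel_measurable M0"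
      and b: "\<And>x. norm (u x) \<le> 1" for M0 :: "'c measure" and X0 :: "'c \<Rightarrow> 'b" and u z
  proof -
    interpret finite_measure M0 by fact
    have i1: "integrable M0 (\<lambda>x. u x * iexp (z \<bullet> X0 x))" for z
      by (rule integrable_norm_le_1) (use b in \<open>auto simp: norm_mult\<close>)
    have i2: "integrable M0 (\<lambda>x. cnj (u x * iexp ((- z) \<bullet> X0 x)))"
      using i1[of "-z"] by (rule integrable_cnj)
    have "(CLINT x|M0. Re (u x) *\<^sub>R iexp (z \<bullet> X0 x)) =
      (CLINT x|M0. (u x * iexp (z \<bullet> X0 x) + cnj (u x * iexp ((- z) \<bullet> X0 x))) / 2)"
    proof (intro Bochner_Integration.integral_cong refl)
      fix x
      have "complex_of_real (Re (u x)) = (u x + cnj (u x)) / 2"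
        by (simp add: complex_add_cnj)
      then show "Re (u x) *\<^sub>R iexp (z \<bullet> X0 x) = (u x * iexp (z \<bullet> X0 x) + cnj (u x * iexp ((- z) \<bullet> X0 x))) / 2"
        by (simp add: scaleR_conv_of_real exp_cnj algebra_simps add_divide_distrib diff_divide_distrib)
    qed
    also have "\<dots> = ((CLINT x|M0. u x * iexp (z \<bullet> X0 x)) + cnj (CLINT x|M0. u x * iexp ((- z) \<bullet> X0 x))) / 2"
      using i1 i2 by (simp del: complex_cnj_mult add: complex_cnj_mult[symmetric] exp_cnj[symmetric])
    finally show "(CLINT x|M0. Re (u x) *\<^sub>R iexp (z \<bullet> X0 x)) = \<dots>" .
    have "(CLINT x|M0. Im (u x) *\<^sub>R iexp (z \<bullet> X0 x)) =
      (CLINT x|M0. (u x * iexp (z \<bullet> X0 x) - cnj (u x * iexp ((- z) \<bullet> X0 x))) / (2 * \<i>))"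
    proof (intro Bochner_Integration.integral_cong refl)
      fix x
      have "complex_of_real (Im (u x)) = (u x - cnj (u x)) / (2 * \<i>)"
        by (simp add: complex_diff_cnj mult.assoc[symmetric] mult.commute[of _ \<i>])
      moreover have "cnj (u x * iexp ((- z) \<bullet> X0 x)) = cnj (u x) * iexp (z \<bullet> X0 x)"
        by (simp add: exp_cnj)
      ultimately show "Im (u x) *\<^sub>R iexp (z \<bullet> X0 x) = (u x * iexp (z \<bullet> X0 x) - cnj (u x * iexp ((- z) \<bullet> X0 x))) / (2 * \<i>)"
        by (simp only: scaleR_conv_of_real left_diff_distrib[symmetric] times_divide_eq_left)
    qed
    also have "\<dots> = ((CLINT x|M0. u x * iexp (z \<bullet> X0 x)) - cnj (CLINT x|M0. u x * iexp ((- z) \<bullet> X0 x))) / (2 * \<i>)"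
      using i1 i2 by (simp del: complex_cnj_mult add: complex_cnj_mult[symmetric] exp_cnj[symmetric])
    finally show "(CLINT x|M0. Im (u x) *\<^sub>R iexp (z \<bullet> X0 x)) = \<dots>" .
    have i3: "integrable M0 (\<lambda>x. u x * indicator B (X0 x))"
      by (rule integrable_norm_le_1) (use b in \<open>auto simp: norm_mult indicator_def\<close>)
    have "Re (u x * indicator B (X0 x)) = Re (u x) * indicator B (X0 x)"
      "Im (u x * indicator B (X0 x)) = Im (u x) * indicator B (X0 x)" for x
      by (auto simp: indicator_def)
    then show "(CLINT x|M0. u x * indicator B (X0 x)) =
        complex_of_real (LINT x|M0. Re (u x) * indicator B (X0 x)) + \<i> * complex_of_real (LINT x|M0. Im (u x) * indicator B (X0 x))"
      using integral_Re[OF i3] integral_Im[OF i3] by (simp add: complex_eq_iff)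
  qed
  note sM = split[OF fin(1) \<open>X \<in> borel_measurable M\<close> \<open>w \<in> borel_measurable M\<close> bd(1)]
  note sN = split[OF fin(2) \<open>Y \<in> borel_measurable N\<close> \<open>w' \<in> borel_measurable N\<close> bd(2)]
  have bd': "\<bar>Re (w x)\<bar> \<le> 1" "\<bar>Im (w x)\<bar> \<le> 1" "\<bar>Re (w' y)\<bar> \<le> 1" "\<bar>Im (w' y)\<bar> \<le> 1" for x y
    using bd abs_Re_le_cmod abs_Im_le_cmod order_trans by metis+
  have eR: "(CLINT x|M. Re (w x) *\<^sub>R iexp (z \<bullet> X x)) = (CLINT x|N. Re (w' x) *\<^sub>R iexp (z \<bullet> Y x))"
    and eI: "(CLINT x|M. Im (w x) *\<^sub>R iexp (z \<bullet> X x)) = (CLINT x|N. Im (w' x) *\<^sub>R iexp (z \<bullet> Y x))" for z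
    by (simp_all only: sM(1,2) sN(1,2) weighted)
  have "(LINT x|M. Re (w x) * indicator B (X x)) = (LINT x|N. Re (w' x) * indicator B (Y x))"
    by (rule weighted_real_char_transfer[OF uniq fin]) (use base bd' eR in \<open>auto\<close>)
  moreover have "(LINT x|M. Im (w x) * indicator B (X x)) = (LINT x|N. Im (w' x) * indicator B (Y x))"
    by (rule weighted_real_char_transfer[OF uniq fin]) (use base bd' eI in \<open>auto\<close>)
  ultimately show ?thesis by (simp add: sM(3) sN(3))
qed

text \<open>The coordinates are exchanged one at a time: the exponential in one coordinate is turned
  into an indicator by uniqueness on the line, while all other factors form a bounded complex
  weight. Once every coordinate carries an indicator, the measures agree on boxes.\<close>

lemma finite_measure_eqI_char_fun:
  fixes \<mu> \<nu> :: "'a::euclidean_space measure"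
  assumes fin: "finite_measure \<mu>" "finite_measure \<nu>"
    and sets: "sets \<mu> = sets borel" "sets \<nu> = sets borel"
    and cf: "\<And>z. char_fun \<mu> z = char_fun \<nu> z"
  shows "\<mu> = \<nu>"
proof -
  interpret m: finite_measure \<mu> by fact
  interpret n: finite_measure \<nu> by fact
  note [measurable_cong] = sets
  have sp: "space \<mu> = UNIV" "space \<nu> = UNIV"
    using sets[THEN sets_eq_imp_space_eq] by auto
  \<comment> \<open>\<open>D\<close> holds the coordinates already turned into indicators. The
    frequencies \<open>a\<close> of the others stay free, since the next step lets the frequency of
    the new coordinate vary.\<close>
  have mixed: "(CLINT x|\<mu>. (\<Prod>b\<in>D. indicator (B b) (x \<bullet> b)) * iexp (\<Sum>b\<in>Basis - D. a b * (x \<bullet> b))) =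
        (CLINT x|\<nu>. (\<Prod>b\<in>D. indicator (B b) (x \<bullet> b)) * iexp (\<Sum>b\<in>Basis - D. a b * (x \<bullet> b)))"
    if "D \<subseteq> Basis" "\<And>b. B b \<in> sets borel" for D a and B :: "'a \<Rightarrow> real set"
  proof -
    have "finite D" using finite_subset[OF that(1)] by simp
    then show ?thesis using that(1)
    proof (induction D arbitrary: a)
      case empty
      have "(\<Sum>b\<in>Basis. a b *\<^sub>R b) \<bullet> x = (\<Sum>b\<in>Basis. a b * (x \<bullet> b))" for x
        by (simp add: inner_sum_left) (simp add: inner_commute)
      then show ?case using cf[of "\<Sum>b\<in>Basis. a b *\<^sub>R b"] by (simp add: char_fun_def)
    next
      case (insert d D)
      then have d: "d \<in> Basis" "d \<notin> D" "D \<subseteq> Basis" "finite D" by auto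
      have [measurable]: "B b \<in> sets borel" for b by fact
      define w where "w = (\<lambda>x. (\<Prod>b\<in>D. indicator (B b) (x \<bullet> b)) * iexp (\<Sum>b\<in>Basis - insert d D. a b * (x \<bullet> b)))"
      have [measurable]: "w \<in> borel_measurable borel" unfolding w_def by measurable
      have wb: "norm (w x) \<le> 1" for x
        unfolding w_def by (auto simp: norm_mult prod_norm[symmetric] intro!: prod_le_1 simp: indicator_def)
      have wz: "w x * iexp (z * (x \<bullet> d)) = (\<Prod>b\<in>D. indicator (B b) (x \<bullet> b)) * iexp (\<Sum>b\<in>Basis - D. (a(d := z)) b * (x \<bullet> b))" for x z
      proof -
        have "(\<Sum>b\<in>Basis - D. (a(d := z)) b * (x \<bullet> b)) = z * (x \<bullet> d) + (\<Sum>b\<in>Basis - D - {d}. (a(d := z)) b * (x \<bullet> b))"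
          using d by (subst sum.remove[of _ d]) auto
        also have "(\<Sum>b\<in>Basis - D - {d}. (a(d := z)) b * (x \<bullet> b)) = (\<Sum>b\<in>Basis - insert d D. a b * (x \<bullet> b))"
          by (rule sum.cong) auto
        finally show ?thesis by (simp add: w_def exp_add distrib_left algebra_simps)
      qed
      have wI: "(CLINT x|\<mu>. w x * iexp (z \<bullet> (x \<bullet> d))) = (CLINT x|\<nu>. w x * iexp (z \<bullet> (x \<bullet> d)))" for z
        unfolding inner_real_def wz by (rule insert.IH[OF d(3)])
      have base: "(CLINT x|\<mu>. iexp (z \<bullet> (x \<bullet> d))) = (CLINT x|\<nu>. iexp (z \<bullet> (x \<bullet> d)))" for z
        using cf[of "z *\<^sub>R d"] by (simp add: char_fun_def inner_commute)
      have "(CLINT x|\<mu>. w x * indicator (B d) (x \<bullet> d)) = (CLINT x|\<nu>. w x * indicator (B d) (x \<bullet> d))"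
        by (rule weighted_char_transfer[OF finite_measure_eqI_char_real fin])
           (use wb base wI in auto)
      then show ?case
        using insert.hyps by (simp add: w_def mult.commute mult.assoc mult.left_commute)
    qed
  qed
  have box: "emeasure \<mu> (box a b) = emeasure \<nu> (box a b)" for a b
  proof -
    have "box a b = {x. \<forall>i\<in>Basis. x \<bullet> i \<in> {a \<bullet> i<..<b \<bullet> i}}" by (auto simp: box_def)
    then have ind: "(\<Prod>i\<in>Basis. indicator {a \<bullet> i<..<b \<bullet> i} (x \<bullet> i)) = (indicator (box a b) x :: complex)" for x
      by (auto simp: indicator_def prod_eq_1_iff intro!: prod.neutral)
    have "(CLINT x|\<mu>. indicator (box a b) x) = (CLINT x|\<nu>. indicator (box a b) x)"
      using mixed[of Basis "\<lambda>i. {a \<bullet> i<..<b \<bullet> i}"] by (simp add: ind)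
    then have "measure \<mu> (box a b) = measure \<nu> (box a b)"
      by (simp add: sp integral_indicator_complex)
    then show ?thesis by (simp add: m.emeasure_eq_measure n.emeasure_eq_measure)
  qed
  have gen: "sets borel = sigma_sets UNIV (range (\<lambda>(a, b). box a (b::'a)))"
    by (subst borel_eq_box) simp
  show ?thesis
  proof (rule measure_eqI_generator_eq[where E="range (\<lambda>(a, b). box a (b::'a))" and \<Omega>=UNIV
      and A="\<lambda>n::nat. box (- (real n *\<^sub>R One)) (real n *\<^sub>R One)"])
    show "Int_stable (range (\<lambda>(a, b). box a (b::'a)))"
      by (auto intro!: Int_stableI exI simp: box_Int_box image_iff)
    show "(\<Union>n::nat. box (- (real n *\<^sub>R One)) (real n *\<^sub>R One)) = (UNIV :: 'a set)"
      by (rule UN_box_eq_UNIV)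
  qed (use box gen sets in auto)
qed

text \<open>The exchange of exponentials for indicators is repeated with the variables
  \<open>X k\<close> in place of coordinates. Two weights on the same space are compared: the random
  product of the other factors, and the constant \<open>c\<close> that this product would contribute
  under independence.\<close>

lemma (in prob_space) indep_vars_char_funI:
  fixes X :: "'i \<Rightarrow> 'a \<Rightarrow> 'b::euclidean_space"
  assumes I: "finite I" and X[measurable]: "\<And>k. k \<in> I \<Longrightarrow> X k \<in> borel_measurable M"
    and cf: "\<And>z. (CLINT x|M. iexp (\<Sum>k\<in>I. z k \<bullet> X k x)) = (\<Prod>k\<in>I. char_fun (distr M borel (X k)) (z k))"
  shows "indep_vars (\<lambda>_. borel) X I"
proof (cases "I = {}")
  case True
  then show ?thesis by (simp add: indep_vars_def indep_sets_def)
next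
  case False
  have cf1: "char_fun (distr M borel (X k)) z = (CLINT x|M. iexp (z \<bullet> X k x))" if "k \<in> I" for k z
    unfolding char_fun_def using X[OF that] by (subst integral_distr) auto
  have cfb: "norm (char_fun (distr M borel (X k)) z) \<le> 1" if "k \<in> I" for k z
  proof -
    have "norm (char_fun (distr M borel (X k)) z) \<le> (LINT x|M. norm (iexp (z \<bullet> X k x)))"
      unfolding cf1[OF that] by (rule integral_norm_bound)
    then show ?thesis by (simp add: prob_space)
  qed
  have mixed: "(CLINT x|M. (\<Prod>k\<in>J. indicator (B k) (X k x)) * iexp (\<Sum>k\<in>I - J. z k \<bullet> X k x)) =
     complex_of_real (\<Prod>k\<in>J. measure (distr M borel (X k)) (B k)) * (\<Prod>k\<in>I - J. char_fun (distr M borel (X k)) (z k))"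
    if "J \<subseteq> I" "\<And>k. B k \<in> sets borel" for J B z
  proof -
    have "finite J" using finite_subset[OF that(1) I] .
    then show ?thesis using that(1)
    proof (induction J arbitrary: z)
      case empty
      then show ?case using cf by simp
    next
      case (insert d J)
      then have d: "d \<in> I" "d \<notin> J" "J \<subseteq> I" "finite J" by auto
      have [measurable]: "B k \<in> sets borel" for k by fact
      have [measurable]: "X k \<in> borel_measurable M" if "k \<in> J \<or> k \<in> I - insert d J \<or> k = d" for k
        using d that by auto
      define w where "w = (\<lambda>x. (\<Prod>k\<in>J. indicator (B k) (X k x)) * iexp (\<Sum>k\<in>I - insert d J. z k \<bullet> X k x))"
      define c where "c = complex_of_real (\<Prod>k\<in>J. measure (distr M borel (X k)) (B k)) * (\<Prod>k\<in>I - insert d J. char_fun (distr M borel (X k)) (z k))"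
      have [measurable]: "w \<in> borel_measurable M" unfolding w_def by measurable
      have wb: "norm (w x) \<le> 1" for x
        unfolding w_def by (auto simp: norm_mult prod_norm[symmetric] intro!: prod_le_1 simp: indicator_def)
      have cb: "norm c \<le> 1"
      proof -
        have "\<bar>measure (distr M borel (X k)) (B k)\<bar> \<le> 1" if "k \<in> J" for k
          using prob_space.prob_le_1[OF prob_space_distr[of "X k" borel]] that by simp
        then show ?thesis unfolding c_def norm_mult
          by (intro mult_le_one) (auto simp: prod_norm[symmetric] abs_prod intro!: prod_le_1 prod_nonneg cfb)
      qed
      have wz: "(CLINT x|M. w x * iexp (u \<bullet> X d x)) = (CLINT x|M. c * iexp (u \<bullet> X d x))" for u
      proof -
        have "w x * iexp (u \<bullet> X d x) = (\<Prod>k\<in>J. indicator (B k) (X k x)) * iexp (\<Sum>k\<in>I - J. (z(d := u)) k \<bullet> X k x)" for x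
        proof -
          have "(\<Sum>k\<in>I - J. (z(d := u)) k \<bullet> X k x) = u \<bullet> X d x + (\<Sum>k\<in>I - J - {d}. (z(d := u)) k \<bullet> X k x)"
            using d I by (subst sum.remove[of _ d]) auto
          also have "(\<Sum>k\<in>I - J - {d}. (z(d := u)) k \<bullet> X k x) = (\<Sum>k\<in>I - insert d J. z k \<bullet> X k x)"
            by (rule sum.cong) auto
          finally show ?thesis by (simp add: w_def exp_add distrib_left algebra_simps)
        qed
        moreover have "(\<Prod>k\<in>I - J. char_fun (distr M borel (X k)) ((z(d := u)) k)) =
          char_fun (distr M borel (X d)) u * (\<Prod>k\<in>I - insert d J. char_fun (distr M borel (X k)) (z k))"
        proof -
          have "(\<Prod>k\<in>I - J. char_fun (distr M borel (X k)) ((z(d := u)) k)) =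
            char_fun (distr M borel (X d)) u * (\<Prod>k\<in>I - J - {d}. char_fun (distr M borel (X k)) ((z(d := u)) k))"
            using d I by (subst prod.remove[of _ d]) auto
          also have "(\<Prod>k\<in>I - J - {d}. char_fun (distr M borel (X k)) ((z(d := u)) k)) = (\<Prod>k\<in>I - insert d J. char_fun (distr M borel (X k)) (z k))"
            by (rule prod.cong) auto
          finally show ?thesis .
        qed
        ultimately show ?thesis
          using insert.IH[OF d(3), of "z(d := u)"] d(1) by (simp add: c_def cf1 mult_ac)
      qed
      have "(CLINT x|M. w x * indicator (B d) (X d x)) = (CLINT x|M. c * indicator (B d) (X d x))"
        by (rule weighted_char_transfer[OF finite_measure_eqI_char_fun])
           (use wb cb wz in \<open>auto intro: finite_measure_axioms\<close>)
      moreover have "(CLINT x|M. indicator (B d) (X d x)) = complex_of_real (measure (distr M borel (X d)) (B d))"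
      proof -
        have "(CLINT x|M. indicator (B d) (X d x)) = (CLINT x|distr M borel (X d). indicator (B d) x)"
          by (subst integral_distr) auto
        also have "\<dots> = complex_of_real (measure (distr M borel (X d)) (B d))"
          by (simp only: integral_indicator_complex) simp
        finally show ?thesis .
      qed
      ultimately show ?case
        using insert.hyps by (simp add: w_def c_def mult_ac)
    qed
  qed
  have prod: "prob (\<Inter>j\<in>I. X j -` B j \<inter> space M) = (\<Prod>j\<in>I. prob (X j -` B j \<inter> space M))"
    if B: "\<And>k. B k \<in> sets borel" for B
  proof -
    have [measurable]: "B k \<in> sets borel" for k by fact
    have "(\<Prod>k\<in>I. indicator (B k) (X k x)) = (indicator (\<Inter>j\<in>I. X j -` B j \<inter> space M) x :: complex)" if "x \<in> space M" for x
      using I False that by (auto simp: indicator_def intro!: prod.neutral)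
    then have "(CLINT x|M. indicator (\<Inter>j\<in>I. X j -` B j \<inter> space M) x) = (CLINT x|M. (\<Prod>k\<in>I. indicator (B k) (X k x)))"
      by (intro Bochner_Integration.integral_cong) auto
    also have "\<dots> = complex_of_real (\<Prod>k\<in>I. measure (distr M borel (X k)) (B k))"
      using mixed[OF subset_refl B] by simp
    also have "(\<Prod>k\<in>I. measure (distr M borel (X k)) (B k)) = (\<Prod>j\<in>I. prob (X j -` B j \<inter> space M))"
      using B by (intro prod.cong measure_distr) auto
    finally have *: "(CLINT x|M. indicator (\<Inter>j\<in>I. X j -` B j \<inter> space M) x) = complex_of_real (\<Prod>j\<in>I. prob (X j -` B j \<inter> space M))" .
    have "(\<Inter>j\<in>I. X j -` B j \<inter> space M) \<in> events"
      using I False B by (intro sets.finite_INT) auto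
    then have "(CLINT x|M. indicator (\<Inter>j\<in>I. X j -` B j \<inter> space M) x) = complex_of_real (prob (\<Inter>j\<in>I. X j -` B j \<inter> space M))"
      using sets.sets_into_space by (simp only: integral_indicator_complex) (simp add: Int_absorb2)
    with * show ?thesis by (simp only: of_real_eq_iff)
  qed
  show ?thesis
    unfolding indep_vars_def2
  proof (intro conjI ballI)
    show "random_variable borel (X i)" if "i \<in> I" for i using X[OF that] .
    show "indep_sets (\<lambda>i. {X i -` A \<inter> space M |A. A \<in> sets borel}) I"
    proof (subst indep_sets_finite[OF False I])
      show "\<forall>A\<in>Pi I (\<lambda>i. {X i -` A \<inter> space M |A. A \<in> sets borel}). prob (\<Inter>j\<in>I. A j) = (\<Prod>j\<in>I. prob (A j))"
      proof
        fix A assume "A \<in> Pi I (\<lambda>i. {X i -` A \<inter> space M |A. A \<in> sets borel})"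
        then have "\<forall>i\<in>I. \<exists>B. B \<in> sets borel \<and> A i = X i -` B \<inter> space M" by (auto simp: Pi_iff)
        then obtain B where "\<forall>i\<in>I. B i \<in> sets borel \<and> A i = X i -` B i \<inter> space M" by metis
        \<comment> \<open>Outside \<open>I\<close> the sets are put equal to \<open>UNIV\<close>,
          since \<open>prod\<close> asks for Borel sets at all indices.\<close>
        then show "prob (\<Inter>j\<in>I. A j) = (\<Prod>j\<in>I. prob (A j))"
          using prod[of "\<lambda>i. if i \<in> I then B i else UNIV"] by (auto cong: INF_cong prod.cong)
      qed
    qed (use X in \<open>auto intro!: exI[of _ UNIV]\<close>)
  qed
qed

section \<open>Products over marked arrivals\<close>

abbreviation exp_law :: "real measure" where
  "exp_law \<equiv> density lborel (exponential_density 1)"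

lemma prob_space_exp_law: "prob_space exp_law"
  by (rule prob_space_exponential_density) simp

text \<open>Since \<open>K' = - (H - 1) * K\<close>, the function
  \<open>- exp (- g) * K (x + g)\<close> is a primitive in \<open>g\<close> of
  \<open>exp (- g) * K (x + g) * H (x + g)\<close>; it tends to \<open>- K x\<close> at 0 and
  vanishes at infinity because \<open>K\<close> is bounded. The indicator inside \<open>K\<close>
  keeps the exponent finite below 0, where \<open>H - 1\<close> is not assumed integrable.\<close>

lemma exp_tail_kernel_invariant:
  fixes H :: "real \<Rightarrow> complex"
  assumes Hm[measurable]: "H \<in> borel_measurable borel"
    and cont: "continuous_on {0<..} H" and Hb: "\<And>x. norm (H x) \<le> 1"
    and int: "set_integrable lborel {0<..} (\<lambda>x. H x - 1)"
  defines "K \<equiv> \<lambda>x. exp (LINT y:{x<..}|lborel. indicator {0<..} y *\<^sub>R (H y - 1))"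
  shows "\<And>x. 0 \<le> x \<Longrightarrow> (LINT g|lborel. exponential_density 1 g *\<^sub>R (K (x + g) * H (x + g))) = K x"
    and "K \<in> borel_measurable borel"
    and "\<exists>B. \<forall>x. norm (K x) \<le> B"
    and "(K \<longlongrightarrow> 1) at_top"
proof -
  define \<phi> where "\<phi> = (\<lambda>y. indicator {0<..} y *\<^sub>R (H y - 1))"
  have \<phi>i: "integrable lborel \<phi>" using int by (simp add: set_integrable_def \<phi>_def)
  have [measurable]: "\<phi> \<in> borel_measurable borel" unfolding \<phi>_def by measurable
  define A where "A = (\<lambda>x. LINT y|lborel. indicator {x<..} y *\<^sub>R \<phi> y)"
  have KA: "K x = exp (A x)" for x by (simp add: K_def A_def \<phi>_def set_lebesgue_integral_def)
  have Ai: "integrable lborel (\<lambda>y. indicator S y *\<^sub>R \<phi> y)" if "S \<in> sets borel" for S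
    using \<phi>i that by (intro integrable_mult_indicator) auto
  define B where "B = (LINT y|lborel. norm (\<phi> y))"
  have AB: "norm (A x) \<le> B" for x
  proof -
    have "norm (A x) \<le> (LINT y|lborel. norm (indicator {x<..} y *\<^sub>R \<phi> y))"
      unfolding A_def by (rule integral_norm_bound)
    also have "\<dots> \<le> B" unfolding B_def
      using integrable_norm[OF Ai[of "{x<..}"]] \<phi>i by (intro integral_mono) (auto simp: indicator_def)
    finally show ?thesis .
  qed
  have KB: "norm (K x) \<le> exp B" for x
    unfolding KA using norm_exp[of "A x"] AB[of x] by (meson exp_le_cancel_iff order_trans)
  then show "\<exists>B. \<forall>x. norm (K x) \<le> B" by blast
  have Acont: "continuous_on UNIV A"
    unfolding continuous_on_sequentially
  proof (intro ballI allI impI, elim conjE)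
    fix X :: "nat \<Rightarrow> real" and x assume X: "X \<longlonglongrightarrow> x"
    have ae: "AE y in lborel. (\<lambda>n. indicator {X n<..} y *\<^sub>R \<phi> y) \<longlonglongrightarrow> indicator {x<..} y *\<^sub>R \<phi> y"
    proof -
      have "AE y in lborel. y \<noteq> x" by (rule AE_lborel_singleton)
      then show ?thesis
      proof eventually_elim
        case (elim y)
        then have "eventually (\<lambda>n. X n < y \<longleftrightarrow> x < y) sequentially"
        proof (cases "x < y")
          case True
          then show ?thesis using order_tendstoD(2)[OF X True] by (auto elim: eventually_mono)
        next
          case False
          then have "y < x" using elim by simp
          then show ?thesis using order_tendstoD(1)[OF X] False by (force elim!: eventually_mono)
        qed
        then have "eventually (\<lambda>n. indicator {X n<..} y *\<^sub>R \<phi> y = indicator {x<..} y *\<^sub>R \<phi> y) sequentially"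
          by eventually_elim (auto simp: indicator_def)
        then show ?case by (rule tendsto_eventually)
      qed
    qed
    have "(\<lambda>n. A (X n)) \<longlonglongrightarrow> A x"
      unfolding A_def
      by (rule integral_dominated_convergence[where w="\<lambda>y. norm (\<phi> y)"])
         (use ae \<phi>i in \<open>auto simp: indicator_def\<close>)
    then show "(A \<circ> X) \<longlonglongrightarrow> A x" by (simp add: comp_def)
  qed
  have [measurable]: "A \<in> borel_measurable borel"
    using Acont by (rule borel_measurable_continuous_onI)
  have KAf: "K = (\<lambda>x. exp (A x))" by (simp add: fun_eq_iff KA)
  show Km[measurable]: "K \<in> borel_measurable borel"
    unfolding KAf by measurable
  have Atop: "(A \<longlongrightarrow> 0) at_top"
  proof (rule tendsto_at_topI_sequentially)
    fix X :: "nat \<Rightarrow> real" assume X: "filterlim X at_top sequentially"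
    have "(\<lambda>n. LINT y|lborel. indicator {X n<..} y *\<^sub>R \<phi> y) \<longlonglongrightarrow> (LINT (y::real)|lborel. (0::complex))"
    proof (rule integral_dominated_convergence[where w="\<lambda>y. norm (\<phi> y)" and f="\<lambda>_. 0"])
      show "AE y in lborel. (\<lambda>n. indicator {X n<..} y *\<^sub>R \<phi> y) \<longlonglongrightarrow> 0"
      proof (intro AE_I2 tendsto_eventually)
        fix y
        have "eventually (\<lambda>n. y \<le> X n) sequentially" using X by (simp add: filterlim_at_top)
        then show "eventually (\<lambda>n. indicator {X n<..} y *\<^sub>R \<phi> y = 0) sequentially"
          by eventually_elim (auto simp: indicator_def)
      qed
    qed (use \<phi>i in \<open>auto simp: indicator_def\<close>)
    then show "(\<lambda>n. A (X n)) \<longlonglongrightarrow> 0" by (simp add: A_def)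
  qed
  show "(K \<longlongrightarrow> 1) at_top"
    unfolding KAf using tendsto_exp[OF Atop] by simp
  \<comment> \<open>\<open>H\<close> is continuous only on the open half-line, so the fundamental
    theorem is applied on the compact interval from \<open>x / 2\<close> to \<open>2 * x\<close>,
    where \<open>A\<close> is a constant minus an integral with moving upper end.\<close>
  have Aderiv: "(A has_vector_derivative - (H x - 1)) (at x)" if x: "0 < x" for x
  proof -
    define a b where "a = x/2" and "b = 2*x"
    have ab: "0 < a" "a < x" "x < b" using x by (auto simp: a_def b_def)
    have diff: "A u = A a - (LBINT y=a..u. (H y - 1))" if u: "u \<in> {a..b}" for u
    proof -
      have "A a = (LINT y|lborel. indicator {a<..u} y *\<^sub>R \<phi> y + indicator {u<..} y *\<^sub>R \<phi> y)"
        unfolding A_def using u by (intro Bochner_Integration.integral_cong) (auto simp: indicator_def)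
      also have "\<dots> = (LINT y|lborel. indicator {a<..u} y *\<^sub>R \<phi> y) + A u"
        unfolding A_def by (rule Bochner_Integration.integral_add) (auto intro: Ai)
      also have "(LINT y|lborel. indicator {a<..u} y *\<^sub>R \<phi> y) = (LINT y:{a<..u}|lborel. (H y - 1))"
        unfolding set_lebesgue_integral_def using ab
        by (intro Bochner_Integration.integral_cong) (auto simp: indicator_def \<phi>_def)
      also have "\<dots> = (LBINT y=a..u. (H y - 1))"
        using u by (simp add: interval_integral_Ioc)
      finally show ?thesis by simp
    qed
    have c2: "continuous_on {a..b} (\<lambda>y. H y - 1)"
      using ab by (intro continuous_intros continuous_on_subset[OF cont]) auto
    have "((\<lambda>u. LBINT y=a..u. (H y - 1)) has_vector_derivative (H x - 1)) (at x within {a..b})"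
      by (rule interval_integral_FTC2[OF _ _ c2]) (use ab in auto)
    then have "((\<lambda>u. A a - (LBINT y=a..u. (H y - 1))) has_vector_derivative 0 - (H x - 1)) (at x within {a..b})"
      by (intro has_vector_derivative_diff has_vector_derivative_const)
    then have "(A has_vector_derivative 0 - (H x - 1)) (at x within {a..b})"
    proof (rule has_vector_derivative_transform[rotated 2])
      show "A u = A a - (LBINT y=a..u. (H y - 1))" if "u \<in> {a..b}" for u by (rule diff[OF that])
    qed (use ab in auto)
    moreover have "at x within {a..b} = at x" using ab by (intro at_within_Icc_at) auto
    ultimately show ?thesis by simp
  qed
  have Kderiv: "(K has_vector_derivative - (H x - 1) * K x) (at x)" if x: "0 < x" for x
  proof -
    have "((exp \<circ> A) has_vector_derivative (- (H x - 1) * exp (A x))) (at x)"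
      by (rule field_vector_diff_chain_at[OF Aderiv[OF x] DERIV_exp])
    then show ?thesis by (simp add: KAf comp_def)
  qed
  show "(LINT g|lborel. exponential_density 1 g *\<^sub>R (K (x + g) * H (x + g))) = K x" if x: "0 \<le> x" for x
  proof -
    define f where "f = (\<lambda>g. exp (- g) *\<^sub>R (K (x + g) * H (x + g)))"
    define F where "F = (\<lambda>g. - (exp (- g) *\<^sub>R K (x + g)))"
    have ie: "integrable lborel (\<lambda>g. exponential_density 1 g)"
    proof (rule integrableI_nonneg)
      have "(\<integral>\<^sup>+ g. ennreal (exponential_density 1 g) \<partial>lborel) = emeasure (exp_law) UNIV"
        by (subst emeasure_density) auto
      also have "\<dots> = 1"
        using prob_space.emeasure_space_1[OF prob_space_exponential_density[of 1]] by simp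
      finally show "(\<integral>\<^sup>+ g. ennreal (exponential_density 1 g) \<partial>lborel) < \<infinity>" by simp
    qed (auto simp: exponential_density_nonneg)
    have fi: "set_integrable lborel {0<..} f"
      unfolding set_integrable_def
    proof (rule Bochner_Integration.integrable_bound)
      show "integrable lborel (\<lambda>g. exp B * exponential_density 1 g)" using ie by simp
      show "AE g in lborel. norm (indicator {0<..} g *\<^sub>R f g) \<le> norm (exp B * exponential_density 1 g)"
      proof (intro AE_I2)
        fix g :: real
        have "norm (K (x + g) * H (x + g)) \<le> exp B * 1"
          unfolding norm_mult using KB Hb by (intro mult_mono) auto
        then show "norm (indicator {0<..} g *\<^sub>R f g) \<le> norm (exp B * exponential_density 1 g)"
          by (auto simp: f_def indicator_def exponential_density_def mult.commute)
      qed
    qed (unfold f_def, measurable)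
    \<comment> \<open>The case \<open>x = 0\<close> is included: at the left end a right limit of
      the primitive is enough, and this follows from the continuity of \<open>K\<close>.\<close>
    have "(LBINT g=0..\<infinity>. f g) = 0 - (- K x)"
    proof (rule interval_integral_FTC_integrable[where F=F])
      show "(F has_vector_derivative f g) (at g)" if "0 < ereal g" "ereal g < \<infinity>" for g
      proof -
        have xg: "0 < x + g" using x that by simp
        have "((K \<circ> (\<lambda>g. x + g)) has_vector_derivative (1 *\<^sub>R (- (H (x + g) - 1) * K (x + g)))) (at g)"
          by (rule vector_diff_chain_at) (use Kderiv[OF xg] in \<open>auto intro!: derivative_eq_intros\<close>)
        then have kd: "((\<lambda>g. K (x + g)) has_vector_derivative (- (H (x + g) - 1) * K (x + g))) (at g)"
          by (simp add: comp_def)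
        have "((\<lambda>g. exp (- g)) has_real_derivative - exp (- g)) (at g)"
          by (auto intro!: derivative_eq_intros)
        from has_vector_derivative_scaleR[OF this kd]
        have "((\<lambda>g. - (exp (- g) *\<^sub>R K (x + g))) has_vector_derivative
            - (exp (- g) *\<^sub>R (- (H (x + g) - 1) * K (x + g)) + (- exp (- g)) *\<^sub>R K (x + g))) (at g)"
          by (rule has_vector_derivative_minus)
        then show ?thesis unfolding F_def
          by (rule has_vector_derivative_eq_rhs) (simp add: f_def algebra_simps)
      qed
      show "isCont f g" if "0 < ereal g" "ereal g < \<infinity>" for g
      proof -
        have xg: "0 < x + g" using x that by simp
        have "isCont H (x + g)" using cont xg by (simp add: continuous_on_eq_continuous_at)
        moreover have "isCont K (x + g)" using Kderiv[OF xg] by (rule has_vector_derivative_continuous)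
        ultimately have "isCont (\<lambda>g. H (x + g)) g" "isCont (\<lambda>g. K (x + g)) g"
          by (simp_all add: isCont_o2[where f="\<lambda>g. x + g" and g=H] isCont_o2[where f="\<lambda>g. x + g" and g=K])
        then show ?thesis unfolding f_def by (intro continuous_intros)
      qed
      show "set_integrable lborel (einterval 0 \<infinity>) f"
        using fi by (simp add: zero_ereal_def)
      have "isCont K x" unfolding KAf using Acont
        by (intro continuous_intros) (simp add: continuous_on_eq_continuous_at)
      then have "isCont (\<lambda>g. K (x + g)) 0"
        by (simp add: isCont_o2[where f="\<lambda>g. x + g" and g=K])
      then have "isCont F 0" unfolding F_def by (intro continuous_intros)
      then have "(F \<longlongrightarrow> - K x) (at_right 0)"
        by (auto simp: isCont_def F_def intro: tendsto_within_subset)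
      then show "((F \<circ> real_of_ereal) \<longlongrightarrow> - K x) (at_right 0)"
        unfolding zero_ereal_def by (simp add: ereal_tendsto_simps)
      have "(F \<longlongrightarrow> 0) at_top"
      proof (rule Lim_null_comparison)
        show "eventually (\<lambda>g. norm (F g) \<le> exp (-g) * exp B) at_top"
          using KB by (auto simp: F_def intro!: always_eventually)
        show "((\<lambda>g. exp (-g) * exp B) \<longlongrightarrow> 0) at_top"
          by (intro tendsto_mult_left_zero) (simp add: filterlim_compose[OF exp_at_bot filterlim_uminus_at_bot_at_top])
      qed
      then show "((F \<circ> real_of_ereal) \<longlongrightarrow> 0) (at_left \<infinity>)"
        by (simp add: ereal_tendsto_simps)
    qed (use fi in auto)
    moreover have "(LBINT g=0..\<infinity>. f g) = (LINT g|lborel. exponential_density 1 g *\<^sub>R (K (x + g) * H (x + g)))"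
      unfolding interval_lebesgue_integral_0_infty set_lebesgue_integral_def
    proof (rule integral_cong_AE)
      show "AE g in lborel. indicator {0<..} g *\<^sub>R f g = exponential_density 1 g *\<^sub>R (K (x + g) * H (x + g))"
        using AE_lborel_singleton[of 0] by eventually_elim (auto simp: f_def indicator_def exponential_density_def)
    qed (unfold f_def, measurable)
    ultimately show ?thesis by simp
  qed
qed

section \<open>Independent pairs of gap and mark\<close>

lemma (in prob_space) indep_var_integral_iterated:
  fixes \<Phi> :: "'b \<times> 'b \<Rightarrow> complex"
  assumes ind: "indep_var S X T Y" and [measurable]: "\<Phi> \<in> borel_measurable (S \<Otimes>\<^sub>M T)"
    and bd: "\<And>x. norm (\<Phi> x) \<le> C"
  shows "(LINT \<omega>|M. \<Phi> (X \<omega>, Y \<omega>)) = (LINT \<omega>|M. (LINT \<omega>'|M. \<Phi> (X \<omega>, Y \<omega>')))"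
proof -
  have [measurable]: "X \<in> measurable M S" "Y \<in> measurable M T"
    using ind by (auto dest: indep_var_rv1 indep_var_rv2)
  interpret X: prob_space "distr M S X" by (rule prob_space_distr) simp
  interpret Y: prob_space "distr M T Y" by (rule prob_space_distr) simp
  interpret XY: pair_prob_space "distr M S X" "distr M T Y" ..
  have eq: "distr M (S \<Otimes>\<^sub>M T) (\<lambda>x. (X x, Y x)) = distr M S X \<Otimes>\<^sub>M distr M T Y"
    using ind by (simp add: indep_var_distribution_eq)
  have "(LINT \<omega>|M. \<Phi> (X \<omega>, Y \<omega>)) = (LINT z|distr M (S \<Otimes>\<^sub>M T) (\<lambda>x. (X x, Y x)). \<Phi> z)"
    by (subst integral_distr) auto
  also have "\<dots> = (LINT x|distr M S X. (LINT y|distr M T Y. \<Phi> (x, y)))"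
    unfolding eq
    by (rule XY.integral_fst'[symmetric], rule XY.integrable_const_bound[of _ C]) (use bd in auto)
  also have "\<dots> = (LINT \<omega>|M. (LINT y|distr M T Y. \<Phi> (X \<omega>, y)))"
    by (subst integral_distr) auto
  also have "\<dots> = (LINT \<omega>|M. (LINT \<omega>'|M. \<Phi> (X \<omega>, Y \<omega>')))"
  proof (rule Bochner_Integration.integral_cong[OF refl])
    fix \<omega> assume "\<omega> \<in> space M"
    then have [measurable]: "X \<omega> \<in> space S" by (rule measurable_space[rotated]) simp
    show "(LINT y|distr M T Y. \<Phi> (X \<omega>, y)) = (LINT \<omega>'|M. \<Phi> (X \<omega>, Y \<omega>'))"
      by (subst integral_distr) auto
  qed
  finally show ?thesis .
qed

text \<open>Gap and mark are bundled into one pair: independence of the pairs and the product law of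
  each pair together say that the marks are independent of all gaps, and one pair can be integrated
  out at a time.\<close>

locale marked_arrivals = prob_space M for M :: "'w measure" +
  fixes G :: "nat \<Rightarrow> 'w \<Rightarrow> real" and Y :: "nat \<Rightarrow> 'w \<Rightarrow> 'y" and \<nu> :: "'y measure"
  assumes mark_prob: "prob_space \<nu>"
    and indep_marked: "indep_vars (\<lambda>_. borel \<Otimes>\<^sub>M \<nu>) (\<lambda>j \<omega>. (G j \<omega>, Y j \<omega>)) UNIV"
    and law_marked: "\<And>j. distr M (borel \<Otimes>\<^sub>M \<nu>) (\<lambda>\<omega>. (G j \<omega>, Y j \<omega>)) =
          exp_law \<Otimes>\<^sub>M \<nu>"
begin

lemma marked_measurable [measurable]:
  "G j \<in> borel_measurable M" "Y j \<in> measurable M \<nu>"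
proof -
  have "(\<lambda>\<omega>. (G j \<omega>, Y j \<omega>)) \<in> measurable M (borel \<Otimes>\<^sub>M \<nu>)"
    using indep_marked by (auto simp: indep_vars_def)
  from measurable_compose[OF this measurable_fst] measurable_compose[OF this measurable_snd]
  show "G j \<in> borel_measurable M" "Y j \<in> measurable M \<nu>" by simp_all
qed

lemma distr_G: "distr M borel (G j) = exp_law"
proof -
  interpret \<nu>: prob_space \<nu> by (rule mark_prob)
  interpret e: prob_space exp_law by (rule prob_space_exp_law)
  interpret pair_prob_space exp_law \<nu> ..
  have "distr M borel (G j) = distr (distr M (borel \<Otimes>\<^sub>M \<nu>) (\<lambda>\<omega>. (G j \<omega>, Y j \<omega>))) borel fst"
    by (subst distr_distr) (auto simp: comp_def)
  also have "\<dots> = distr (exp_law \<Otimes>\<^sub>M \<nu>) (exp_law) fst"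
    unfolding law_marked by (rule distr_cong) auto
  also have "\<dots> = exp_law"
    by (rule \<nu>.distr_pair_fst)
  finally show ?thesis .
qed

definition arrival :: "nat \<Rightarrow> 'w \<Rightarrow> real" where
  "arrival n \<omega> = (\<Sum>i<n. G i \<omega>)"

lemma arrival_measurable[measurable]: "arrival n \<in> borel_measurable M"
  unfolding arrival_def by measurable

lemma AE_G_nonneg: "AE \<omega> in M. \<forall>j. 0 \<le> G j \<omega>"
proof -
  have "AE \<omega> in M. 0 \<le> G j \<omega>" for j
  proof -
    have "AE x in distr M borel (G j). 0 \<le> x"
      unfolding distr_G by (subst AE_density) (auto simp: exponential_density_def)
    then show ?thesis by (subst (asm) AE_distr_iff) auto
  qed
  then show ?thesis by (simp add: AE_all_countable)
qed

lemma AE_arrival_nonneg: "AE \<omega> in M. \<forall>n. 0 \<le> arrival n \<omega>"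
  using AE_G_nonneg by eventually_elim (auto simp: arrival_def intro: sum_nonneg)

abbreviation hist :: "nat \<Rightarrow> 'w \<Rightarrow> nat \<Rightarrow> real \<times> 'y" where
  "hist n \<omega> \<equiv> restrict (\<lambda>i. (G i \<omega>, Y i \<omega>)) {..<n}"

text \<open>This is conditioning on the first \<open>n\<close> pairs: the history is frozen and the
  new pair is integrated against its own law. The history takes values in a product space over
  \<open>{..<n}\<close>, so that independence over disjoint index sets applies to it as a
  whole.\<close>

lemma integral_marked_step:
  fixes \<Phi> :: "(nat \<Rightarrow> real \<times> 'y) \<times> (real \<times> 'y) \<Rightarrow> complex"
  assumes [measurable]: "\<Phi> \<in> borel_measurable (PiM {..<n} (\<lambda>_. borel \<Otimes>\<^sub>M \<nu>) \<Otimes>\<^sub>M (borel \<Otimes>\<^sub>M \<nu>))"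
    and bd: "\<And>x. norm (\<Phi> x) \<le> C"
  shows "(LINT \<omega>|M. \<Phi> (hist n \<omega>, (G n \<omega>, Y n \<omega>))) =
    (LINT \<omega>|M. (LINT z|(exp_law \<Otimes>\<^sub>M \<nu>). \<Phi> (hist n \<omega>, z)))"
proof -
  have "indep_var (PiM {..<n} (\<lambda>_. borel \<Otimes>\<^sub>M \<nu>)) (\<lambda>\<omega>. hist n \<omega>)
      (PiM {n} (\<lambda>_. borel \<Otimes>\<^sub>M \<nu>)) (\<lambda>\<omega>. restrict (\<lambda>i. (G i \<omega>, Y i \<omega>)) {n})"
    by (rule indep_var_restrict[OF indep_marked]) auto
  moreover have "norm (case x of (f, g) \<Rightarrow> \<Phi> (f, g n)) \<le> C" for x :: "(nat \<Rightarrow> real \<times> 'y) \<times> (nat \<Rightarrow> real \<times> 'y)"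
    using bd by (simp add: split_beta)
  ultimately
  have "(LINT \<omega>|M. \<Phi> (hist n \<omega>, (G n \<omega>, Y n \<omega>))) =
     (LINT \<omega>|M. (LINT \<omega>'|M. \<Phi> (hist n \<omega>, (G n \<omega>', Y n \<omega>'))))"
    using indep_var_integral_iterated[of _ _ _ _ "\<lambda>(f, g). \<Phi> (f, g n)" C] by fastforce
  also have "\<dots> = (LINT \<omega>|M. (LINT z|distr M (borel \<Otimes>\<^sub>M \<nu>) (\<lambda>\<omega>. (G n \<omega>, Y n \<omega>)). \<Phi> (hist n \<omega>, z)))"
  proof (rule Bochner_Integration.integral_cong[OF refl])
    fix \<omega> assume "\<omega> \<in> space M"
    then have [measurable]: "hist n \<omega> \<in> space (PiM {..<n} (\<lambda>_. borel \<Otimes>\<^sub>M \<nu>))"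
      by (auto simp: space_PiM space_pair_measure intro: measurable_space[OF marked_measurable(2)])
    show "(LINT \<omega>'|M. \<Phi> (hist n \<omega>, (G n \<omega>', Y n \<omega>'))) =
        (LINT z|distr M (borel \<Otimes>\<^sub>M \<nu>) (\<lambda>\<omega>. (G n \<omega>, Y n \<omega>)). \<Phi> (hist n \<omega>, z))"
      by (subst integral_distr) auto
  qed
  finally show ?thesis by (simp add: law_marked)
qed

text \<open>Chernoff's bound with exponent 1: the mean of \<open>exp (- G j)\<close> is 1/2, and
  Markov's inequality for \<open>exp (n / 2 - arrival n)\<close> contributes the factor
  \<open>exp (1/2) / 2\<close> for each gap.\<close>

lemma prob_arrival_le: "prob {\<omega>\<in>space M. arrival n \<omega> \<le> real n / 2} \<le> (exp (1/2) / 2) ^ n"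
proof -
  interpret e: prob_space exp_law by (rule prob_space_exp_law)
  have indG: "indep_vars (\<lambda>_. borel) (\<lambda>j \<omega>. exp (- G j \<omega>)) {..<n}"
  proof -
    have "indep_vars (\<lambda>_. borel) (\<lambda>j \<omega>. exp (- fst (G j \<omega>, Y j \<omega>))) UNIV"
      by (rule indep_vars_compose2[OF indep_marked, where Y="\<lambda>_ z. exp (- fst z)"]) measurable
    then show ?thesis using indep_vars_subset[of "\<lambda>_. borel" "\<lambda>j \<omega>. exp (- G j \<omega>)" UNIV "{..<n}"] by simp
  qed
  have one: "(\<integral>\<^sup>+ \<omega>. ennreal (exp (- G j \<omega>)) \<partial>M) = ennreal (1/2)" for j
  proof -
    have "(\<integral>\<^sup>+ \<omega>. ennreal (exp (- G j \<omega>)) \<partial>M) = (\<integral>\<^sup>+ x. ennreal (exp (- x)) \<partial>distr M borel (G j))"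
      by (subst nn_integral_distr) auto
    also have "\<dots> = (\<integral>\<^sup>+ x. ennreal (exponential_density 1 x) * ennreal (exp (- x)) \<partial>lborel)"
      unfolding distr_G by (subst nn_integral_density) auto
    \<comment> \<open>Tilting by \<open>exp (- x)\<close> turns the rate 1 into 2; the factor 1/2
      restores the normalisation.\<close>
    also have "\<dots> = (\<integral>\<^sup>+ x. ennreal (1/2) * ennreal (exponential_density 2 x) \<partial>lborel)"
    proof (intro nn_integral_cong)
      fix x :: real
      have "exponential_density 1 x * exp (- x) = 1/2 * exponential_density 2 x"
        by (simp add: exponential_density_def exp_add[symmetric])
      then show "ennreal (exponential_density 1 x) * ennreal (exp (- x)) = ennreal (1/2) * ennreal (exponential_density 2 x)"
        by (simp only: ennreal_mult[symmetric] exponential_density_nonneg exp_ge_zero zero_less_numeral zero_less_one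
            divide_nonneg_nonneg zero_le_one zero_le_numeral)
    qed
    also have "\<dots> = ennreal (1/2) * emeasure (density lborel (exponential_density 2)) UNIV"
      by (subst nn_integral_cmult) (auto simp: emeasure_density)
    also have "\<dots> = ennreal (1/2)"
      using prob_space.emeasure_space_1[OF prob_space_exponential_density[of 2]] by simp
    finally show ?thesis .
  qed
  have "emeasure M {\<omega>\<in>space M. arrival n \<omega> \<le> real n / 2} = (\<integral>\<^sup>+ \<omega>. indicator {\<omega>\<in>space M. arrival n \<omega> \<le> real n / 2} \<omega> \<partial>M)"
    by simp
  also have "\<dots> \<le> (\<integral>\<^sup>+ \<omega>. ennreal (exp (1/2) ^ n) * (\<Prod>i<n. ennreal (exp (- G i \<omega>))) \<partial>M)"
  proof (rule nn_integral_mono)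
    fix \<omega>
    have eq: "ennreal (exp (1/2) ^ n) * (\<Prod>i<n. ennreal (exp (- G i \<omega>))) = ennreal (exp (real n / 2 - arrival n \<omega>))"
      by (simp add: prod_ennreal ennreal_mult[symmetric] prod_nonneg exp_of_nat_mult[symmetric] arrival_def
          exp_sum[symmetric] exp_add[symmetric] sum_negf)
    show "indicator {\<omega>\<in>space M. arrival n \<omega> \<le> real n / 2} \<omega> \<le> ennreal (exp (1/2) ^ n) * (\<Prod>i<n. ennreal (exp (- G i \<omega>)))"
      unfolding eq by (auto simp: indicator_def)
  qed
  also have "\<dots> = ennreal (exp (1/2) ^ n) * (\<integral>\<^sup>+ \<omega>. (\<Prod>i<n. ennreal (exp (- G i \<omega>))) \<partial>M)"
    by (rule nn_integral_cmult) measurable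
  also have "(\<integral>\<^sup>+ \<omega>. (\<Prod>i<n. ennreal (exp (- G i \<omega>))) \<partial>M) = (\<Prod>i<n. \<integral>\<^sup>+ \<omega>. ennreal (exp (- G i \<omega>)) \<partial>M)"
  proof -
    have "indep_vars (\<lambda>_. borel) (\<lambda>j \<omega>. ennreal (exp (- G j \<omega>))) {..<n}"
      by (rule indep_vars_compose2[OF indG, where Y="\<lambda>_. ennreal"]) measurable
    then show ?thesis by (intro indep_vars_nn_integral) auto
  qed
  also have "ennreal (exp (1/2) ^ n) * (\<Prod>i<n. \<integral>\<^sup>+ \<omega>. ennreal (exp (- G i \<omega>)) \<partial>M) = ennreal ((exp (1/2) / 2) ^ n)"
  proof -
    have "(\<Prod>i<n. ennreal (1/2)) = ennreal ((1/2) ^ n)"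
      by (simp only: prod_constant card_lessThan) (rule ennreal_power, simp)
    then have "ennreal (exp (1/2) ^ n) * (\<Prod>i<n. ennreal (1/2)) = ennreal (exp (1/2) ^ n * (1/2) ^ n)"
      by (simp only: ennreal_mult zero_le_power exp_ge_zero divide_nonneg_nonneg zero_le_one zero_le_numeral)
    then show ?thesis unfolding one by (simp only: power_mult_distrib[symmetric]) simp
  qed
  finally show ?thesis by (simp add: emeasure_eq_measure)
qed

text \<open>Since e < 4, the bounds of \<open>prob_arrival_le\<close> form a convergent geometric
  series, and Borel-Cantelli applies.\<close>

lemma AE_arrival_linear: "AE \<omega> in M. eventually (\<lambda>n. real n / 2 < arrival n \<omega>) sequentially"
proof -
  have "exp (1/2::real) < 2"
  proof -
    have "exp (1/2::real) ^ 2 < 2 ^ 2" using e_less_272 by (simp add: exp_of_nat_mult[symmetric])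
    then show ?thesis by (rule power_less_imp_less_base) simp
  qed
  then have sm: "summable (\<lambda>n. (exp (1/2::real) / 2) ^ n)" by (intro summable_geometric) auto
  have "AE \<omega> in M. eventually (\<lambda>n. \<omega> \<in> space M - {\<omega>\<in>space M. arrival n \<omega> \<le> real n / 2}) sequentially"
  proof (rule borel_cantelli_AE1)
    show "summable (\<lambda>n. prob {\<omega>\<in>space M. arrival n \<omega> \<le> real n / 2})"
      by (rule summable_comparison_test'[OF sm, of 0]) (use prob_arrival_le in auto)
  qed (auto simp: emeasure_eq_measure)
  then show ?thesis
    by eventually_elim (auto elim: eventually_mono)
qed

lemma AE_arrival_at_top: "AE \<omega> in M. filterlim (\<lambda>n. arrival n \<omega>) at_top sequentially"
  using AE_arrival_linear
proof eventually_elim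
  case (elim \<omega>)
  have "filterlim (\<lambda>n. real n / 2) at_top sequentially"
    using filterlim_tendsto_pos_mult_at_top[OF tendsto_const[of "1/2::real"] _ filterlim_real_sequentially] by simp
  then show ?case by (rule filterlim_at_top_mono) (use elim in \<open>auto elim: eventually_mono\<close>)
qed

text \<open>Nothing is assumed about convergence of the random products: they have modulus at most 1
  and \<open>K\<close> tends to 1 along the arrivals, so inserting \<open>K\<close> at the last
  arrival changes the mean by a vanishing amount. The conclusion is therefore a limit of
  expectations, to be matched later with the almost sure limit of the series.\<close>

theorem expectation_prod_arrivals_tendsto:
  fixes h :: "real \<Rightarrow> 'y \<Rightarrow> complex"
  assumes h[measurable]: "(\<lambda>(x, y). h x y) \<in> borel_measurable (borel \<Otimes>\<^sub>M \<nu>)"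
    and hb: "\<And>x y. norm (h x y) \<le> 1"
  defines "H \<equiv> \<lambda>x. (LINT y|\<nu>. h x y)"
  assumes cont: "continuous_on {0<..} H"
    and int: "set_integrable lborel {0<..} (\<lambda>x. H x - 1)"
  shows "(\<lambda>n. (LINT \<omega>|M. (\<Prod>j<n. h (arrival (Suc j) \<omega>) (Y j \<omega>)))) \<longlonglongrightarrow>
     exp (LINT x:{0<..}|lborel. H x - 1)"
proof -
  interpret \<nu>: prob_space \<nu> by (rule mark_prob)
  interpret e: prob_space exp_law by (rule prob_space_exp_law)
  interpret pp: pair_prob_space exp_law \<nu> ..
  have Hm[measurable]: "H \<in> borel_measurable borel"
    unfolding H_def by measurable
  have Hb: "norm (H x) \<le> 1" for x
  proof -
    have "norm (H x) \<le> (LINT y|\<nu>. norm (h x y))" unfolding H_def by (rule integral_norm_bound)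
    also have "\<dots> \<le> (LINT y|\<nu>. 1)"
      using hb by (intro integral_mono \<nu>.integrable_const_bound[of _ 1]) auto
    finally show ?thesis by (simp add: \<nu>.prob_space)
  qed
  define K where "K = (\<lambda>x. exp (LINT y:{x<..}|lborel. indicator {0<..} y *\<^sub>R (H y - 1)))"
  have Kf: "\<And>x. 0 \<le> x \<Longrightarrow> (LINT g|lborel. exponential_density 1 g *\<^sub>R (K (x + g) * H (x + g))) = K x"
    "K \<in> borel_measurable borel" "\<exists>B. \<forall>x. norm (K x) \<le> B" "(K \<longlongrightarrow> 1) at_top"
    unfolding K_def by (fact exp_tail_kernel_invariant[OF Hm cont Hb int])+
  have Km[measurable]: "K \<in> borel_measurable borel" by (rule Kf(2))
  obtain C0 where C0: "\<And>x. norm (K x) \<le> C0" using Kf(3) by blast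
  define C where "C = max 1 C0"
  have C: "norm (K x) \<le> C" "0 \<le> C" for x using C0[of x] by (auto simp: C_def)
  have pb: "norm (\<Prod>j<n. h (f j) (g j)) \<le> 1" for n :: nat and f g
    using hb by (auto simp: prod_norm[symmetric] intro!: prod_le_1)
  have pm: "(\<lambda>\<omega>. (\<Prod>j<n. h (arrival (Suc j) \<omega>) (Y j \<omega>))) \<in> borel_measurable M" for n
  proof (intro borel_measurable_prod)
    fix j
    have "(\<lambda>\<omega>. (arrival (Suc j) \<omega>, Y j \<omega>)) \<in> measurable M (borel \<Otimes>\<^sub>M \<nu>)" by measurable
    from measurable_compose[OF this h]
    show "(\<lambda>\<omega>. h (arrival (Suc j) \<omega>) (Y j \<omega>)) \<in> borel_measurable M" by simp
  qed
  \<comment> \<open>One step of the induction integrates out the pair with index \<open>n\<close>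
    and uses the invariance of \<open>K\<close> at \<open>x = arrival n\<close>, which is
    nonnegative almost surely.\<close>
  have mart: "(LINT \<omega>|M. (\<Prod>j<n. h (arrival (Suc j) \<omega>) (Y j \<omega>)) * K (arrival n \<omega>)) = K 0" for n
  proof (induction n)
    case 0
    show ?case by (simp add: arrival_def prob_space)
  next
    case (Suc n)
    \<comment> \<open>The integrand as a function of history and new pair: the old factors read only
      the first \<open>n\<close> coordinates, the new one adds the gap \<open>fst z\<close> to the
      last arrival.\<close>
    define \<Phi> where "\<Phi> = (\<lambda>(f :: nat \<Rightarrow> real \<times> 'y, z :: real \<times> 'y).
       (\<Prod>j<n. h (\<Sum>i\<le>j. fst (f i)) (snd (f j))) *
        (h ((\<Sum>i<n. fst (f i)) + fst z) (snd z) * K ((\<Sum>i<n. fst (f i)) + fst z)))"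
    have \<Phi>m: "\<Phi> \<in> borel_measurable (PiM {..<n} (\<lambda>_. borel \<Otimes>\<^sub>M \<nu>) \<Otimes>\<^sub>M (borel \<Otimes>\<^sub>M \<nu>))"
    proof -
      have 0: "(\<lambda>p. fst p i) \<in> measurable (PiM {..<n} (\<lambda>_. borel \<Otimes>\<^sub>M \<nu>) \<Otimes>\<^sub>M (borel \<Otimes>\<^sub>M \<nu>)) (borel \<Otimes>\<^sub>M \<nu>)"
        if "i < n" for i
        using that by (auto intro!: measurable_compose[OF measurable_fst measurable_component_singleton])
      have 1: "(\<lambda>p. fst (fst p i)) \<in> borel_measurable (PiM {..<n} (\<lambda>_. borel \<Otimes>\<^sub>M \<nu>) \<Otimes>\<^sub>M (borel \<Otimes>\<^sub>M \<nu>))"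
        "(\<lambda>p. snd (fst p i)) \<in> measurable (PiM {..<n} (\<lambda>_. borel \<Otimes>\<^sub>M \<nu>) \<Otimes>\<^sub>M (borel \<Otimes>\<^sub>M \<nu>)) \<nu>"
        if "i < n" for i
        using measurable_compose[OF 0[OF that] measurable_fst] measurable_compose[OF 0[OF that] measurable_snd] by auto
      have 2: "(\<lambda>p. h (f p) (g p)) \<in> borel_measurable N"
        if "f \<in> borel_measurable N" "g \<in> measurable N \<nu>" for f g and N :: "'z measure"
        using measurable_compose[OF measurable_Pair[OF that] h] by simp
      show ?thesis unfolding \<Phi>_def split_beta
        by (intro borel_measurable_times borel_measurable_prod 2 borel_measurable_sum borel_measurable_add 1
            measurable_compose[OF _ Km] measurable_compose[OF measurable_snd measurable_fst]
            measurable_compose[OF measurable_snd measurable_snd]) auto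
    qed
    have \<Phi>b: "norm (\<Phi> x) \<le> C" for x
    proof -
      have "norm (\<Phi> x) \<le> 1 * (1 * C)"
        unfolding \<Phi>_def split_beta norm_mult using C hb pb
        by (intro mult_mono mult_nonneg_nonneg) auto
      then show ?thesis by simp
    qed
    have arr: "(\<Sum>i\<le>j. G i \<omega>) = arrival (Suc j) \<omega>" for j \<omega>
      by (simp add: arrival_def lessThan_Suc_atMost)
    have \<Phi>eq: "\<Phi> (hist n \<omega>, z) =
        (\<Prod>j<n. h (arrival (Suc j) \<omega>) (Y j \<omega>)) * (h (arrival n \<omega> + fst z) (snd z) * K (arrival n \<omega> + fst z))" for \<omega> z
    proof -
      have "(\<Sum>i\<le>j. fst (hist n \<omega> i)) = arrival (Suc j) \<omega>" if "j < n" for j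
        unfolding arr[symmetric] using that by (intro sum.cong) auto
      moreover have "(\<Sum>i<n. fst (hist n \<omega> i)) = arrival n \<omega>"
        unfolding arrival_def by (intro sum.cong) auto
      ultimately show ?thesis unfolding \<Phi>_def by simp
    qed
    have inner: "(LINT z|(exp_law \<Otimes>\<^sub>M \<nu>). h (x + fst z) (snd z) * K (x + fst z)) = K x"
      if "0 \<le> x" for x
    proof -
      have hm: "(\<lambda>z. h (x + fst z) (snd z)) \<in> borel_measurable (borel \<Otimes>\<^sub>M \<nu>)"
      proof -
        have "(\<lambda>z. (x + fst z, snd z)) \<in> measurable (borel \<Otimes>\<^sub>M \<nu>) (borel \<Otimes>\<^sub>M \<nu>)" by measurable
        from measurable_compose[OF this h] show ?thesis by simp
      qed
      have i: "integrable (exp_law \<Otimes>\<^sub>M \<nu>) (\<lambda>z. h (x + fst z) (snd z) * K (x + fst z))"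
      proof (rule pp.integrable_const_bound[of _ C])
        have "sets (exp_law \<Otimes>\<^sub>M \<nu>) = sets (borel \<Otimes>\<^sub>M \<nu>)"
          by (intro sets_pair_measure_cong) auto
        note mc = measurable_cong_sets[OF this refl]
        show "(\<lambda>z. h (x + fst z) (snd z) * K (x + fst z)) \<in> borel_measurable (exp_law \<Otimes>\<^sub>M \<nu>)"
          unfolding mc using hm by measurable
        show "AE z in exp_law \<Otimes>\<^sub>M \<nu>. norm (h (x + fst z) (snd z) * K (x + fst z)) \<le> C"
        proof (intro AE_I2)
          fix z
          have "norm (h (x + fst z) (snd z) * K (x + fst z)) \<le> 1 * C"
            unfolding norm_mult using C hb by (intro mult_mono) auto
          then show "norm (h (x + fst z) (snd z) * K (x + fst z)) \<le> C" by simp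
        qed
      qed
      have "(LINT z|(exp_law \<Otimes>\<^sub>M \<nu>). h (x + fst z) (snd z) * K (x + fst z)) =
          (LINT g|exp_law. (LINT y|\<nu>. h (x + g) y * K (x + g)))"
        using pp.integral_fst'[OF i] by simp
      also have "\<dots> = (LINT g|exp_law. K (x + g) * H (x + g))"
        by (simp add: H_def mult.commute)
      also have "\<dots> = (LINT g|lborel. exponential_density 1 g *\<^sub>R (K (x + g) * H (x + g)))"
        by (rule integral_density) (auto simp: exponential_density_nonneg)
      also have "\<dots> = K x" by (rule Kf(1)[OF that])
      finally show ?thesis .
    qed
    have "(LINT \<omega>|M. (\<Prod>j<Suc n. h (arrival (Suc j) \<omega>) (Y j \<omega>)) * K (arrival (Suc n) \<omega>)) =
      (LINT \<omega>|M. \<Phi> (hist n \<omega>, (G n \<omega>, Y n \<omega>)))"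
      unfolding \<Phi>eq by (simp add: arrival_def mult.assoc)
    also have "\<dots> = (LINT \<omega>|M. (LINT z|(exp_law \<Otimes>\<^sub>M \<nu>). \<Phi> (hist n \<omega>, z)))"
      by (rule integral_marked_step[OF \<Phi>m \<Phi>b])
    also have "\<dots> = (LINT \<omega>|M. (\<Prod>j<n. h (arrival (Suc j) \<omega>) (Y j \<omega>)) *
       (LINT z|(exp_law \<Otimes>\<^sub>M \<nu>). h (arrival n \<omega> + fst z) (snd z) * K (arrival n \<omega> + fst z)))"
      unfolding \<Phi>eq by simp
    also have "\<dots> = (LINT \<omega>|M. (\<Prod>j<n. h (arrival (Suc j) \<omega>) (Y j \<omega>)) * K (arrival n \<omega>))"
    proof (rule integral_cong_AE)
      show "AE \<omega> in M. (\<Prod>j<n. h (arrival (Suc j) \<omega>) (Y j \<omega>)) *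
       (LINT z|(exp_law \<Otimes>\<^sub>M \<nu>). h (arrival n \<omega> + fst z) (snd z) * K (arrival n \<omega> + fst z)) =
         (\<Prod>j<n. h (arrival (Suc j) \<omega>) (Y j \<omega>)) * K (arrival n \<omega>)"
        using AE_arrival_nonneg by eventually_elim (simp add: inner)
      have "(\<lambda>x. LINT z|(exp_law \<Otimes>\<^sub>M \<nu>). h (x + fst z) (snd z) * K (x + fst z)) \<in> borel_measurable borel"
      proof (rule pp.borel_measurable_lebesgue_integral)
        have "(\<lambda>p. (fst p + fst (snd p), snd (snd p))) \<in> measurable (borel \<Otimes>\<^sub>M (exp_law \<Otimes>\<^sub>M \<nu>)) (borel \<Otimes>\<^sub>M \<nu>)"
          by measurable
        from measurable_compose[OF this h]
        show "(\<lambda>(x, z). h (x + fst z) (snd z) * K (x + fst z)) \<in> borel_measurable (borel \<Otimes>\<^sub>M (exp_law \<Otimes>\<^sub>M \<nu>))"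
          unfolding split_beta by (intro borel_measurable_times) auto
      qed
      from measurable_compose[OF arrival_measurable this]
      show "(\<lambda>\<omega>. (\<Prod>j<n. h (arrival (Suc j) \<omega>) (Y j \<omega>)) *
       (LINT z|(exp_law \<Otimes>\<^sub>M \<nu>). h (arrival n \<omega> + fst z) (snd z) * K (arrival n \<omega> + fst z))) \<in> borel_measurable M"
        by (intro borel_measurable_times pm)
      show "(\<lambda>\<omega>. (\<Prod>j<n. h (arrival (Suc j) \<omega>) (Y j \<omega>)) * K (arrival n \<omega>)) \<in> borel_measurable M"
        by (intro borel_measurable_times pm) measurable
    qed
    also have "\<dots> = K 0" by (rule Suc.IH)
    finally show ?case .
  qed
  have K0: "K 0 = exp (LINT x:{0<..}|lborel. H x - 1)"
    unfolding K_def set_lebesgue_integral_def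
    by (intro arg_cong[of _ _ exp] Bochner_Integration.integral_cong) (auto simp: indicator_def)
  define S where "S = (\<lambda>n \<omega>. \<Prod>j<n. h (arrival (Suc j) \<omega>) (Y j \<omega>))"
  have Sm[measurable]: "S n \<in> borel_measurable M" for n using pm by (simp add: S_def)
  have Si: "integrable M (S n)" for n
    by (rule integrable_const_bound[of _ 1]) (use pb in \<open>auto simp: S_def\<close>)
  have SKb: "norm (S n \<omega> * K (arrival n \<omega>)) \<le> C" for n \<omega>
    using mult_mono[OF pb C(1)] by (auto simp: norm_mult S_def)
  have SKi: "integrable M (\<lambda>\<omega>. S n \<omega> * K (arrival n \<omega>))" for n
    by (rule integrable_const_bound[of _ C]) (use SKb in auto)
  have "(\<lambda>n. LINT \<omega>|M. S n \<omega> * K (arrival n \<omega>) - S n \<omega>) \<longlonglongrightarrow> (LINT \<omega>|M. 0)"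
  proof (rule integral_dominated_convergence[where w="\<lambda>_. C + 1"])
    show "AE \<omega> in M. (\<lambda>n. S n \<omega> * K (arrival n \<omega>) - S n \<omega>) \<longlonglongrightarrow> 0"
      using AE_arrival_at_top
    proof eventually_elim
      case (elim \<omega>)
      have "(\<lambda>n. K (arrival n \<omega>)) \<longlonglongrightarrow> 1" by (rule filterlim_compose[OF Kf(4) elim])
      then have lim: "(\<lambda>n. norm (K (arrival n \<omega>) - 1)) \<longlonglongrightarrow> 0"
        by (intro tendsto_norm_zero) (simp add: LIM_zero_iff)
      show ?case
      proof (rule Lim_null_comparison[OF always_eventually lim], intro allI)
        fix n
        have "S n \<omega> * K (arrival n \<omega>) - S n \<omega> = S n \<omega> * (K (arrival n \<omega>) - 1)" by (simp add: algebra_simps)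
        then show "norm (S n \<omega> * K (arrival n \<omega>) - S n \<omega>) \<le> norm (K (arrival n \<omega>) - 1)"
          using pb by (auto simp: norm_mult S_def intro!: mult_left_le_one_le)
      qed
    qed
    show "AE \<omega> in M. norm (S n \<omega> * K (arrival n \<omega>) - S n \<omega>) \<le> C + 1" for n
      by (intro AE_I2 order_trans[OF norm_triangle_ineq4] add_mono SKb) (auto simp: S_def intro: pb)
  qed auto
  then have "(\<lambda>n. K 0 - (LINT \<omega>|M. S n \<omega>)) \<longlonglongrightarrow> 0"
    using SKi Si mart by (simp add: S_def)
  then have "(\<lambda>n. K 0 - (K 0 - (LINT \<omega>|M. S n \<omega>))) \<longlonglongrightarrow> K 0 - 0"
    by (intro tendsto_intros)
  then show ?thesis by (simp add: K0 S_def)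
qed

end

section \<open>The radial law of a jump\<close>

text \<open>Intensity of the arrival times. As a density on the whole line it keeps
  \<open>UNIV\<close> as its space, which spares domain conditions in products and images.\<close>

definition halfline :: "real measure" where
  "halfline = density lborel (indicator {0<..})"

lemma sets_halfline[simp, measurable_cong]: "sets halfline = sets borel"
  and space_halfline[simp]: "space halfline = UNIV"
  by (auto simp: halfline_def)

lemma sigma_finite_halfline: "sigma_finite_measure halfline"
  unfolding halfline_def
  by (subst sigma_finite_measure.sigma_finite_iff_density_finite[OF lborel.sigma_finite_measure_axioms]) (auto simp: indicator_def intro!: AE_I2)

lemma AE_halfline_pos: "AE x in halfline. 0 < x"
  unfolding halfline_def by (subst AE_density) (auto simp: indicator_def)

text \<open>The measures may be infinite near 0 while all tails are finite. Passing to logarithms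
  moves 0 to minus infinity, and there the half-lines \<open>{- n<..}\<close> exhaust the space and
  have finite measure; \<open>exp\<close> leads back, as both measures live on the positive
  numbers.\<close>

lemma measure_eqI_tails:
  fixes M N :: "real measure"
  assumes sets[measurable_cong]: "sets M = sets borel" "sets N = sets borel"
    and pos: "AE x in M. 0 < x" "AE x in N. 0 < x"
    and eq: "\<And>y. 0 < y \<Longrightarrow> emeasure M {y<..} = emeasure N {y<..}"
    and fin: "\<And>y. 0 < y \<Longrightarrow> emeasure M {y<..} \<noteq> \<infinity>"
  shows "M = N"
proof -
  have ln_exp: "distr (distr K borel ln) borel exp = K" if that: "sets K = sets borel" "AE x in K. 0 < x" for K :: "real measure"
  proof -
    note [measurable_cong] = that(1)
    have "distr (distr K borel ln) borel exp = distr K borel (\<lambda>x. exp (ln x))"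
      by (subst distr_distr) (auto simp: comp_def)
    also have "\<dots> = distr K K (\<lambda>x. x)"
      by (rule distr_cong_AE) (use that in auto)
    finally show ?thesis by (simp add: distr_id)
  qed
  have tail: "emeasure (distr K borel ln) {t<..} = emeasure K {exp t<..}"
    if that: "sets K = sets borel" "AE x in K. 0 < x" for K :: "real measure" and t
  proof -
    note [measurable_cong] = that(1)
    have "space K = UNIV" using sets_eq_imp_space_eq[OF that(1)] by simp
    then have "emeasure (distr K borel ln) {t<..} = emeasure K (ln -` {t<..})"
      by (subst emeasure_distr) auto
    also have "\<dots> = emeasure K {exp t<..}"
    proof (rule emeasure_eq_AE)
      show "AE x in K. (x \<in> ln -` {t<..}) = (x \<in> {exp t<..})"
        using that(2)
      proof eventually_elim
        case (elim x)
        have "t < ln x \<longleftrightarrow> exp t < x" using elim by (metis exp_less_cancel_iff exp_ln)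
        then show ?case by simp
      qed
      show "ln -` {t<..} \<in> sets K" using measurable_sets[of ln borel borel "{t<..}"] that by simp
    qed (use that in auto)
    finally show ?thesis .
  qed
  have "distr M borel ln = distr N borel ln"
  proof (rule measure_eqI_generator_eq[where E="range greaterThan" and \<Omega>=UNIV and A="\<lambda>n::nat. {- real n<..}"])
    show "Int_stable (range greaterThan :: real set set)"
    proof -
      have "{a<..} \<inter> {b<..} = {max a b<..}" for a b :: real by auto
      then show ?thesis by (auto simp: Int_stable_def)
    qed
    show "(\<Union>i. {- real i<..}) = UNIV"
    proof -
      have "\<exists>i::nat. - real i < x" for x using reals_Archimedean2[of "-x"] by (auto simp: minus_less_iff)
      then show ?thesis by auto
    qed
    show "emeasure (distr M borel ln) X = emeasure (distr N borel ln) X" if "X \<in> range greaterThan" for X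
      using that by (auto simp: tail pos sets eq)
    show "sets (distr M borel ln) = sigma_sets UNIV (range greaterThan)" "sets (distr N borel ln) = sigma_sets UNIV (range greaterThan)"
      by (simp_all, simp_all add: borel_Ioi)
    show "emeasure (distr M borel ln) {- real i<..} \<noteq> \<infinity>" for i
      unfolding tail[OF sets(1) pos(1)] by (rule fin) simp
  qed auto
  then show ?thesis using ln_exp[OF sets(1) pos(1)] ln_exp[OF sets(2) pos(2)] by metis
qed

lemma powr_minus_inverse_less_iff:
  fixes a v y :: real
  assumes "0 < a" "0 < v" "0 < y"
  shows "y < v powr (- 1 / a) \<longleftrightarrow> v < y powr (- a)"
proof -
  have e: "(y powr (- a)) powr (- 1 / a) = y" using assms by (simp add: powr_powr)
  have "v < y powr (- a) \<longleftrightarrow> (y powr (- a)) powr (- 1 / a) < v powr (- 1 / a)"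
    using assms powr_less_mono2_neg[of "- 1 / a" v "y powr (- a)"] powr_less_mono2_neg[of "- 1 / a" "y powr (- a)" v]
    by (cases v "y powr (- a)" rule: linorder_cases) auto
  then show ?thesis by (simp only: e)
qed

lemma nn_integral_powr_tail:
  fixes a y :: real
  assumes a: "0 < a" and y: "0 < y"
  shows "(\<integral>\<^sup>+ x. indicator {y<..} x * ennreal (x powr (- a - 1)) \<partial>lborel) = ennreal (y powr (- a) / a)"
proof -
  have "(\<integral>\<^sup>+ x. indicator {y<..} x * ennreal (x powr (- a - 1)) \<partial>lborel) =
    (\<integral>\<^sup>+ x. ennreal (x powr (- a - 1)) * indicator {y..} x \<partial>lborel)"
    by (rule nn_integral_cong_AE, use AE_lborel_singleton[of y] in eventually_elim) (auto simp: indicator_def)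
  also have "\<dots> = ennreal (0 - (- (y powr (- a) / a)))"
  proof (rule nn_integral_FTC_atLeast)
    show "((\<lambda>x. - (x powr (- a) / a)) has_real_derivative x powr (- a - 1)) (at x)" if "y \<le> x" for x
    proof -
      have "((\<lambda>x. - (x powr (- a) / a)) has_real_derivative - ((- a * x powr (- a - 1)) / a)) (at x)"
        using y that by (intro DERIV_minus DERIV_cdivide has_real_derivative_powr) auto
      then show ?thesis using a by simp
    qed
    show "((\<lambda>x. - (x powr (- a) / a)) \<longlongrightarrow> 0) at_top"
    proof -
      have "((\<lambda>x. x powr (- a)) \<longlongrightarrow> 0) at_top"
        using a by (intro tendsto_neg_powr filterlim_ident) auto
      then have "((\<lambda>x. - (x powr (- a) / a)) \<longlongrightarrow> - (0 / a)) at_top"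
        by (intro tendsto_intros) (use a in auto)
      then show ?thesis by simp
    qed
  qed auto
  finally show ?thesis by simp
qed

lemma emeasure_exponential_density_tail:
  assumes "0 \<le> w"
  shows "emeasure (exp_law) {w<..} = ennreal (exp (- w))"
proof -
  have "emeasure (exp_law) {w<..} =
    (\<integral>\<^sup>+ x. ennreal (exponential_density 1 x) * indicator {w<..} x \<partial>lborel)"
    by (rule emeasure_density) auto
  also have "\<dots> = (\<integral>\<^sup>+ x. ennreal (exp (- x)) * indicator {w..} x \<partial>lborel)"
    by (rule nn_integral_cong_AE, use AE_lborel_singleton[of w] in eventually_elim)
       (use assms in \<open>auto simp: indicator_def exponential_density_def\<close>)
  also have "\<dots> = ennreal (0 - (- exp (- w)))"
  proof (rule nn_integral_FTC_atLeast)
    have "((\<lambda>x::real. exp (- x)) \<longlongrightarrow> 0) at_top"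
      by (rule filterlim_compose[OF exp_at_bot filterlim_uminus_at_bot_at_top])
    then show "((\<lambda>x::real. - exp (- x)) \<longlongrightarrow> 0) at_top"
      using tendsto_minus by fastforce
  qed (auto intro!: derivative_eq_intros)
  finally show ?thesis by simp
qed

lemma prob_space_unif: "a < b \<Longrightarrow> prob_space (uniform_measure lborel {a<..<b::real})"
  by (rule prob_space_uniform_measure) auto

lemma AE_uniform_greaterThanLessThan:
  "AE x in uniform_measure lborel {a<..<b::real}. a < x \<and> x < b"
  by (rule AE_uniform_measureI) auto

text \<open>\<open>y * u powr (- 1 / a)\<close> is Pareto distributed with index \<open>a\<close>
  and scale \<open>y\<close>. Through this law the uniform variables produce the power
  \<open>x powr (- a - 1)\<close> of the Levy density.\<close>

lemma pareto_distr:
  fixes a y :: real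
  assumes a: "0 < a" and y: "0 < y"
  shows "distr (uniform_measure lborel {0<..<1}) borel (\<lambda>u. y * u powr (- 1 / a)) =
     density lborel (\<lambda>x. ennreal (a * y powr a) * (indicator {y<..} x * ennreal (x powr (- a - 1))))"
proof (rule measure_eqI_tails)
  interpret U: prob_space "uniform_measure lborel {0<..<1::real}" by (rule prob_space_unif) simp
  show "AE x in distr (uniform_measure lborel {0<..<1}) borel (\<lambda>u. y * u powr (- 1 / a)). 0 < x"
    by (subst AE_distr_iff) (use AE_uniform_greaterThanLessThan[of 0 1] y in \<open>auto elim!: eventually_mono\<close>)
  show "AE x in density lborel (\<lambda>x. ennreal (a * y powr a) * (indicator {y<..} x * ennreal (x powr (- a - 1)))). 0 < x"
    by (subst AE_density) (use y in \<open>auto simp: indicator_def split: if_splits intro!: AE_I2\<close>)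
  fix x :: real assume x: "0 < x"
  have "emeasure (distr (uniform_measure lborel {0<..<1}) borel (\<lambda>u. y * u powr (- 1 / a))) {x<..} =
     emeasure (uniform_measure lborel {0<..<1::real}) ((\<lambda>u. y * u powr (- 1 / a)) -` {x<..})"
    by (subst emeasure_distr) auto
  also have "\<dots> = emeasure (uniform_measure lborel {0<..<1}) {0<..<min 1 ((x / y) powr (- a))}"
  proof (rule emeasure_eq_AE)
    show "AE u in uniform_measure lborel {0<..<1}. (u \<in> (\<lambda>u. y * u powr (- 1 / a)) -` {x<..}) = (u \<in> {0<..<min 1 ((x / y) powr (- a))})"
      using AE_uniform_greaterThanLessThan[of 0 1]
    proof eventually_elim
      case (elim u)
      have "x < y * u powr (- 1 / a) \<longleftrightarrow> x / y < u powr (- 1 / a)" using y by (simp add: field_simps)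
      also have "\<dots> \<longleftrightarrow> u < (x / y) powr (- a)"
        using elim a x y by (intro powr_minus_inverse_less_iff) auto
      finally show ?case using elim by auto
    qed
    have "(\<lambda>u. y * u powr (- 1 / a)) \<in> borel_measurable borel" by measurable
    from measurable_sets_borel[OF this, of "{x<..}"]
    show "(\<lambda>u. y * u powr (- 1 / a)) -` {x<..} \<in> sets (uniform_measure lborel {0<..<1})" by simp
  qed auto
  also have "\<dots> = ennreal (min 1 ((x / y) powr (- a)))"
    using x y by (subst emeasure_uniform_measure) (auto simp: Int_absorb1 greaterThanLessThan_subseteq_greaterThanLessThan divide_ennreal_def)
  finally have l: "emeasure (distr (uniform_measure lborel {0<..<1}) borel (\<lambda>u. y * u powr (- 1 / a))) {x<..} = \<dots>" .
  then show "emeasure (distr (uniform_measure lborel {0<..<1}) borel (\<lambda>u. y * u powr (- 1 / a))) {x<..} \<noteq> \<infinity>"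
    by simp
  have "emeasure (density lborel (\<lambda>x. ennreal (a * y powr a) * (indicator {y<..} x * ennreal (x powr (- a - 1))))) {x<..} =
    (\<integral>\<^sup>+ z. ennreal (a * y powr a) * (indicator {y<..} z * ennreal (z powr (- a - 1))) * indicator {x<..} z \<partial>lborel)"
    by (rule emeasure_density) auto
  also have "\<dots> = (\<integral>\<^sup>+ z. ennreal (a * y powr a) * (indicator {max x y<..} z * ennreal (z powr (- a - 1))) \<partial>lborel)"
    by (intro nn_integral_cong) (auto simp: indicator_def)
  also have "\<dots> = ennreal (a * y powr a) * ennreal (max x y powr (- a) / a)"
    using y a by (subst nn_integral_cmult) (auto simp: nn_integral_powr_tail)
  also have "\<dots> = ennreal (y powr a * max x y powr (- a))"
    using a y by (subst ennreal_mult[symmetric]) auto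
  also have "y powr a * max x y powr (- a) = min 1 ((x / y) powr (- a))"
  proof (cases "x \<le> y")
    case True
    then have "(x / y) powr (- a) \<ge> 1"
      using a x y powr_mono2'[of "- a" "x / y" 1] by simp
    then show ?thesis using True y by (simp add: max_def powr_minus field_simps)
  next
    case False
    then have "(x / y) powr (- a) \<le> 1"
      using a x y powr_mono2'[of "- a" 1 "x / y"] by simp
    then show ?thesis using False x y by (simp add: max_def powr_divide powr_minus field_simps)
  qed
  finally show "emeasure (distr (uniform_measure lborel {0<..<1}) borel (\<lambda>u. y * u powr (- 1 / a))) {x<..} =
    emeasure (density lborel (\<lambda>x. ennreal (a * y powr a) * (indicator {y<..} x * ennreal (x powr (- a - 1))))) {x<..}"
    using l by simp
qed auto

section \<open>Tails of the tempered radius\<close>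

abbreviation unif_exp :: "(real \<times> real) measure" where
  "unif_exp \<equiv> uniform_measure lborel {0<..<1} \<Otimes>\<^sub>M exp_law"

lemma prob_space_unif_exp: "prob_space unif_exp"
  and sets_unif_exp[measurable_cong]: "sets unif_exp = sets (borel \<Otimes>\<^sub>M borel)"
proof -
  interpret U: prob_space "uniform_measure lborel {0<..<1::real}" by (rule prob_space_unif) simp
  interpret e: prob_space exp_law by (rule prob_space_exp_law)
  interpret pair_prob_space "uniform_measure lborel {0<..<1::real}" exp_law ..
  show "prob_space unif_exp" by unfold_locales
  show "sets unif_exp = sets (borel \<Otimes>\<^sub>M borel)" by (intro sets_pair_measure_cong) auto
qed

lemma AE_unif_exp_pos: "AE z in unif_exp. 0 < fst z \<and> fst z < 1 \<and> 0 < snd z"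
proof -
  interpret U: prob_space "uniform_measure lborel {0<..<1::real}" by (rule prob_space_unif) simp
  interpret e: prob_space exp_law by (rule prob_space_exp_law)
  interpret pair_prob_space "uniform_measure lborel {0<..<1::real}" exp_law ..
  have ep: "AE x in exp_law. 0 < x"
    by (subst AE_density, simp, use AE_lborel_singleton[of "0::real"] in eventually_elim)
       (auto simp: exponential_density_def)
  show ?thesis
  proof (rule AE_pair_measure)
    show "AE x in uniform_measure lborel {0<..<1::real}. AE y in exp_law.
       0 < fst (x, y) \<and> fst (x, y) < 1 \<and> 0 < snd (x, y)"
      using AE_uniform_greaterThanLessThan[of 0 1]
    proof eventually_elim
      case (elim x)
      show ?case using ep by eventually_elim (use elim in auto)
    qed
  qed measurable
qed

lemma sets_unif_exp_tail[measurable]: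
  "{z::real \<times> real. y < snd z powr b * fst z powr b' / c} \<in> sets (borel \<Otimes>\<^sub>M borel)"
proof -
  have "(\<lambda>z::real \<times> real. snd z powr b * fst z powr b' / c) \<in> borel_measurable (borel \<Otimes>\<^sub>M borel)" by measurable
  from measurable_sets[OF this, of "{y<..}"] show ?thesis by (simp add: vimage_def space_pair_measure)
qed

text \<open>For fixed \<open>u\<close> the inequality says that the exponential variable exceeds
  \<open>s * (y * u powr (- 1 / a)) powr p\<close>, which has probability \<open>exp\<close> of
  minus that number. The remaining mean over \<open>u\<close> is taken under the Pareto law of
  \<open>x = y * u powr (- 1 / a)\<close>.\<close>

lemma emeasure_unif_exp_tail:
  fixes p a s y :: real
  assumes p: "0 < p" and a: "0 < a" and s: "0 < s" and y: "0 < y"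
  shows "emeasure unif_exp {z. y < snd z powr (1 / p) * fst z powr (1 / a) / s powr (1 / p)} =
    ennreal (a * y powr a) * (\<integral>\<^sup>+ x. indicator {y<..} x * ennreal (exp (- (s * x powr p)) * x powr (- a - 1)) \<partial>lborel)"
proof -
  interpret U: prob_space "uniform_measure lborel {0<..<1::real}" by (rule prob_space_unif) simp
  interpret e: prob_space exp_law by (rule prob_space_exp_law)
  interpret pair_prob_space "uniform_measure lborel {0<..<1::real}" exp_law ..
  let ?C = "{z::real \<times> real. y < snd z powr (1 / p) * fst z powr (1 / a) / s powr (1 / p)}"
  have C: "?C \<in> sets unif_exp" unfolding sets_unif_exp by (rule sets_unif_exp_tail)
  have "emeasure unif_exp ?C = (\<integral>\<^sup>+ u. emeasure (exp_law) (Pair u -` ?C) \<partial>uniform_measure lborel {0<..<1})"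
    by (rule e.emeasure_pair_measure_alt[OF C])
  also have "\<dots> = (\<integral>\<^sup>+ u. ennreal (exp (- (s * (y * u powr (- 1 / a)) powr p))) \<partial>uniform_measure lborel {0<..<1})"
  proof (rule nn_integral_cong_AE, use AE_uniform_greaterThanLessThan[of 0 1] in eventually_elim)
    case (elim u)
    let ?w = "s * (y * u powr (- 1 / a)) powr p"
    have "emeasure (exp_law) (Pair u -` ?C) = emeasure (exp_law) {?w<..}"
    proof (rule emeasure_eq_AE)
      have ep: "AE x in exp_law. 0 < x"
        by (subst AE_density, simp, use AE_lborel_singleton[of "0::real"] in eventually_elim)
           (auto simp: exponential_density_def)
      then show "AE x in exp_law. (x \<in> Pair u -` ?C) = (x \<in> {?w<..})"
      proof eventually_elim
        case (elim x)
        have "y < x powr (1 / p) * u powr (1 / a) / s powr (1 / p) \<longleftrightarrow> (s powr (1 / p) * (y * u powr (- 1 / a))) < x powr (1 / p)"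
          using s y \<open>0 < u \<and> u < 1\<close> by (simp add: powr_minus field_simps)
        also have "s powr (1 / p) * (y * u powr (- 1 / a)) = ?w powr (1 / p)"
          using s y p \<open>0 < u \<and> u < 1\<close> by (simp add: powr_mult powr_powr)
        also have "?w powr (1 / p) < x powr (1 / p) \<longleftrightarrow> ?w < x"
          using elim p s y \<open>0 < u \<and> u < 1\<close> powr_less_mono2[of "1 / p" ?w x] powr_less_mono2[of "1 / p" x ?w]
          by (cases ?w x rule: linorder_cases) auto
        finally show ?case by simp
      qed
    qed (use measurable_sets[OF measurable_Pair1' C, of u] in auto)
    also have "\<dots> = ennreal (exp (- ?w))"
      using s by (intro emeasure_exponential_density_tail) auto
    finally show ?case .
  qed
  also have "\<dots> = (\<integral>\<^sup>+ x. ennreal (exp (- (s * x powr p))) \<partial>distr (uniform_measure lborel {0<..<1}) borel (\<lambda>u. y * u powr (- 1 / a)))"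
    by (subst nn_integral_distr) auto
  also have "\<dots> = (\<integral>\<^sup>+ x. ennreal (a * y powr a) * (indicator {y<..} x * ennreal (x powr (- a - 1))) * ennreal (exp (- (s * x powr p))) \<partial>lborel)"
    unfolding pareto_distr[OF a y] by (subst nn_integral_density) auto
  also have "\<dots> = (\<integral>\<^sup>+ x. ennreal (a * y powr a) * (indicator {y<..} x * ennreal (exp (- (s * x powr p)) * x powr (- a - 1))) \<partial>lborel)"
    by (intro nn_integral_cong) (auto simp: indicator_def ennreal_mult mult_ac)
  also have "\<dots> = ennreal (a * y powr a) * (\<integral>\<^sup>+ x. indicator {y<..} x * ennreal (exp (- (s * x powr p)) * x powr (- a - 1)) \<partial>lborel)"
    by (rule nn_integral_cmult) auto
  finally show ?thesis .
qed

text \<open>Up to a null set the condition describes the interval from 0 to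
  \<open>c * y powr (- a) / a\<close>; its length is the tail of the stable measure without
  tempering.\<close>

lemma emeasure_halfline_power_tail:
  fixes a c y :: real
  assumes a: "0 < a" and c: "0 < c" and y: "0 < y"
  shows "emeasure halfline {x. y < (a * x / c) powr (- 1 / a)} = ennreal (c * y powr (- a) / a)"
proof -
  have "emeasure halfline {x. y < (a * x / c) powr (- 1 / a)} = emeasure halfline {0<..<c * y powr (- a) / a}"
  proof (rule emeasure_eq_AE)
    show "AE x in halfline. (x \<in> {x. y < (a * x / c) powr (- 1 / a)}) = (x \<in> {0<..<c * y powr (- a) / a})"
      using AE_halfline_pos
    proof eventually_elim
      case (elim x)
      have "y < (a * x / c) powr (- 1 / a) \<longleftrightarrow> a * x / c < y powr (- a)"
        using elim a c y by (intro powr_minus_inverse_less_iff) auto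
      then show ?case using elim a c by (auto simp: field_simps)
    qed
  qed auto
  also have "\<dots> = (\<integral>\<^sup>+ x. indicator {0<..} x * indicator {0<..<c * y powr (- a) / a} x \<partial>lborel)"
    unfolding halfline_def by (subst emeasure_density) auto
  also have "\<dots> = (\<integral>\<^sup>+ x. indicator {0<..<c * y powr (- a) / a} x \<partial>lborel)"
    by (intro nn_integral_cong) (auto simp: indicator_def)
  also have "\<dots> = ennreal (c * y powr (- a) / a)" using a c by simp
  finally show ?thesis .
qed

text \<open>A minimum exceeds \<open>y\<close> exactly when both entries do, and these depend on
  different factors of the product measure, so the tails multiply. The factor
  \<open>c * y powr (- a) / a\<close> of the arrival cancels the factor \<open>a * y powr a\<close>
  of the other tail up to \<open>c\<close>; this is the purpose of the minimum in the
  series.\<close>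

lemma radial_distr:
  fixes p a s c :: real
  assumes p: "0 < p" and a: "0 < a" and s: "0 < s" and c: "0 < c"
  shows "distr (halfline \<Otimes>\<^sub>M unif_exp) borel
      (\<lambda>z. min ((a * fst z / c) powr (- 1 / a)) (snd (snd z) powr (1 / p) * fst (snd z) powr (1 / a) / s powr (1 / p))) =
    density lborel (\<lambda>r. ennreal c * (indicator {0<..} r * ennreal (exp (- (s * r powr p)) * r powr (- a - 1))))"
proof (rule measure_eqI_tails)
  interpret ue: prob_space unif_exp by (rule prob_space_unif_exp)
  interpret h: sigma_finite_measure halfline by (rule sigma_finite_halfline)
  interpret hu: pair_sigma_finite halfline unif_exp ..
  let ?f = "\<lambda>z. min ((a * fst z / c) powr (- 1 / a)) (snd (snd z) powr (1 / p) * fst (snd z) powr (1 / a) / s powr (1 / p))"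
  have [measurable]: "?f \<in> borel_measurable (halfline \<Otimes>\<^sub>M unif_exp)" by measurable
  have "AE z in halfline \<Otimes>\<^sub>M unif_exp. 0 < ?f z"
  proof (rule hu.AE_pair_measure)
    show "AE x in halfline. AE z in unif_exp. 0 < ?f (x, z)"
      using AE_halfline_pos
    proof eventually_elim
      case (elim x)
      show ?case using AE_unif_exp_pos by eventually_elim (use elim a c s in auto)
    qed
  qed measurable
  then show "AE x in distr (halfline \<Otimes>\<^sub>M unif_exp) borel ?f. 0 < x"
    by (subst AE_distr_iff) auto
  show "AE x in density lborel (\<lambda>r. ennreal c * (indicator {0<..} r * ennreal (exp (- (s * r powr p)) * r powr (- a - 1)))). 0 < x"
    by (subst AE_density) (auto simp: indicator_def split: if_splits intro!: AE_I2)
  fix y :: real assume y: "0 < y"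
  let ?I = "\<integral>\<^sup>+ x. indicator {y<..} x * ennreal (exp (- (s * x powr p)) * x powr (- a - 1)) \<partial>lborel"
  have "emeasure (distr (halfline \<Otimes>\<^sub>M unif_exp) borel ?f) {y<..} = emeasure (halfline \<Otimes>\<^sub>M unif_exp) (?f -` {y<..} \<inter> space (halfline \<Otimes>\<^sub>M unif_exp))"
    by (rule emeasure_distr) auto
  also have "?f -` {y<..} \<inter> space (halfline \<Otimes>\<^sub>M unif_exp) =
     {x. y < (a * x / c) powr (- 1 / a)} \<times> {z. y < snd z powr (1 / p) * fst z powr (1 / a) / s powr (1 / p)}"
    by (auto simp: space_pair_measure)
  also have "emeasure (halfline \<Otimes>\<^sub>M unif_exp) \<dots> =
     emeasure halfline {x. y < (a * x / c) powr (- 1 / a)} * emeasure unif_exp {z. y < snd z powr (1 / p) * fst z powr (1 / a) / s powr (1 / p)}"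
    by (rule ue.emeasure_pair_measure_Times) (simp, simp only: sets_unif_exp sets_unif_exp_tail)
  also have "\<dots> = ennreal (c * y powr (- a) / a) * (ennreal (a * y powr a) * ?I)"
    using assms y by (simp only: emeasure_halfline_power_tail emeasure_unif_exp_tail)
  also have "\<dots> = ennreal c * ?I"
    unfolding mult.assoc[symmetric] using a c y
    by (subst ennreal_mult[symmetric]) (auto simp: powr_minus field_simps)
  also have "\<dots> = (\<integral>\<^sup>+ x. ennreal c * (indicator {y<..} x * ennreal (exp (- (s * x powr p)) * x powr (- a - 1))) \<partial>lborel)"
    by (rule nn_integral_cmult[symmetric]) auto
  also have "\<dots> = (\<integral>\<^sup>+ x. ennreal c * (indicator {0<..} x * ennreal (exp (- (s * x powr p)) * x powr (- a - 1))) * indicator {y<..} x \<partial>lborel)"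
    using y by (intro nn_integral_cong) (auto simp: indicator_def)
  also have "\<dots> = emeasure (density lborel (\<lambda>r. ennreal c * (indicator {0<..} r * ennreal (exp (- (s * r powr p)) * r powr (- a - 1))))) {y<..}"
    by (rule emeasure_density[symmetric]) auto
  finally show "emeasure (distr (halfline \<Otimes>\<^sub>M unif_exp) borel ?f) {y<..} =
    emeasure (density lborel (\<lambda>r. ennreal c * (indicator {0<..} r * ennreal (exp (- (s * r powr p)) * r powr (- a - 1))))) {y<..}" .
  \<comment> \<open>For finiteness it suffices to drop the condition on the second entry, since the
    arrival alone has finite tails.\<close>
  have "emeasure (distr (halfline \<Otimes>\<^sub>M unif_exp) borel ?f) {y<..} = emeasure (halfline \<Otimes>\<^sub>M unif_exp) (?f -` {y<..} \<inter> space (halfline \<Otimes>\<^sub>M unif_exp))"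
    by (rule emeasure_distr) auto
  also have "\<dots> \<le> emeasure (halfline \<Otimes>\<^sub>M unif_exp) ({x. y < (a * x / c) powr (- 1 / a)} \<times> space unif_exp)"
  proof (rule emeasure_mono)
    show "{x. y < (a * x / c) powr (- 1 / a)} \<times> space unif_exp \<in> sets (halfline \<Otimes>\<^sub>M unif_exp)"
      by (rule pair_measureI) (simp, rule sets.top)
  qed (auto simp: space_pair_measure)
  also have "\<dots> = emeasure halfline {x. y < (a * x / c) powr (- 1 / a)} * emeasure unif_exp (space unif_exp)"
    by (rule ue.emeasure_pair_measure_Times) measurable
  also have "\<dots> < \<infinity>" unfolding emeasure_halfline_power_tail[OF a c y] ue.emeasure_space_1 by simp
  finally show "emeasure (distr (halfline \<Otimes>\<^sub>M unif_exp) borel ?f) {y<..} \<noteq> \<infinity>" by simp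
qed auto

section \<open>The Levy measure as an image measure\<close>

text \<open>A summand of the series without its time indicator, as a function of the arrival
  \<open>x\<close> and the mark \<open>m\<close>; \<open>c\<close> stands for the product of the
  mass of \<open>sg\<close> and \<open>T\<close>. For \<open>v = 0\<close> the value is 0.\<close>

definition jump :: "real \<Rightarrow> real \<Rightarrow> real \<Rightarrow> real \<Rightarrow> 'a::euclidean_space \<times> real \<times> real \<Rightarrow> 'a" where
  "jump p \<alpha> c x m = (case m of (v, u, e) \<Rightarrow>
     min ((\<alpha> * x / c) powr (- 1 / \<alpha>)) (e powr (1 / p) * u powr (1 / \<alpha>) / norm v powr (1 / p)) *\<^sub>R (v /\<^sub>R norm v))"

lemma jump_measurable[measurable]:
  "(\<lambda>z. jump p \<alpha> c (fst z) (snd z)) \<in> borel_measurable (borel \<Otimes>\<^sub>M (borel \<Otimes>\<^sub>M (borel \<Otimes>\<^sub>M borel)))"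
  unfolding jump_def split_beta by measurable

lemma jump_uminus: "jump p \<alpha> c x (- v, z) = - jump p \<alpha> c x (v, z)"
  by (simp add: jump_def split_beta)

lemma norm_jump_le:
  assumes "0 < \<alpha>" "0 < c" "0 < x"
  shows "norm (jump p \<alpha> c x m) \<le> (\<alpha> / c) powr (- 1 / \<alpha>) * x powr (- 1 / \<alpha>)"
proof -
  obtain v u e where m: "m = (v, u, e)" by (cases m)
  let ?g = "min ((\<alpha> * x / c) powr (- 1 / \<alpha>)) (e powr (1 / p) * u powr (1 / \<alpha>) / norm v powr (1 / p))"
  have g: "0 \<le> ?g" by simp
  have "norm (jump p \<alpha> c x m) = ?g * norm (v /\<^sub>R norm v)"
    unfolding jump_def m split using g by (simp only: norm_scaleR abs_of_nonneg)
  also have "\<dots> \<le> ?g * 1"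
    by (intro mult_left_mono g) (cases "v = 0", auto)
  also have "\<dots> \<le> (\<alpha> * x / c) powr (- 1 / \<alpha>)" by simp
  also have "\<alpha> * x / c = (\<alpha> / c) * x" by simp
  also have "\<dots> powr (- 1 / \<alpha>) = (\<alpha> / c) powr (- 1 / \<alpha>) * x powr (- 1 / \<alpha>)"
    by (rule powr_mult)
  finally show ?thesis .
qed

section \<open>Directions and tempering rates on the sphere\<close>

locale tempered_data =
  fixes sg :: "'a::euclidean_space measure" and Qk :: "'a \<Rightarrow> real measure" and p \<alpha> T :: real
  assumes p_pos: "0 < p" and alpha: "0 < \<alpha>" "\<alpha> < 2" and T_pos: "0 < T"
    and sigma_sets: "sets sg = sets borel"
    and sigma_fin: "finite_measure sg"
    and sigma_supp: "emeasure sg (UNIV - sphere 0 1) = 0"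
    and sigma_nz: "emeasure sg (sphere 0 1) \<noteq> 0"
    and Qk_prob: "\<forall>u\<in>sphere 0 1. prob_space (Qk u) \<and> sets (Qk u) = sets borel \<and>
                     emeasure (Qk u) {..0} = 0"
    and Qk_meas: "\<forall>A\<in>sets borel.
                     (\<lambda>u. emeasure (Qk u) A) \<in> borel_measurable (restrict_space borel (sphere 0 1))"
begin

declare sigma_sets[measurable_cong]

lemma sphere_sets[measurable]: "sphere (0::'a) 1 \<in> sets borel"
  by (simp add: borel_closed)

lemma space_sg: "space sg = UNIV"
  using sets_eq_imp_space_eq[OF sigma_sets] by simp

definition ns :: real where "ns = measure sg (space sg)"

lemma ns_pos: "0 < ns"
proof -
  interpret finite_measure sg by (rule sigma_fin)
  have "0 < emeasure sg (sphere 0 1)" using sigma_nz by (simp add: zero_less_iff_neq_zero)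
  also have "\<dots> \<le> emeasure sg (space sg)" using sigma_sets by (intro emeasure_mono) (auto simp: space_sg)
  finally show ?thesis by (simp add: ns_def emeasure_eq_measure)
qed

text \<open>\<open>Qk\<close> is controlled on the unit sphere only; a point mass elsewhere
  completes it to a measurable kernel on the whole space, the form in which it enters the mixture
  defining \<open>Q\<close>.\<close>

definition kernel :: "'a \<Rightarrow> real measure" where
  "kernel u = (if u \<in> sphere 0 1 then Qk u else return borel 1)"

lemma kernel_measurable[measurable]: "kernel \<in> measurable borel (subprob_algebra borel)"
proof (rule measurable_subprob_algebra)
  show "subprob_space (kernel a)" for a
    using Qk_prob by (auto simp: kernel_def intro!: prob_space_imp_subprob_space prob_space_return)
  show "sets (kernel a) = sets borel" for a
    using Qk_prob by (auto simp: kernel_def)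
  fix A :: "real set" assume A[measurable]: "A \<in> sets borel"
  have "(\<lambda>u. if u \<in> sphere 0 1 then emeasure (Qk u) A else indicator A 1) \<in> borel_measurable borel"
  proof (subst measurable_If_restrict_space_iff)
    show "{u \<in> space borel. u \<in> sphere (0::'a) 1} \<in> sets borel" using sphere_sets by simp
    show "(\<lambda>u. emeasure (Qk u) A) \<in> borel_measurable (restrict_space borel {u. u \<in> sphere 0 1}) \<and>
        (\<lambda>u. indicator A 1) \<in> borel_measurable (restrict_space borel {u :: 'a. u \<notin> sphere 0 1})"
      unfolding Collect_mem_eq using bspec[OF Qk_meas A] by (intro conjI measurable_const) simp_all
  qed
  moreover have "(\<lambda>u. emeasure (kernel u) A) = (\<lambda>u. if u \<in> sphere 0 1 then emeasure (Qk u) A else indicator A 1)"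
  proof (rule ext)
    fix u
    show "emeasure (kernel u) A = (if u \<in> sphere 0 1 then emeasure (Qk u) A else indicator A 1)"
      unfolding kernel_def using emeasure_return[OF A, of 1] by (cases "u \<in> sphere 0 1") (simp_all only: if_True if_False)
  qed
  ultimately show "(\<lambda>u. emeasure (kernel u) A) \<in> borel_measurable borel" by simp
qed

text \<open>\<open>measure_of\<close> returns the given set function only if that is countably
  additive. This is obtained by recognising it as the \<open>emeasure\<close> of a mixture: choose
  \<open>u\<close> on the sphere by \<open>sg\<close>, then \<open>s\<close> by \<open>Qk u\<close>,
  and return \<open>s *\<^sub>R u\<close>.\<close>

lemma Q_measure_eq_bind:
  "Q_measure sg Qk = density sg (indicator (sphere 0 1)) \<bind> (\<lambda>u. distr (kernel u) borel (\<lambda>s. s *\<^sub>R u))" (is "_ = ?B")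
    and kernel_distr_measurable: "(\<lambda>u. distr (kernel u) borel (\<lambda>s. s *\<^sub>R u)) \<in> measurable (density sg (indicator (sphere 0 1))) (subprob_algebra borel)"
proof -
  have "(\<lambda>u. distr (kernel u) borel (\<lambda>s. s *\<^sub>R u)) \<in> measurable borel (subprob_algebra (borel :: 'a measure))"
    by (rule measurable_distr2[OF _ kernel_measurable]) measurable
  then show K: "(\<lambda>u. distr (kernel u) borel (\<lambda>s. s *\<^sub>R u)) \<in> measurable (density sg (indicator (sphere 0 1))) (subprob_algebra borel)"
    by (subst measurable_cong_sets[OF _ refl, of _ borel]) (auto simp: sigma_sets)
  have sB: "sets ?B = sets borel" by (rule sets_bind_measurable[OF K]) (simp add: space_sg)
  have spB: "space ?B = UNIV" using sets_eq_imp_space_eq[OF sB] by simp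
  have em: "emeasure ?B A = (\<integral>\<^sup>+ u. indicator (sphere 0 1) u * (\<integral>\<^sup>+ s. indicator A (s *\<^sub>R u) \<partial>(Qk u)) \<partial>sg)"
    if A[measurable]: "A \<in> sets borel" for A
  proof -
    have meas: "(\<lambda>u. emeasure (distr (kernel u) borel (\<lambda>s. s *\<^sub>R u)) A) \<in> borel_measurable sg"
      using measurable_compose[OF K measurable_emeasure_subprob_algebra[OF A]]
      by (subst (asm) measurable_cong_sets[of _ sg]) auto
    have "emeasure ?B A = (\<integral>\<^sup>+ u. emeasure (distr (kernel u) borel (\<lambda>s. s *\<^sub>R u)) A \<partial>density sg (indicator (sphere 0 1)))"
      by (rule emeasure_bind[OF _ K A]) (simp add: space_sg)
    also have "\<dots> = (\<integral>\<^sup>+ u. indicator (sphere 0 1) u * emeasure (distr (kernel u) borel (\<lambda>s. s *\<^sub>R u)) A \<partial>sg)"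
      by (rule nn_integral_density) (use meas in auto)
    also have "\<dots> = (\<integral>\<^sup>+ u. indicator (sphere 0 1) u * (\<integral>\<^sup>+ s. indicator A (s *\<^sub>R u) \<partial>(Qk u)) \<partial>sg)"
    proof (intro nn_integral_cong)
      fix u
      show "indicator (sphere 0 1) u * emeasure (distr (kernel u) borel (\<lambda>s. s *\<^sub>R u)) A = indicator (sphere 0 1) u * (\<integral>\<^sup>+ s. indicator A (s *\<^sub>R u) \<partial>(Qk u))"
      proof (cases "u \<in> sphere 0 1")
        case True
        then have [measurable_cong]: "sets (Qk u) = sets borel" using Qk_prob by auto
        have "emeasure (distr (Qk u) borel (\<lambda>s. s *\<^sub>R u)) A = (\<integral>\<^sup>+ v. indicator A v \<partial>distr (Qk u) borel (\<lambda>s. s *\<^sub>R u))"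
          by simp
        also have "\<dots> = (\<integral>\<^sup>+ s. indicator A (s *\<^sub>R u) \<partial>(Qk u))"
          by (rule nn_integral_distr) auto
        finally show ?thesis using True by (simp add: kernel_def)
      qed simp
    qed
    finally show ?thesis .
  qed
  have "Q_measure sg Qk = measure_of UNIV (sets borel) (emeasure ?B)"
    unfolding Q_measure_def
    by (rule measure_of_eq) (auto simp: em sets.sigma_sets_eq[of borel, simplified])
  also have "\<dots> = ?B"
    using measure_of_of_measure[of ?B] by (simp only: sB spB)
  finally show "Q_measure sg Qk = ?B" .
qed

lemma nn_integral_Q_measure:
  assumes f[measurable]: "f \<in> borel_measurable borel"
  shows "(\<integral>\<^sup>+ v. f v \<partial>Q_measure sg Qk) = (\<integral>\<^sup>+ u. indicator (sphere 0 1) u * (\<integral>\<^sup>+ s. f (s *\<^sub>R u) \<partial>(Qk u)) \<partial>sg)"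
proof -
  have meas: "(\<lambda>u. \<integral>\<^sup>+ v. f v \<partial>distr (kernel u) borel (\<lambda>s. s *\<^sub>R u)) \<in> borel_measurable sg"
    using measurable_compose[OF kernel_distr_measurable nn_integral_measurable_subprob_algebra[OF f]]
    by (subst (asm) measurable_cong_sets[of _ sg]) auto
  have "(\<integral>\<^sup>+ v. f v \<partial>Q_measure sg Qk) =
    (\<integral>\<^sup>+ u. \<integral>\<^sup>+ v. f v \<partial>distr (kernel u) borel (\<lambda>s. s *\<^sub>R u) \<partial>density sg (indicator (sphere 0 1)))"
    unfolding Q_measure_eq_bind by (rule nn_integral_bind[OF f kernel_distr_measurable])
  also have "\<dots> = (\<integral>\<^sup>+ u. indicator (sphere 0 1) u * (\<integral>\<^sup>+ v. f v \<partial>distr (kernel u) borel (\<lambda>s. s *\<^sub>R u)) \<partial>sg)"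
    by (rule nn_integral_density) (use meas in auto)
  also have "\<dots> = (\<integral>\<^sup>+ u. indicator (sphere 0 1) u * (\<integral>\<^sup>+ s. f (s *\<^sub>R u) \<partial>(Qk u)) \<partial>sg)"
  proof (intro nn_integral_cong)
    fix u
    show "indicator (sphere 0 1) u * (\<integral>\<^sup>+ v. f v \<partial>distr (kernel u) borel (\<lambda>s. s *\<^sub>R u)) = indicator (sphere 0 1) u * (\<integral>\<^sup>+ s. f (s *\<^sub>R u) \<partial>(Qk u))"
    proof (cases "u \<in> sphere 0 1")
      case True
      then have [measurable_cong]: "sets (Qk u) = sets borel" using Qk_prob by auto
      have "(\<integral>\<^sup>+ v. f v \<partial>distr (Qk u) borel (\<lambda>s. s *\<^sub>R u)) = (\<integral>\<^sup>+ s. f (s *\<^sub>R u) \<partial>(Qk u))"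
        by (rule nn_integral_distr) auto
      then show ?thesis using True by (simp add: kernel_def)
    qed simp
  qed
  finally show ?thesis .
qed

lemma sets_Q_measure[simp, measurable_cong]: "sets (Q_measure sg Qk) = sets borel"
  unfolding Q_measure_def using sets.sigma_sets_eq[of "borel :: 'a measure"] by simp

definition VL :: "'a measure" where "VL = scale_measure (ennreal (1 / ns)) (Q_measure sg Qk)"

lemma sets_VL[simp, measurable_cong]: "sets VL = sets borel"
  and space_VL[simp]: "space VL = UNIV"
  using sets_eq_imp_space_eq[OF sets_Q_measure] by (auto simp: VL_def space_scale_measure)

lemma nn_integral_VL:
  assumes [measurable]: "f \<in> borel_measurable borel"
  shows "(\<integral>\<^sup>+ v. f v \<partial>VL) = ennreal (1 / ns) * (\<integral>\<^sup>+ u. indicator (sphere 0 1) u * (\<integral>\<^sup>+ s. f (s *\<^sub>R u) \<partial>(Qk u)) \<partial>sg)"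
  unfolding VL_def by (subst nn_integral_scale_measure) (auto simp: nn_integral_Q_measure)

lemma AE_Qk_pos:
  assumes "u \<in> sphere 0 1"
  shows "AE s in Qk u. 0 < s"
proof -
  have s: "sets (Qk u) = sets borel" "emeasure (Qk u) {..0} = 0" using Qk_prob assms by auto
  then have "{..0} \<in> null_sets (Qk u)" by auto
  from AE_not_in[OF this] show ?thesis by eventually_elim auto
qed

lemma prob_space_VL: "prob_space VL"
proof
  interpret finite_measure sg by (rule sigma_fin)
  have "emeasure VL UNIV = (\<integral>\<^sup>+ v. 1 \<partial>VL)" by simp
  also have "\<dots> = ennreal (1 / ns) * (\<integral>\<^sup>+ u. indicator (sphere 0 1) u * (\<integral>\<^sup>+ s. 1 \<partial>(Qk u)) \<partial>sg)"
    by (rule nn_integral_VL) simp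
  also have "(\<integral>\<^sup>+ u. indicator (sphere 0 1) u * (\<integral>\<^sup>+ s. 1 \<partial>(Qk u)) \<partial>sg) = (\<integral>\<^sup>+ u. 1 \<partial>sg)"
  proof (rule nn_integral_cong_AE)
    have "UNIV - sphere 0 1 \<in> null_sets sg" using sigma_supp sigma_sets by auto
    from AE_not_in[OF this] show "AE u in sg. indicator (sphere 0 1) u * (\<integral>\<^sup>+ s. 1 \<partial>(Qk u)) = 1"
      by eventually_elim (use Qk_prob in \<open>auto simp: prob_space.emeasure_space_1\<close>)
  qed
  also have "(\<integral>\<^sup>+ u. 1 \<partial>sg) = ennreal ns" by (simp add: ns_def emeasure_eq_measure)
  also have "ennreal (1 / ns) * ennreal ns = 1"
    using ns_pos by (subst ennreal_mult[symmetric]) auto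
  finally show "emeasure VL (space VL) = 1" by simp
qed

lemma AE_VL_nonzero: "AE v in VL. v \<noteq> 0"
proof -
  have "emeasure VL {0} = (\<integral>\<^sup>+ v. indicator {0} v \<partial>VL)" by simp
  also have "\<dots> = ennreal (1 / ns) * (\<integral>\<^sup>+ u. indicator (sphere 0 1) u * (\<integral>\<^sup>+ s. indicator {0} (s *\<^sub>R u) \<partial>(Qk u)) \<partial>sg)"
    by (rule nn_integral_VL) simp
  also have "(\<integral>\<^sup>+ u. indicator (sphere 0 1) u * (\<integral>\<^sup>+ s. indicator {0} (s *\<^sub>R u) \<partial>(Qk u)) \<partial>sg) = (\<integral>\<^sup>+ u. 0 \<partial>sg)"
  proof (intro nn_integral_cong)
    fix u :: 'a
    show "indicator (sphere 0 1) u * (\<integral>\<^sup>+ s. indicator {0} (s *\<^sub>R u) \<partial>(Qk u)) = (0::ennreal)"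
    proof (cases "u \<in> sphere 0 1")
      case True
      have "(\<integral>\<^sup>+ s. indicator {0} (s *\<^sub>R u) \<partial>(Qk u)) = (\<integral>\<^sup>+ s. 0 \<partial>(Qk u))"
      proof (rule nn_integral_cong_AE, use AE_Qk_pos[OF True] in eventually_elim)
        case (elim s)
        then show ?case using True by (auto simp: indicator_def)
      qed
      then show ?thesis by simp
    qed simp
  qed
  finally have "emeasure VL {0} = 0" by simp
  then have "{0} \<in> null_sets VL" by auto
  from AE_not_in[OF this] show ?thesis by simp
qed

text \<open>With the mark vector integrated last, the inner integral over arrival, uniform and
  exponential variable is radial, and \<open>radial_distr\<close> evaluates it with
  \<open>s = norm v\<close>. In polar form \<open>v = s *\<^sub>R u\<close> the average of
  \<open>exp (- (s * r powr p))\<close> over \<open>Qk u\<close> is the tempering function. Of the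
  constants, \<open>ns * T\<close> comes from the radial law and \<open>1 / ns\<close> from
  \<open>VL\<close>, which leaves \<open>T\<close>.\<close>

lemma tempered_levy_measure_eq:
  "tempered_levy_measure sg Qk p \<alpha> =
     density (distr (halfline \<Otimes>\<^sub>M (VL \<Otimes>\<^sub>M unif_exp)) borel (\<lambda>z. jump p \<alpha> (ns * T) (fst z) (snd z))) (\<lambda>_. ennreal (1 / T))"
  (is "_ = density ?N _")
proof -
  interpret ue: prob_space unif_exp by (rule prob_space_unif_exp)
  interpret h: sigma_finite_measure halfline by (rule sigma_finite_halfline)
  interpret VL: prob_space VL by (rule prob_space_VL)
  interpret Vu: pair_prob_space VL unif_exp ..
  interpret hV: pair_sigma_finite halfline VL ..
  interpret hu: pair_sigma_finite halfline unif_exp ..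
  define c where "c = ns * T"
  have c: "0 < c" using ns_pos T_pos by (simp add: c_def)
  have sVu[measurable_cong]: "sets (VL \<Otimes>\<^sub>M unif_exp) = sets (borel \<Otimes>\<^sub>M (borel \<Otimes>\<^sub>M borel))"
    by (intro sets_pair_measure_cong sets_unif_exp) auto
  have [measurable]: "(\<lambda>z. jump p \<alpha> c (fst z) (snd z)) \<in> borel_measurable (halfline \<Otimes>\<^sub>M (VL \<Otimes>\<^sub>M unif_exp))"
    using jump_measurable[of p \<alpha> c] by (subst measurable_cong_sets[OF _ refl]) (auto intro!: sets_pair_measure_cong sVu)
  define radial where "radial A u = (\<integral>\<^sup>+ r. indicator {0<..} r * indicator A (r *\<^sub>R u) *
                  ennreal (temper_fun Qk (r powr p) u * r powr (- \<alpha> - 1)) \<partial>lborel)" for A u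
  have key: "(\<integral>\<^sup>+ u. indicator (sphere 0 1) u * radial A u \<partial>sg) =
     ennreal (1 / T) * emeasure ?N A" if A[measurable]: "A \<in> sets borel" for A
  proof -
    define g where "g = (\<lambda>s r. ennreal c * (indicator {0<..} r * ennreal (exp (- (s * r powr p)) * r powr (- \<alpha> - 1))) :: ennreal)"
    have [measurable]: "(\<lambda>(s, r). g s r) \<in> borel_measurable (borel \<Otimes>\<^sub>M borel)" unfolding g_def by measurable
    define F where "F = (\<lambda>s (w::'a). \<integral>\<^sup>+ r. g s r * indicator A (r *\<^sub>R w) \<partial>lborel)"
    have [measurable]: "(\<lambda>(s, w). F s w) \<in> borel_measurable (borel \<Otimes>\<^sub>M borel)"
      unfolding F_def by measurable
    have inner: "(\<integral>\<^sup>+ x. \<integral>\<^sup>+ z. indicator A (jump p \<alpha> c x (v, z)) \<partial>unif_exp \<partial>halfline) = F (norm v) (v /\<^sub>R norm v)"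
      if v: "v \<noteq> 0" for v
    proof -
      let ?f = "\<lambda>z. min ((\<alpha> * fst z / c) powr (- 1 / \<alpha>)) (snd (snd z) powr (1 / p) * fst (snd z) powr (1 / \<alpha>) / norm v powr (1 / p))"
      have [measurable]: "?f \<in> borel_measurable (halfline \<Otimes>\<^sub>M unif_exp)" by measurable
      have "(\<integral>\<^sup>+ x. \<integral>\<^sup>+ z. indicator A (jump p \<alpha> c x (v, z)) \<partial>unif_exp \<partial>halfline) =
        (\<integral>\<^sup>+ x. \<integral>\<^sup>+ z. indicator A (?f (x, z) *\<^sub>R (v /\<^sub>R norm v)) \<partial>unif_exp \<partial>halfline)"
        by (simp add: jump_def split_beta)
      also have "\<dots> = (\<integral>\<^sup>+ y. indicator A (?f y *\<^sub>R (v /\<^sub>R norm v)) \<partial>(halfline \<Otimes>\<^sub>M unif_exp))"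
        by (rule ue.nn_integral_fst) measurable
      also have "\<dots> = (\<integral>\<^sup>+ r. indicator A (r *\<^sub>R (v /\<^sub>R norm v)) \<partial>distr (halfline \<Otimes>\<^sub>M unif_exp) borel ?f)"
        by (rule nn_integral_distr[symmetric]) auto
      also have "\<dots> = F (norm v) (v /\<^sub>R norm v)"
        using v p_pos alpha c
        by (subst radial_distr) (auto simp: F_def g_def nn_integral_density)
      finally show ?thesis .
    qed
    have "emeasure ?N A = (\<integral>\<^sup>+ y. indicator A (jump p \<alpha> c (fst y) (snd y)) \<partial>(halfline \<Otimes>\<^sub>M (VL \<Otimes>\<^sub>M unif_exp)))"
      unfolding c_def[symmetric] by (subst nn_integral_indicator[symmetric], simp, subst nn_integral_distr) auto
    also have "\<dots> = (\<integral>\<^sup>+ x. \<integral>\<^sup>+ m. indicator A (jump p \<alpha> c x m) \<partial>(VL \<Otimes>\<^sub>M unif_exp) \<partial>halfline)"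
      by (subst Vu.nn_integral_fst[symmetric]) auto
    also have "\<dots> = (\<integral>\<^sup>+ x. \<integral>\<^sup>+ v. \<integral>\<^sup>+ z. indicator A (jump p \<alpha> c x (v, z)) \<partial>unif_exp \<partial>VL \<partial>halfline)"
    proof (intro nn_integral_cong)
      fix x
      have "(\<lambda>m. jump p \<alpha> c x m) \<in> borel_measurable (VL \<Otimes>\<^sub>M unif_exp)"
        unfolding jump_def split_beta by measurable
      then show "(\<integral>\<^sup>+ m. indicator A (jump p \<alpha> c x m) \<partial>(VL \<Otimes>\<^sub>M unif_exp)) = (\<integral>\<^sup>+ v. \<integral>\<^sup>+ z. indicator A (jump p \<alpha> c x (v, z)) \<partial>unif_exp \<partial>VL)"
        by (subst ue.nn_integral_fst[symmetric]) auto
    qed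
    also have "\<dots> = (\<integral>\<^sup>+ v. \<integral>\<^sup>+ x. \<integral>\<^sup>+ z. indicator A (jump p \<alpha> c x (v, z)) \<partial>unif_exp \<partial>halfline \<partial>VL)"
    proof (rule hV.Fubini'[symmetric])
      have "(\<lambda>q. jump p \<alpha> c (fst (fst q)) (snd (fst q), snd q)) \<in> borel_measurable ((halfline \<Otimes>\<^sub>M VL) \<Otimes>\<^sub>M unif_exp)"
        unfolding jump_def split_beta by measurable
      then show "(\<lambda>(x, v). \<integral>\<^sup>+ z. indicator A (jump p \<alpha> c x (v, z)) \<partial>unif_exp) \<in> borel_measurable (halfline \<Otimes>\<^sub>M VL)"
        unfolding split_beta by (intro ue.borel_measurable_nn_integral) (simp add: split_beta)
    qed
    also have "\<dots> = (\<integral>\<^sup>+ v. F (norm v) (v /\<^sub>R norm v) \<partial>VL)"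
      by (rule nn_integral_cong_AE, use AE_VL_nonzero in eventually_elim) (simp add: inner)
    also have "\<dots> = ennreal (1 / ns) * (\<integral>\<^sup>+ u. indicator (sphere 0 1) u * (\<integral>\<^sup>+ s. F (norm (s *\<^sub>R u)) ((s *\<^sub>R u) /\<^sub>R norm (s *\<^sub>R u)) \<partial>(Qk u)) \<partial>sg)"
      by (rule nn_integral_VL) measurable
    also have "(\<integral>\<^sup>+ u. indicator (sphere 0 1) u * (\<integral>\<^sup>+ s. F (norm (s *\<^sub>R u)) ((s *\<^sub>R u) /\<^sub>R norm (s *\<^sub>R u)) \<partial>(Qk u)) \<partial>sg) =
      (\<integral>\<^sup>+ u. indicator (sphere 0 1) u * (\<integral>\<^sup>+ s. F s u \<partial>(kernel u)) \<partial>sg)"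
    proof (intro nn_integral_cong)
      fix u :: 'a
      have "(\<integral>\<^sup>+ s. F (norm (s *\<^sub>R u)) ((s *\<^sub>R u) /\<^sub>R norm (s *\<^sub>R u)) \<partial>(Qk u)) = (\<integral>\<^sup>+ s. F s u \<partial>(Qk u))" if "u \<in> sphere 0 1"
        by (rule nn_integral_cong_AE, use AE_Qk_pos[OF that] in eventually_elim) (use that in simp)
      then show "indicator (sphere 0 1) u * (\<integral>\<^sup>+ s. F (norm (s *\<^sub>R u)) ((s *\<^sub>R u) /\<^sub>R norm (s *\<^sub>R u)) \<partial>(Qk u)) =
         indicator (sphere 0 1) u * (\<integral>\<^sup>+ s. F s u \<partial>(kernel u))"
        by (auto simp: kernel_def indicator_def)
    qed
    \<comment> \<open>\<open>F\<close> carries a factor \<open>c\<close>; writing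
      \<open>c * (1 / c)\<close> lets \<open>1 / c\<close> cancel it pointwise in
      \<open>u\<close>.\<close>
    also have "\<dots> = ennreal c * (ennreal (1 / c) * (\<integral>\<^sup>+ u. indicator (sphere 0 1) u * (\<integral>\<^sup>+ s. F s u \<partial>(kernel u)) \<partial>sg))"
      unfolding mult.assoc[symmetric] using c by (subst ennreal_mult[symmetric]) auto
    also have "ennreal (1 / c) * (\<integral>\<^sup>+ u. indicator (sphere 0 1) u * (\<integral>\<^sup>+ s. F s u \<partial>(kernel u)) \<partial>sg) =
      (\<integral>\<^sup>+ u. ennreal (1 / c) * (indicator (sphere 0 1) u * (\<integral>\<^sup>+ s. F s u \<partial>(kernel u))) \<partial>sg)"
    proof (rule nn_integral_cmult[symmetric])
      have "(\<lambda>u. \<integral>\<^sup>+ s. F s u \<partial>(kernel u)) \<in> borel_measurable borel"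
        by (rule nn_integral_measurable_subprob_algebra2[OF _ kernel_measurable]) measurable
      then show "(\<lambda>u. indicator (sphere 0 1) u * (\<integral>\<^sup>+ s. F s u \<partial>(kernel u))) \<in> borel_measurable sg"
        by measurable
    qed
    also have "\<dots> = (\<integral>\<^sup>+ u. indicator (sphere 0 1) u * radial A u \<partial>sg)"
    proof (intro nn_integral_cong)
      fix u :: 'a
      show "ennreal (1 / c) * (indicator (sphere 0 1) u * (\<integral>\<^sup>+ s. F s u \<partial>(kernel u))) =
         indicator (sphere 0 1) u * radial A u"
      proof (cases "u \<in> sphere 0 1")
        case True
        then have u: "norm u = 1" by simp
        interpret K: prob_space "Qk u" using Qk_prob True by auto
        interpret lK: pair_sigma_finite lborel "Qk u" ..
        have [measurable_cong]: "sets (Qk u) = sets borel" using Qk_prob True by auto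
        have "(\<integral>\<^sup>+ s. F s u \<partial>(Qk u)) = (\<integral>\<^sup>+ r. \<integral>\<^sup>+ s. g s r * indicator A (r *\<^sub>R u) \<partial>(Qk u) \<partial>lborel)"
          unfolding F_def by (rule lK.Fubini') measurable
        also have "\<dots> = (\<integral>\<^sup>+ r. ennreal c * (indicator {0<..} r * indicator A (r *\<^sub>R u) *
                  ennreal (temper_fun Qk (r powr p) u * r powr (- \<alpha> - 1))) \<partial>lborel)"
        proof (intro nn_integral_cong)
          fix r :: real
          have ie: "integrable (Qk u) (\<lambda>s. exp (- (r powr p) * s))"
          proof (rule K.integrable_const_bound[of _ 1])
            show "AE s in Qk u. norm (exp (- (r powr p) * s)) \<le> 1"
              using AE_Qk_pos[OF True] by eventually_elim auto
          qed measurable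
          have "(\<integral>\<^sup>+ s. ennreal (exp (- (r powr p) * s)) \<partial>(Qk u)) = ennreal (temper_fun Qk (r powr p) u)"
            unfolding temper_fun_def by (rule nn_integral_eq_integral[OF ie]) auto
          moreover have "g s r * indicator A (r *\<^sub>R u) =
             (ennreal c * (indicator {0<..} r * indicator A (r *\<^sub>R u) * ennreal (r powr (- \<alpha> - 1)))) * ennreal (exp (- (r powr p) * s))" for s
            by (auto simp: g_def indicator_def ennreal_mult mult_ac)
          ultimately have "(\<integral>\<^sup>+ s. g s r * indicator A (r *\<^sub>R u) \<partial>(Qk u)) =
            (ennreal c * (indicator {0<..} r * indicator A (r *\<^sub>R u) * ennreal (r powr (- \<alpha> - 1)))) * ennreal (temper_fun Qk (r powr p) u)"
            by (simp add: nn_integral_cmult)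
          moreover have "0 \<le> temper_fun Qk (r powr p) u"
            unfolding temper_fun_def by (rule integral_nonneg_AE) auto
          ultimately show "(\<integral>\<^sup>+ s. g s r * indicator A (r *\<^sub>R u) \<partial>(Qk u)) = ennreal c * (indicator {0<..} r * indicator A (r *\<^sub>R u) *
                  ennreal (temper_fun Qk (r powr p) u * r powr (- \<alpha> - 1)))"
            by (simp add: ennreal_mult mult_ac)
        qed
        also have "\<dots> = ennreal c * radial A u"
          unfolding radial_def
        proof (rule nn_integral_cmult)
          have "(\<lambda>r. temper_fun Qk (r powr p) u) \<in> borel_measurable borel"
            unfolding temper_fun_def by measurable
          then show "(\<lambda>r. indicator {0<..} r * indicator A (r *\<^sub>R u) *
                  ennreal (temper_fun Qk (r powr p) u * r powr (- \<alpha> - 1))) \<in> borel_measurable lborel"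
            by measurable
        qed
        finally have "ennreal (1 / c) * (\<integral>\<^sup>+ s. F s u \<partial>(Qk u)) = ennreal (1 / c) * ennreal c * radial A u"
          by (simp add: mult.assoc)
        also have "ennreal (1 / c) * ennreal c = 1" using c by (subst ennreal_mult[symmetric]) auto
        finally show ?thesis using True by (simp add: kernel_def)
      qed simp
    qed
    finally have "ennreal (1 / T) * emeasure ?N A = (ennreal (1 / T) * (ennreal (1 / ns) * ennreal c)) * (\<integral>\<^sup>+ u. indicator (sphere 0 1) u * radial A u \<partial>sg)"
      by (simp add: mult.assoc)
    moreover have "ennreal (1 / T) * (ennreal (1 / ns) * ennreal c) = 1"
    proof -
      have "ennreal (1 / T) * (ennreal (1 / ns) * ennreal c) = ennreal (1 / T * (1 / ns * c))"
        using ns_pos T_pos c by (simp only: ennreal_mult mult_nonneg_nonneg divide_nonneg_nonneg less_imp_le zero_le_one)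
      also have "1 / T * (1 / ns * c) = 1" using ns_pos T_pos by (simp add: c_def)
      finally show ?thesis by simp
    qed
    ultimately show ?thesis by simp
  qed
  \<comment> \<open>As for \<open>Q_measure\<close>, the defining set function is countably additive
    because it has been identified with the \<open>emeasure\<close> of an existing measure.\<close>
  have "tempered_levy_measure sg Qk p \<alpha> = measure_of UNIV (sets borel) (emeasure (density ?N (\<lambda>_. ennreal (1 / T))))"
    unfolding tempered_levy_measure_def
    by (rule measure_of_eq) (auto simp: key[unfolded radial_def] sets.sigma_sets_eq[of borel, simplified] emeasure_density_const)
  also have "\<dots> = density ?N (\<lambda>_. ennreal (1 / T))"
    using measure_of_of_measure[of "density ?N (\<lambda>_. ennreal (1 / T))"] by simp
  finally show ?thesis .
qed

end

section \<open>The Levy exponent\<close>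

lemma integrable_halfline_iff:
  fixes f :: "real \<Rightarrow> 'b::{banach, second_countable_topology}"
  assumes [measurable]: "f \<in> borel_measurable borel"
  shows "integrable halfline f \<longleftrightarrow> set_integrable lborel {0<..} f"
    and "(LINT x|halfline. f x) = (LINT x:{0<..}|lborel. f x)"
proof -
  have h: "halfline = density lborel (\<lambda>x. ennreal (indicator {0<..} x))"
    unfolding halfline_def by (intro density_cong) (auto simp: indicator_def)
  show "integrable halfline f \<longleftrightarrow> set_integrable lborel {0<..} f"
    unfolding h set_integrable_def by (rule integrable_density) auto
  show "(LINT x|halfline. f x) = (LINT x:{0<..}|lborel. f x)"
    unfolding h set_lebesgue_integral_def by (rule integral_density) auto
qed

text \<open>The minimum takes care of the behaviour at 0 and the power of that at infinity; the two
  ranges are separated at 1.\<close>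

lemma integrable_halfline_min_powr:
  fixes K b :: real
  assumes K: "0 \<le> K" and b: "1 < b"
  shows "integrable halfline (\<lambda>x. min 1 (K * x powr (- b)))"
proof (rule integrableI_nonneg)
  have "(\<integral>\<^sup>+ x. ennreal (min 1 (K * x powr (- b))) \<partial>halfline) =
      (\<integral>\<^sup>+ x. indicator {0<..} x * ennreal (min 1 (K * x powr (- b))) \<partial>lborel)"
    unfolding halfline_def by (rule nn_integral_density) auto
  also have "\<dots> \<le> (\<integral>\<^sup>+ x. indicator {0..1} x + ennreal K * (indicator {1<..} x * ennreal (x powr (- (b - 1) - 1))) \<partial>lborel)"
    using K by (intro nn_integral_mono) (auto simp: indicator_def ennreal_mult[symmetric] intro!: ennreal_leI)
  also have "\<dots> = 1 + ennreal K * ennreal (1 powr (- (b - 1)) / (b - 1))"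
    using b by (subst nn_integral_add, simp, simp, subst nn_integral_cmult, simp, subst nn_integral_powr_tail) auto
  also have "\<dots> < \<infinity>" by (simp add: ennreal_mult_less_top)
  finally show "(\<integral>\<^sup>+ x. ennreal (min 1 (K * x powr (- b))) \<partial>halfline) < \<infinity>" .
qed (use K in auto)

lemma cball_sets[measurable]: "cball (a::'a::euclidean_space) r \<in> sets borel"
  by (simp add: borel_closed)

lemma truncation_measurable: "(\<lambda>x::'a::euclidean_space. indicator (cball 0 1) x *\<^sub>R x) \<in> borel_measurable borel"
  by measurable

definition levy_integrand :: "'a::euclidean_space \<Rightarrow> 'a \<Rightarrow> complex" where
  "levy_integrand z x = iexp (z \<bullet> x) - 1 - \<i> * complex_of_real (z \<bullet> x) * indicator (cball 0 1) x"

lemma levy_integrand_measurable[measurable]: "levy_integrand z \<in> borel_measurable borel"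
  unfolding levy_integrand_def by measurable

text \<open>Inside the unit ball this is the second order Taylor bound, outside it the trivial bound
  2; the constant covers both.\<close>

lemma norm_levy_integrand_le: "norm (levy_integrand z x) \<le> (2 + (norm z)\<^sup>2) * min 1 ((norm x)\<^sup>2)"
proof (cases "norm x \<le> 1")
  case True
  have "norm (levy_integrand z x) = norm (iexp (z \<bullet> x) - (\<Sum>k\<le>1. (\<i> * (z \<bullet> x)) ^ k / fact k))"
    using True by (simp add: levy_integrand_def algebra_simps)
  also have "\<dots> \<le> \<bar>z \<bullet> x\<bar> ^ (Suc 1) / fact (Suc 1)"
    by (rule iexp_approx1)
  also have "\<dots> \<le> \<bar>z \<bullet> x\<bar>\<^sup>2" by (simp add: power2_eq_square)
  also have "\<dots> \<le> (norm z * norm x)\<^sup>2"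
    using Cauchy_Schwarz_ineq2[of z x] by (intro power_mono) auto
  also have "\<dots> \<le> (2 + (norm z)\<^sup>2) * (norm x)\<^sup>2"
    by (simp add: power_mult_distrib mult_right_mono)
  also have "(norm x)\<^sup>2 = min 1 ((norm x)\<^sup>2)"
    using power_le_one[OF norm_ge_zero True, of 2] by simp
  finally show ?thesis .
next
  case False
  then have "norm (levy_integrand z x) = norm (iexp (z \<bullet> x) - 1)"
    by (simp add: levy_integrand_def)
  also have "\<dots> \<le> 1 + 1"
    using norm_triangle_ineq4[of "iexp (z \<bullet> x)" 1] by (simp add: norm_exp_i_times)
  also have "\<dots> \<le> (2 + (norm z)\<^sup>2) * 1" by simp
  also have "1 = min 1 ((norm x)\<^sup>2)"
    using False one_le_power[of "norm x" 2] by (simp add: min_def)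
  finally show ?thesis .
qed

context tempered_data
begin

definition cT :: real where "cT = ns * T"

lemma cT_pos: "0 < cT" using ns_pos T_pos by (simp add: cT_def)

definition mark_law :: "('a \<times> real \<times> real) measure" where "mark_law = VL \<Otimes>\<^sub>M unif_exp"

lemma sets_mark_law[measurable_cong]: "sets mark_law = sets (borel \<Otimes>\<^sub>M (borel \<Otimes>\<^sub>M borel))"
  unfolding mark_law_def by (intro sets_pair_measure_cong sets_unif_exp) auto

lemma space_mark_law[simp]: "space mark_law = UNIV"
  using sets_eq_imp_space_eq[OF sets_mark_law] by (simp add: space_pair_measure)

lemma prob_space_mark_law: "prob_space mark_law"
proof -
  interpret ue: prob_space unif_exp by (rule prob_space_unif_exp)
  interpret VL: prob_space VL by (rule prob_space_VL)
  interpret pair_prob_space VL unif_exp ..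
  show ?thesis unfolding mark_law_def by unfold_locales
qed

abbreviation J :: "real \<Rightarrow> 'a \<times> real \<times> real \<Rightarrow> 'a" where "J \<equiv> jump p \<alpha> cT"

lemma J_measurable[measurable]:
  "(\<lambda>z. J (fst z) (snd z)) \<in> borel_measurable (borel \<Otimes>\<^sub>M mark_law)"
  "(\<lambda>m. J x m) \<in> borel_measurable mark_law"
proof -
  have "sets (borel \<Otimes>\<^sub>M mark_law) = sets (borel \<Otimes>\<^sub>M (borel \<Otimes>\<^sub>M (borel \<Otimes>\<^sub>M borel)))"
    by (intro sets_pair_measure_cong sets_mark_law) auto
  from measurable_cong_sets[OF this refl] jump_measurable
  show *: "(\<lambda>z. J (fst z) (snd z)) \<in> borel_measurable (borel \<Otimes>\<^sub>M mark_law)" by blast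
  show "(\<lambda>m. J x m) \<in> borel_measurable mark_law"
    using measurable_compose[OF measurable_Pair1'[of x borel mark_law] *] by simp
qed

definition \<kappa> :: real where "\<kappa> = (\<alpha> / cT) powr (- 1 / \<alpha>)"

lemma norm_J_le: "0 < x \<Longrightarrow> norm (J x m) \<le> \<kappa> * x powr (- 1 / \<alpha>)"
  unfolding \<kappa>_def by (rule norm_jump_le[OF alpha(1) cT_pos])

lemma kappa_nonneg: "0 \<le> \<kappa>" by (simp add: \<kappa>_def)

lemma isCont_J: "0 < x \<Longrightarrow> isCont (\<lambda>x. J x m) x"
  unfolding jump_def split_beta using alpha cT_pos
  by (intro continuous_intros) auto

text \<open>Dominated convergence, as jumps depend continuously on a positive arrival. This supplies
  the continuity of \<open>H\<close> on the open half-line that the product formula asks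
  for.\<close>

lemma continuous_on_integral_J:
  fixes f :: "'a \<Rightarrow> complex"
  assumes f: "\<And>x. isCont f x" and fb: "\<And>x. norm (f x) \<le> 1"
  shows "continuous_on {0<..} (\<lambda>x. LINT m|mark_law. f (J x m))"
proof -
  interpret prob_space mark_law by (rule prob_space_mark_law)
  have [measurable]: "f \<in> borel_measurable borel"
    using f by (intro borel_measurable_continuous_onI) (simp add: continuous_on_eq_continuous_at)
  show ?thesis
    unfolding continuous_on_sequentially
  proof (intro ballI allI impI, elim conjE)
    fix X :: "nat \<Rightarrow> real" and x :: real assume x: "x \<in> {0<..}" and X: "X \<longlonglongrightarrow> x"
    have "(\<lambda>n. LINT m|mark_law. f (J (X n) m)) \<longlonglongrightarrow> (LINT m|mark_law. f (J x m))"
    proof (rule integral_dominated_convergence[where w="\<lambda>_. 1"])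
      show "AE m in mark_law. (\<lambda>n. f (J (X n) m)) \<longlonglongrightarrow> f (J x m)"
      proof (rule AE_I2)
        fix m
        have "(\<lambda>n. J (X n) m) \<longlonglongrightarrow> J x m"
          by (rule isCont_tendsto_compose[OF isCont_J X]) (use x in simp)
        then show "(\<lambda>n. f (J (X n) m)) \<longlonglongrightarrow> f (J x m)"
          by (rule isCont_tendsto_compose[OF f])
      qed
    qed (use fb in auto)
    then show "((\<lambda>x. LINT m|mark_law. f (J x m)) \<circ> X) \<longlonglongrightarrow> (LINT m|mark_law. f (J x m))"
      by (simp add: comp_def)
  qed
qed

text \<open>Mean jump at arrival \<open>x\<close> under the truncation of
  \<open>lk_exponent\<close>; its integral converts between the uncompensated exponent of the series
  and the compensated one.\<close>

definition drift :: "real \<Rightarrow> 'a" where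
  "drift x = (LINT m|mark_law. indicator (cball 0 1) (J x m) *\<^sub>R J x m)"

lemma drift_measurable[measurable]: "drift \<in> borel_measurable borel"
proof -
  interpret prob_space mark_law by (rule prob_space_mark_law)
  have "(\<lambda>z. indicator (cball 0 1) (J (fst z) (snd z)) *\<^sub>R J (fst z) (snd z)) \<in> borel_measurable (borel \<Otimes>\<^sub>M mark_law)"
    using measurable_compose[OF J_measurable(1) truncation_measurable] .
  then show ?thesis unfolding drift_def
    by (intro borel_measurable_lebesgue_integral) (simp add: split_beta)
qed

lemma integrable_truncated_J: "integrable mark_law (\<lambda>m. indicator (cball 0 1) (J x m) *\<^sub>R J x m)"
proof -
  interpret prob_space mark_law by (rule prob_space_mark_law)
  show ?thesis by (rule integrable_const_bound[of _ 1]) (auto simp: indicator_def)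
qed

text \<open>The jump at arrival \<open>x\<close> is at most of order
  \<open>x powr (- 1 / \<alpha>)\<close>, integrable at infinity for \<alpha> < 1; near 0 the
  truncation bounds it by 1.\<close>

lemma integrable_drift:
  assumes "\<alpha> < 1"
  shows "integrable halfline drift"
proof (rule Bochner_Integration.integrable_bound)
  interpret prob_space mark_law by (rule prob_space_mark_law)
  show "integrable halfline (\<lambda>x. min 1 (\<kappa> * x powr (- (1 / \<alpha>))))"
    using assms alpha kappa_nonneg by (intro integrable_halfline_min_powr) auto
  show "AE x in halfline. norm (drift x) \<le> norm (min 1 (\<kappa> * x powr (- (1 / \<alpha>))))"
    using AE_halfline_pos
  proof eventually_elim
    case (elim x)
    have "norm (drift x) \<le> (LINT m|mark_law. norm (indicator (cball 0 1) (J x m) *\<^sub>R J x m))"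
      unfolding drift_def by (rule integral_norm_bound)
    also have "\<dots> \<le> (LINT m|mark_law. min 1 (\<kappa> * x powr (- (1 / \<alpha>))))"
    proof (rule integral_mono)
      show "norm (indicator (cball 0 1) (J x m) *\<^sub>R J x m) \<le> min 1 (\<kappa> * x powr (- (1 / \<alpha>)))" for m
        using norm_J_le[OF elim, of m] kappa_nonneg by (auto simp: indicator_def)
    qed (use integrable_norm[OF integrable_truncated_J] in auto)
    also have "\<dots> = min 1 (\<kappa> * x powr (- (1 / \<alpha>)))" using prob_space by simp
    finally show ?case using kappa_nonneg by simp
  qed
qed auto

text \<open>Here \<alpha> < 2 enters: the integrand is at most of the order of the squared jump,
  hence of \<open>x powr (- (2 / \<alpha>))\<close>, and the exponent is below -1.\<close>

lemma integrable_levy_integrand_J: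
  "integrable (halfline \<Otimes>\<^sub>M mark_law) (\<lambda>q. levy_integrand z (J (fst q) (snd q)))"
proof -
  interpret h: sigma_finite_measure halfline by (rule sigma_finite_halfline)
  interpret m: prob_space mark_law by (rule prob_space_mark_law)
  interpret pair_sigma_finite halfline mark_law ..
  define C where "C = 2 + (norm z)\<^sup>2"
  have C: "0 \<le> C" by (simp add: C_def)
  have smeas: "sets (halfline \<Otimes>\<^sub>M mark_law) = sets (borel \<Otimes>\<^sub>M mark_law)" by (intro sets_pair_measure_cong) auto
  have meas[measurable]: "(\<lambda>q. levy_integrand z (J (fst q) (snd q))) \<in> borel_measurable (halfline \<Otimes>\<^sub>M mark_law)"
    unfolding measurable_cong_sets[OF smeas refl] by measurable
  have bd: "norm (levy_integrand z (J x m)) \<le> C * min 1 (\<kappa>\<^sup>2 * x powr (- (2 / \<alpha>)))" if "0 < x" for x m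
  proof -
    have "(norm (J x m))\<^sup>2 \<le> (\<kappa> * x powr (- 1 / \<alpha>))\<^sup>2"
      using norm_J_le[OF that, of m] by (intro power_mono) auto
    also have "\<dots> = \<kappa>\<^sup>2 * x powr (- (2 / \<alpha>))"
      using that by (simp add: power_mult_distrib power2_eq_square powr_add[symmetric])
    finally have "min 1 ((norm (J x m))\<^sup>2) \<le> min 1 (\<kappa>\<^sup>2 * x powr (- (2 / \<alpha>)))" by auto
    from mult_left_mono[OF this C] norm_levy_integrand_le[of z "J x m"]
    show ?thesis by (simp add: C_def)
  qed
  have i1: "integrable mark_law (\<lambda>m. levy_integrand z (J x m))" for x
  proof (rule m.integrable_const_bound[of _ C])
    show "AE m in mark_law. norm (levy_integrand z (J x m)) \<le> C"
    proof (rule AE_I2)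
      fix m
      have "norm (levy_integrand z (J x m)) \<le> C * min 1 ((norm (J x m))\<^sup>2)"
        using norm_levy_integrand_le[of z "J x m"] by (simp add: C_def)
      also have "\<dots> \<le> C * 1" using C by (intro mult_left_mono) auto
      finally show "norm (levy_integrand z (J x m)) \<le> C" by simp
    qed
  qed measurable
  show ?thesis
  proof (rule Fubini_integrable[OF meas])
    show "AE x in halfline. integrable mark_law (\<lambda>y. levy_integrand z (J (fst (x, y)) (snd (x, y))))"
      using i1 by simp
    show "integrable halfline (\<lambda>x. LINT y|mark_law. norm (levy_integrand z (J (fst (x, y)) (snd (x, y)))))"
    proof (rule Bochner_Integration.integrable_bound)
      show "integrable halfline (\<lambda>x. C * min 1 (\<kappa>\<^sup>2 * x powr (- (2 / \<alpha>))))"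
        using alpha by (intro integrable_mult_right integrable_halfline_min_powr) auto
      show "(\<lambda>x. LINT y|mark_law. norm (levy_integrand z (J (fst (x, y)) (snd (x, y))))) \<in> borel_measurable halfline"
        using meas by (intro m.borel_measurable_lebesgue_integral) (simp add: split_beta)
      show "AE x in halfline. norm (LINT y|mark_law. norm (levy_integrand z (J (fst (x, y)) (snd (x, y)))))
          \<le> norm (C * min 1 (\<kappa>\<^sup>2 * x powr (- (2 / \<alpha>))))"
        using AE_halfline_pos
      proof eventually_elim
        case (elim x)
        have "(LINT y|mark_law. norm (levy_integrand z (J x y))) \<le> (LINT y|mark_law. C * min 1 (\<kappa>\<^sup>2 * x powr (- (2 / \<alpha>))))"
          using i1 bd[OF elim] by (intro integral_mono) auto
        also have "\<dots> = C * min 1 (\<kappa>\<^sup>2 * x powr (- (2 / \<alpha>)))" using m.prob_space by simp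
        finally show ?case using C by (simp add: abs_mult)
      qed
    qed
  qed
qed

lemma integral_levy_measure:
  fixes f :: "'a \<Rightarrow> complex"
  assumes [measurable]: "f \<in> borel_measurable borel"
  shows "(CLINT x|tempered_levy_measure sg Qk p \<alpha>. f x) = (1 / T) *\<^sub>R (LINT q|(halfline \<Otimes>\<^sub>M mark_law). f (J (fst q) (snd q)))"
proof -
  have smeas: "sets (halfline \<Otimes>\<^sub>M mark_law) = sets (borel \<Otimes>\<^sub>M mark_law)" by (intro sets_pair_measure_cong) auto
  have Jm[measurable]: "(\<lambda>q. J (fst q) (snd q)) \<in> borel_measurable (halfline \<Otimes>\<^sub>M mark_law)"
    unfolding measurable_cong_sets[OF smeas refl] by measurable
  have "(CLINT x|tempered_levy_measure sg Qk p \<alpha>. f x) =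
     (LINT x|distr (halfline \<Otimes>\<^sub>M mark_law) borel (\<lambda>q. J (fst q) (snd q)). (1 / T) *\<^sub>R f x)"
    unfolding tempered_levy_measure_eq cT_def[symmetric] mark_law_def[symmetric]
    using T_pos by (subst integral_density) auto
  also have "\<dots> = (LINT q|(halfline \<Otimes>\<^sub>M mark_law). (1 / T) *\<^sub>R f (J (fst q) (snd q)))"
    by (rule integral_distr) auto
  finally show ?thesis by simp
qed

text \<open>The average over the mark comes before the integral over the arrival. Jointly,
  \<open>iexp (z \<bullet> J x m) - 1\<close> need not be integrable; its average is split into that
  of the compensated integrand, which is jointly integrable, and the drift term, which is integrable
  by hypothesis. The factor \<open>T\<close> comes from the description of the Levy measure as an
  image.\<close>

lemma jump_exponent:
  assumes drift: "integrable halfline drift"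
  defines "b \<equiv> (1 / T) *\<^sub>R (LINT x|halfline. drift x)"
  defines "H \<equiv> \<lambda>z x. (LINT m|mark_law. iexp (z \<bullet> J x m))"
  shows "integrable halfline (\<lambda>x. H z x - 1)"
    and "(LINT x|halfline. H z x - 1) = complex_of_real T * lk_exponent (tempered_levy_measure sg Qk p \<alpha>) b z"
proof -
  interpret h: sigma_finite_measure halfline by (rule sigma_finite_halfline)
  interpret m: prob_space mark_law by (rule prob_space_mark_law)
  interpret pair_sigma_finite halfline mark_law ..
  have inner: "(LINT m|mark_law. levy_integrand z (J x m)) = H z x - 1 - \<i> * complex_of_real (z \<bullet> drift x)" for x
  proof -
    have 1: "integrable mark_law (\<lambda>m. iexp (z \<bullet> J x m))"
      by (rule m.integrable_const_bound[of _ 1]) (auto simp: norm_exp_i_times)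
    have 2: "integrable mark_law (\<lambda>m. \<i> * complex_of_real (z \<bullet> (indicator (cball 0 1) (J x m) *\<^sub>R J x m)))"
      by (intro integrable_mult_right integrable_of_real integrable_inner_right integrable_truncated_J)
    have "(LINT m|mark_law. levy_integrand z (J x m)) =
       (LINT m|mark_law. iexp (z \<bullet> J x m) - 1 - \<i> * complex_of_real (z \<bullet> (indicator (cball 0 1) (J x m) *\<^sub>R J x m)))"
      by (intro Bochner_Integration.integral_cong) (auto simp: levy_integrand_def indicator_def)
    also have "\<dots> = H z x - 1 - (LINT m|mark_law. \<i> * complex_of_real (z \<bullet> (indicator (cball 0 1) (J x m) *\<^sub>R J x m)))"
      using 1 2 m.prob_space by (simp add: H_def)
    also have "(LINT m|mark_law. \<i> * complex_of_real (z \<bullet> (indicator (cball 0 1) (J x m) *\<^sub>R J x m))) = \<i> * complex_of_real (z \<bullet> drift x)"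
      unfolding drift_def using integrable_truncated_J[of x]
      by (simp only: integral_mult_right_zero integral_complex_of_real integral_inner_right[OF integrable_truncated_J])
    finally show ?thesis .
  qed
  have Li: "integrable halfline (\<lambda>x. LINT m|mark_law. levy_integrand z (J x m))"
    using integrable_fst'[OF integrable_levy_integrand_J[of z]] by simp
  have di: "integrable halfline (\<lambda>x. \<i> * complex_of_real (z \<bullet> drift x))"
    using drift by (intro integrable_mult_right integrable_of_real integrable_inner_right)
  have eq: "H z x - 1 = (LINT m|mark_law. levy_integrand z (J x m)) + \<i> * complex_of_real (z \<bullet> drift x)" for x
    by (simp add: inner)
  show "integrable halfline (\<lambda>x. H z x - 1)"
    unfolding eq by (intro Bochner_Integration.integrable_add Li di)
  have "(LINT x|halfline. H z x - 1) = (LINT x|halfline. LINT m|mark_law. levy_integrand z (J x m)) +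
      (LINT x|halfline. \<i> * complex_of_real (z \<bullet> drift x))"
    unfolding eq by (rule Bochner_Integration.integral_add[OF Li di])
  also have "(LINT x|halfline. LINT m|mark_law. levy_integrand z (J x m)) = (LINT q|(halfline \<Otimes>\<^sub>M mark_law). levy_integrand z (J (fst q) (snd q)))"
    using integral_fst'[OF integrable_levy_integrand_J[of z]] by simp
  also have "\<dots> = complex_of_real T * (CLINT x|tempered_levy_measure sg Qk p \<alpha>. levy_integrand z x)"
    using T_pos by (simp add: integral_levy_measure scaleR_conv_of_real)
  also have "(LINT x|halfline. \<i> * complex_of_real (z \<bullet> drift x)) = complex_of_real T * (\<i> * complex_of_real (b \<bullet> z))"
    using T_pos drift by (simp add: b_def inner_commute)
  finally show "(LINT x|halfline. H z x - 1) = complex_of_real T * lk_exponent (tempered_levy_measure sg Qk p \<alpha>) b z"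
    by (simp add: lk_exponent_def levy_integrand_def algebra_simps)
qed

section \<open>Reflection of the directions in the symmetric case\<close>

lemma distr_VL_uminus:
  assumes sym: "\<forall>A\<in>sets borel. emeasure (Q_measure sg Qk) (uminus ` A) = emeasure (Q_measure sg Qk) A"
  shows "distr VL borel uminus = VL"
proof (rule measure_eqI)
  fix A assume "A \<in> sets (distr VL borel uminus)"
  then have A: "A \<in> sets borel" by simp
  have "uminus -` A = uminus ` A" by (auto simp: image_iff) (metis minus_minus)
  then show "emeasure (distr VL borel uminus) A = emeasure VL A"
    using A sym by (simp add: emeasure_distr) (simp add: VL_def)
qed simp

lemma distr_mark_law_uminus:
  assumes "distr VL borel uminus = VL"
  shows "distr mark_law mark_law (\<lambda>(v, z). (- v, z)) = mark_law"
proof -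
  interpret ue: prob_space unif_exp by (rule prob_space_unif_exp)
  have id: "distr unif_exp unif_exp (\<lambda>z. z) = unif_exp" by (rule distr_id)
  have "distr VL borel uminus \<Otimes>\<^sub>M distr unif_exp unif_exp (\<lambda>z. z) =
     distr (VL \<Otimes>\<^sub>M unif_exp) (borel \<Otimes>\<^sub>M unif_exp) (\<lambda>(v, z). (- v, z))"
    by (rule pair_measure_distr) (auto simp: id ue.sigma_finite_measure_axioms)
  then have "VL \<Otimes>\<^sub>M unif_exp = distr (VL \<Otimes>\<^sub>M unif_exp) (borel \<Otimes>\<^sub>M unif_exp) (\<lambda>(v, z). (- v, z))"
    unfolding assms id .
  also have "\<dots> = distr mark_law mark_law (\<lambda>(v, z). (- v, z))"
    unfolding mark_law_def by (rule distr_cong) (auto intro!: sets_pair_measure_cong)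
  finally show ?thesis by (simp add: mark_law_def)
qed

text \<open>Reflecting the vector in the mark preserves the law of the mark and changes the sign of
  the jump, while the unit ball is symmetric; so the drift equals its own negative.\<close>

lemma drift_eq_0:
  assumes "distr VL borel uminus = VL"
  shows "drift x = 0"
proof -
  have fm[measurable]: "(\<lambda>(v, z). (- v, z)) \<in> measurable mark_law mark_law"
    unfolding measurable_cong_sets[OF sets_mark_law sets_mark_law] by measurable
  have "drift x = (LINT m|distr mark_law mark_law (\<lambda>(v, z). (- v, z)). indicator (cball 0 1) (J x m) *\<^sub>R J x m)"
    unfolding drift_def distr_mark_law_uminus[OF assms] ..
  also have "\<dots> = (LINT m|mark_law. indicator (cball 0 1) (J x (case m of (v, z) \<Rightarrow> (- v, z))) *\<^sub>R J x (case m of (v, z) \<Rightarrow> (- v, z)))"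
    using measurable_compose[OF J_measurable(2) truncation_measurable, of x] by (subst integral_distr) auto
  also have "\<dots> = (LINT m|mark_law. - (indicator (cball 0 1) (J x m) *\<^sub>R J x m))"
    by (intro Bochner_Integration.integral_cong) (auto simp: jump_uminus indicator_def)
  also have "\<dots> = - drift x" by (simp add: drift_def)
  finally have "drift x + drift x = 0" by (simp add: eq_neg_iff_add_eq_0)
  then show ?thesis by (simp add: scaleR_2[symmetric])
qed

end

section \<open>A maximal inequality for random signs\<close>

text \<open>A sign pattern is encoded by the set of indices with a minus sign, so that averages over
  random signs become counts over \<open>Pow J\<close>.\<close>

definition set_sign :: "'i set \<Rightarrow> 'i \<Rightarrow> real" where
  "set_sign s j = (if j \<in> s then - 1 else 1)"

text \<open>Flipping the signs outside \<open>A l\<close> at the first index \<open>l\<close> where the partial sum is large is an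
  involution of the sign patterns, and one of a pattern and its image has a large total sum.\<close>

lemma levy_maximal_count:
  fixes x :: "'i \<Rightarrow> 'a::real_normed_vector" and A :: "'l::linorder \<Rightarrow> 'i set" and K :: "'r \<Rightarrow> 'i set"
  assumes J: "finite J" and L: "finite L" and mono: "\<And>l l'. l \<le> l' \<Longrightarrow> A l \<subseteq> A l'"
  shows "card {s\<in>Pow J. \<exists>l\<in>L. \<exists>r\<in>R. \<delta> < norm (\<Sum>j\<in>J \<inter> A l \<inter> K r. set_sign s j *\<^sub>R x j)}
    \<le> 2 * card {s\<in>Pow J. \<exists>r\<in>R. \<delta> < norm (\<Sum>j\<in>J \<inter> K r. set_sign s j *\<^sub>R x j)}"
proof -
  \<comment> \<open>The second parameter \<open>r\<close> is carried along on both sides while only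
    \<open>l\<close> is removed, so that the inequality can be applied once for each
    parameter.\<close>
  define PP where "PP l s \<longleftrightarrow> (\<exists>r\<in>R. \<delta> < norm (\<Sum>j\<in>J \<inter> A l \<inter> K r. set_sign s j *\<^sub>R x j))" for l s
  define Q where "Q s \<longleftrightarrow> (\<exists>r\<in>R. \<delta> < norm (\<Sum>j\<in>J \<inter> K r. set_sign s j *\<^sub>R x j))" for s
  define flip where "flip l s = (s - (J - A l)) \<union> ((J - A l) - s)" for l s
  define D where "D l = {s\<in>Pow J. PP l s \<and> (\<forall>i\<in>L. i < l \<longrightarrow> \<not> PP i s)}" for l
  have finD: "finite (D l)" for l using J by (auto simp: D_def)
  have flip_flip: "flip l (flip l s) = s" for l s by (auto simp: flip_def)
  have flipJ: "flip l s \<subseteq> J" if "s \<subseteq> J" for l s using that by (auto simp: flip_def)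
  have sg1: "set_sign (flip l s) j = set_sign s j" if "j \<in> J \<inter> A l" for l s j
    using that by (auto simp: set_sign_def flip_def)
  have sg2: "set_sign (flip l s) j = - set_sign s j" if "j \<in> J - A l" for l s j
    using that by (auto simp: set_sign_def flip_def)
  have PPflip: "PP i (flip l s) \<longleftrightarrow> PP i s" if "i \<le> l" for i l s
  proof -
    have "(\<Sum>j\<in>J \<inter> A i \<inter> K r. set_sign (flip l s) j *\<^sub>R x j) = (\<Sum>j\<in>J \<inter> A i \<inter> K r. set_sign s j *\<^sub>R x j)" for r
      using mono[OF that] by (intro sum.cong refl arg_cong2[where f=scaleR] sg1) auto
    then show ?thesis by (simp add: PP_def)
  qed
  \<comment> \<open>The signs inside \<open>A l\<close> are kept, and by monotonicity they determine
    all earlier partial sums, so the first large index does not move.\<close>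
  have flipD: "flip l s \<in> D l" if "s \<in> D l" for l s
    using that by (auto simp: D_def PPflip dest!: flipJ[THEN subsetD, rotated])
  have dich: "Q s \<or> Q (flip l s)" if "PP l s" for l s
  proof -
    from that obtain r where r: "r \<in> R" "\<delta> < norm (\<Sum>j\<in>J \<inter> A l \<inter> K r. set_sign s j *\<^sub>R x j)" by (auto simp: PP_def)
    let ?u = "\<Sum>j\<in>J \<inter> A l \<inter> K r. set_sign s j *\<^sub>R x j"
    let ?v = "\<Sum>j\<in>(J - A l) \<inter> K r. set_sign s j *\<^sub>R x j"
    have split: "(\<Sum>j\<in>J \<inter> K r. f j) = (\<Sum>j\<in>J \<inter> A l \<inter> K r. f j) + (\<Sum>j\<in>(J - A l) \<inter> K r. f j)" for f :: "'i \<Rightarrow> 'a"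
      using J by (subst sum.union_disjoint[symmetric]) (auto intro!: sum.cong)
    have s1: "(\<Sum>j\<in>J \<inter> K r. set_sign s j *\<^sub>R x j) = ?u + ?v" by (rule split)
    have "(\<Sum>j\<in>J \<inter> A l \<inter> K r. set_sign (flip l s) j *\<^sub>R x j) = ?u"
      by (intro sum.cong refl arg_cong2[where f=scaleR] sg1) auto
    moreover have "(\<Sum>j\<in>(J - A l) \<inter> K r. set_sign (flip l s) j *\<^sub>R x j) = - ?v"
      unfolding sum_negf[symmetric] by (intro sum.cong refl) (auto simp: sg2)
    ultimately have s2: "(\<Sum>j\<in>J \<inter> K r. set_sign (flip l s) j *\<^sub>R x j) = ?u - ?v"
      unfolding split by simp
    \<comment> \<open>The sums for \<open>s\<close> and for its image are \<open>u + v\<close> and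
      \<open>u - v\<close>; their mean is \<open>u\<close>, so they cannot both be small.\<close>
    have "2 *\<^sub>R ?u = (?u + ?v) + (?u - ?v)" by (simp add: scaleR_2)
    then have "norm (2 *\<^sub>R ?u) \<le> norm (?u + ?v) + norm (?u - ?v)" by (elim ssubst) (rule norm_triangle_ineq)
    then have "2 * norm ?u \<le> norm (?u + ?v) + norm (?u - ?v)" by simp
    then have "\<delta> < norm (?u + ?v) \<or> \<delta> < norm (?u - ?v)" using r(2) by linarith
    then show ?thesis unfolding Q_def s1[symmetric] s2[symmetric] using r(1) by blast
  qed
  have cardD: "card (D l) \<le> 2 * card (D l \<inter> {s. Q s})" for l
  proof -
    have "D l \<subseteq> (D l \<inter> {s. Q s}) \<union> flip l ` (D l \<inter> {s. Q s})"
    proof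
      fix s assume s: "s \<in> D l"
      then have "PP l s" by (simp add: D_def)
      from dich[OF this] show "s \<in> (D l \<inter> {s. Q s}) \<union> flip l ` (D l \<inter> {s. Q s})"
        using s flipD[OF s] flip_flip[of l s, symmetric] by (auto simp: image_iff)
    qed
    then have "card (D l) \<le> card ((D l \<inter> {s. Q s}) \<union> flip l ` (D l \<inter> {s. Q s}))"
      by (intro card_mono) (auto simp: finD)
    also have "\<dots> \<le> card (D l \<inter> {s. Q s}) + card (flip l ` (D l \<inter> {s. Q s}))" by (rule card_Un_le)
    also have "card (flip l ` (D l \<inter> {s. Q s})) \<le> card (D l \<inter> {s. Q s})" by (rule card_image_le) (simp add: finD)
    finally show ?thesis by simp
  qed
  have disj: "D l \<inter> D l' = {}" if "l \<in> L" "l' \<in> L" "l \<noteq> l'" for l l'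
    using that by (cases l l' rule: linorder_cases) (auto simp: D_def)
  have "{s\<in>Pow J. \<exists>l\<in>L. PP l s} \<subseteq> (\<Union>l\<in>L. D l)"
  proof
    fix s assume s: "s \<in> {s\<in>Pow J. \<exists>l\<in>L. PP l s}"
    define l where "l = Min {l\<in>L. PP l s}"
    have ne: "finite {l\<in>L. PP l s}" "{l\<in>L. PP l s} \<noteq> {}" using s L by auto
    have "l \<in> {l\<in>L. PP l s}" unfolding l_def by (rule Min_in[OF ne])
    moreover have "\<not> PP i s" if "i \<in> L" "i < l" for i
    proof
      assume "PP i s"
      then have "l \<le> i" unfolding l_def using ne(1) that by (intro Min_le) auto
      then show False using that by simp
    qed
    ultimately show "s \<in> (\<Union>l\<in>L. D l)" using s by (auto simp: D_def)
  qed
  then have "card {s\<in>Pow J. \<exists>l\<in>L. PP l s} \<le> card (\<Union>l\<in>L. D l)"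
    using L finD by (intro card_mono) auto
  also have "\<dots> = (\<Sum>l\<in>L. card (D l))"
    using L finD disj by (intro card_UN_disjoint) auto
  also have "\<dots> \<le> (\<Sum>l\<in>L. 2 * card (D l \<inter> {s. Q s}))" by (intro sum_mono cardD)
  also have "\<dots> = 2 * (\<Sum>l\<in>L. card (D l \<inter> {s. Q s}))" by (simp add: sum_distrib_left)
  also have "(\<Sum>l\<in>L. card (D l \<inter> {s. Q s})) = card (\<Union>l\<in>L. D l \<inter> {s. Q s})"
    using L finD disj by (intro card_UN_disjoint[symmetric]) auto
  also have "\<dots> \<le> card {s\<in>Pow J. Q s}"
    using J by (intro card_mono) (auto simp: D_def)
  finally show ?thesis by (simp add: PP_def Q_def)
qed

text \<open>By the parallelogram law the two signs of a new vector add up to twice the old square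
  plus twice the new one, so the cross terms cancel in the average over all patterns.\<close>

lemma sum_signs_norm_square:
  fixes x :: "'i \<Rightarrow> 'a::real_inner"
  assumes "finite J"
  shows "(\<Sum>s\<in>Pow J. (norm (\<Sum>j\<in>J. set_sign s j *\<^sub>R x j))\<^sup>2) = 2 ^ card J * (\<Sum>j\<in>J. (norm (x j))\<^sup>2)"
  using assms
proof (induction J)
  case (insert a J)
  let ?S = "\<lambda>s. \<Sum>j\<in>J. set_sign s j *\<^sub>R x j"
  have ins: "(\<Sum>j\<in>J. set_sign (insert a s) j *\<^sub>R x j) = ?S s" for s
    using insert by (intro sum.cong) (auto simp: set_sign_def)
  have inj: "inj_on (insert a) (Pow J)" using insert by (auto simp: inj_on_def)
  have "(\<Sum>s\<in>Pow (insert a J). (norm (\<Sum>j\<in>insert a J. set_sign s j *\<^sub>R x j))\<^sup>2) =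
    (\<Sum>s\<in>Pow J. (norm (\<Sum>j\<in>insert a J. set_sign s j *\<^sub>R x j))\<^sup>2) +
    (\<Sum>s\<in>insert a ` Pow J. (norm (\<Sum>j\<in>insert a J. set_sign s j *\<^sub>R x j))\<^sup>2)"
    unfolding Pow_insert using insert by (subst sum.union_disjoint) auto
  also have "\<dots> = (\<Sum>s\<in>Pow J. (norm (\<Sum>j\<in>insert a J. set_sign s j *\<^sub>R x j))\<^sup>2 +
      (norm (\<Sum>j\<in>insert a J. set_sign (insert a s) j *\<^sub>R x j))\<^sup>2)"
    by (subst sum.reindex[OF inj]) (simp add: sum.distrib)
  also have "\<dots> = (\<Sum>s\<in>Pow J. 2 * (norm (?S s))\<^sup>2 + 2 * (norm (x a))\<^sup>2)"
  proof (intro sum.cong refl)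
    fix s assume "s \<in> Pow J"
    then have "a \<notin> s" using insert by auto
    then have "(\<Sum>j\<in>insert a J. set_sign s j *\<^sub>R x j) = x a + ?S s"
      "(\<Sum>j\<in>insert a J. set_sign (insert a s) j *\<^sub>R x j) = - x a + ?S s"
      using insert ins by (auto simp: set_sign_def)
    then show "(norm (\<Sum>j\<in>insert a J. set_sign s j *\<^sub>R x j))\<^sup>2 +
      (norm (\<Sum>j\<in>insert a J. set_sign (insert a s) j *\<^sub>R x j))\<^sup>2 = 2 * (norm (?S s))\<^sup>2 + 2 * (norm (x a))\<^sup>2"
      by (simp add: power2_norm_eq_inner inner_add_left inner_add_right inner_diff_left inner_diff_right inner_commute)
  qed
  also have "\<dots> = 2 * (\<Sum>s\<in>Pow J. (norm (?S s))\<^sup>2) + 2 ^ card J * (2 * (norm (x a))\<^sup>2)"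
    using insert.hyps by (simp add: sum.distrib sum_distrib_left card_Pow)
  also have "\<dots> = 2 ^ card (insert a J) * (\<Sum>j\<in>insert a J. (norm (x j))\<^sup>2)"
    unfolding insert.IH using insert.hyps by (simp add: distrib_left)
  finally show ?case .
qed simp

text \<open>Each use of the maximal count costs a factor 2: the first removes the maximum over the
  number of terms with the time sets kept as second parameter, the second removes the maximum over
  time. Chebyshev's inequality for the full signed sum, whose mean square is the sum of squares,
  does the rest.\<close>

lemma two_parameter_sign_count:
  fixes x :: "nat \<Rightarrow> 'a::real_inner" and \<tau> :: "nat \<Rightarrow> real"
  assumes \<delta>: "0 < \<delta>"
  shows "real (card {s\<in>Pow {m..<N}. \<exists>n\<in>{m..N}. \<exists>i\<in>{m..<N}.
      \<delta> < norm (\<Sum>j\<in>{m..<n}. if \<tau> j \<le> \<tau> i then set_sign s j *\<^sub>R x j else 0)}) * \<delta>\<^sup>2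
    \<le> 4 * 2 ^ card {m..<N} * (\<Sum>j\<in>{m..<N}. (norm (x j))\<^sup>2)"
proof -
  let ?J = "{m..<N}"
  define c3 where "c3 = card {s\<in>Pow ?J. \<delta> < norm (\<Sum>j\<in>?J. set_sign s j *\<^sub>R x j)}"
  have "{s\<in>Pow ?J. \<exists>n\<in>{m..N}. \<exists>i\<in>?J. \<delta> < norm (\<Sum>j\<in>{m..<n}. if \<tau> j \<le> \<tau> i then set_sign s j *\<^sub>R x j else 0)} =
     {s\<in>Pow ?J. \<exists>n\<in>{m..N}. \<exists>i\<in>?J. \<delta> < norm (\<Sum>j\<in>?J \<inter> {..<n} \<inter> {j. \<tau> j \<le> \<tau> i}. set_sign s j *\<^sub>R x j)}"
  proof -
    have "(\<Sum>j\<in>{m..<n}. if \<tau> j \<le> \<tau> i then set_sign s j *\<^sub>R x j else 0) = (\<Sum>j\<in>?J \<inter> {..<n} \<inter> {j. \<tau> j \<le> \<tau> i}. set_sign s j *\<^sub>R x j)"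
      if "n \<in> {m..N}" for n i s
    proof -
      have "?J \<inter> {..<n} \<inter> {j. \<tau> j \<le> \<tau> i} = {m..<n} \<inter> {j. \<tau> j \<le> \<tau> i}" using that by auto
      then show ?thesis by (simp add: sum.inter_restrict)
    qed
    then show ?thesis by (intro Collect_cong conj_cong refl bex_cong) simp
  qed
  also have "card \<dots> \<le> 2 * card {s\<in>Pow ?J. \<exists>i\<in>?J. \<delta> < norm (\<Sum>j\<in>?J \<inter> {j. \<tau> j \<le> \<tau> i}. set_sign s j *\<^sub>R x j)}"
    by (rule levy_maximal_count[where A=lessThan and K="\<lambda>i. {j. \<tau> j \<le> \<tau> i}"]) auto
  \<comment> \<open>Time is now the ordered parameter. It is indexed by the values of
    \<open>\<tau>\<close>, for which the sets \<open>{j. \<tau> j \<le> t}\<close> increase, and the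
    second parameter becomes trivial.\<close>
  also have "{s\<in>Pow ?J. \<exists>i\<in>?J. \<delta> < norm (\<Sum>j\<in>?J \<inter> {j. \<tau> j \<le> \<tau> i}. set_sign s j *\<^sub>R x j)} =
    {s\<in>Pow ?J. \<exists>t\<in>\<tau> ` ?J. \<exists>r\<in>{()}. \<delta> < norm (\<Sum>j\<in>?J \<inter> {j. \<tau> j \<le> t} \<inter> UNIV. set_sign s j *\<^sub>R x j)}"
    by (intro Collect_cong conj_cong refl) simp
  also have "card \<dots> \<le> 2 * card {s\<in>Pow ?J. \<exists>r\<in>{()}. \<delta> < norm (\<Sum>j\<in>?J \<inter> UNIV. set_sign s j *\<^sub>R x j)}"
    by (rule levy_maximal_count[where A="\<lambda>t. {j. \<tau> j \<le> t}" and K="\<lambda>_. UNIV"]) auto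
  also have "card {s\<in>Pow ?J. \<exists>r\<in>{()}. \<delta> < norm (\<Sum>j\<in>?J \<inter> UNIV. set_sign s j *\<^sub>R x j)} = c3"
    by (simp add: c3_def)
  finally have "card {s\<in>Pow ?J. \<exists>n\<in>{m..N}. \<exists>i\<in>?J. \<delta> < norm (\<Sum>j\<in>{m..<n}. if \<tau> j \<le> \<tau> i then set_sign s j *\<^sub>R x j else 0)} \<le> 4 * c3"
    by simp
  then have "real (card {s\<in>Pow ?J. \<exists>n\<in>{m..N}. \<exists>i\<in>?J. \<delta> < norm (\<Sum>j\<in>{m..<n}. if \<tau> j \<le> \<tau> i then set_sign s j *\<^sub>R x j else 0)}) * \<delta>\<^sup>2
     \<le> real (4 * c3) * \<delta>\<^sup>2"
    by (intro mult_right_mono) (auto simp del: of_nat_mult)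
  also have "real c3 * \<delta>\<^sup>2 \<le> (\<Sum>s\<in>Pow ?J. (norm (\<Sum>j\<in>?J. set_sign s j *\<^sub>R x j))\<^sup>2)"
  proof -
    have "real c3 * \<delta>\<^sup>2 = (\<Sum>s\<in>{s\<in>Pow ?J. \<delta> < norm (\<Sum>j\<in>?J. set_sign s j *\<^sub>R x j)}. \<delta>\<^sup>2)"
      by (simp add: c3_def)
    also have "\<dots> \<le> (\<Sum>s\<in>{s\<in>Pow ?J. \<delta> < norm (\<Sum>j\<in>?J. set_sign s j *\<^sub>R x j)}. (norm (\<Sum>j\<in>?J. set_sign s j *\<^sub>R x j))\<^sup>2)"
      using \<delta> by (intro sum_mono power_mono) auto
    also have "\<dots> \<le> (\<Sum>s\<in>Pow ?J. (norm (\<Sum>j\<in>?J. set_sign s j *\<^sub>R x j))\<^sup>2)"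
      by (intro sum_mono2) auto
    finally show ?thesis .
  qed
  then have "real (4 * c3) * \<delta>\<^sup>2 \<le> 4 * (2 ^ card ?J * (\<Sum>j\<in>?J. (norm (x j))\<^sup>2))"
    by (simp add: sum_signs_norm_square)
  finally show ?thesis by (simp add: mult.assoc)
qed

text \<open>Invariance under all sign patterns replaces the probability of a large block by its
  average over the patterns, and for every fixed \<open>\<omega>\<close> that average is bounded by
  the sign count. The bounds \<open>c j\<close> are deterministic, so the resulting estimate tends
  to 0 with the tail of the series of squares.\<close>

lemma (in prob_space) AE_uniformly_convergent_symmetric:
  fixes X :: "nat \<Rightarrow> 'a \<Rightarrow> 'b::euclidean_space" and \<tau> :: "nat \<Rightarrow> 'a \<Rightarrow> real" and c :: "nat \<Rightarrow> real"
  assumes X[measurable]: "\<And>j. X j \<in> borel_measurable M" and \<tau>[measurable]: "\<And>j. \<tau> j \<in> borel_measurable M"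
    and bd: "\<And>j \<omega>. \<omega> \<in> space M \<Longrightarrow> norm (X j \<omega>) \<le> c j" and sm: "summable (\<lambda>j. (c j)\<^sup>2)"
    and sym: "\<And>s. distr M (PiM UNIV (\<lambda>_. borel \<Otimes>\<^sub>M borel)) (\<lambda>\<omega> j. (set_sign s j *\<^sub>R X j \<omega>, \<tau> j \<omega>)) =
       distr M (PiM UNIV (\<lambda>_. borel \<Otimes>\<^sub>M borel)) (\<lambda>\<omega> j. (X j \<omega>, \<tau> j \<omega>))"
  shows "AE \<omega> in M. uniformly_convergent_on UNIV (\<lambda>n t. \<Sum>j<n. if \<tau> j \<omega> \<le> t then X j \<omega> else 0)"
proof -
  define S where "S = (PiM UNIV (\<lambda>_. borel \<Otimes>\<^sub>M borel) :: (nat \<Rightarrow> 'b \<times> real) measure)"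
  \<comment> \<open>The event lives in the space of sequences, so that equality of laws applies to
    it. Only the times of the block itself are tested, which leaves finitely many
    conditions.\<close>
  define Ev where "Ev m N \<delta> = {y \<in> space S. \<exists>n\<in>{m..N}. \<exists>i\<in>{m..<N}.
      \<delta> < norm (\<Sum>j\<in>{m..<n}. if snd (y j) \<le> snd (y i) then fst (y j) else 0)}" for m N :: nat and \<delta> :: real
  have Ev[measurable]: "Ev m N \<delta> \<in> sets S" for m N \<delta>
    unfolding Ev_def S_def by measurable
  define y where "y s \<omega> = (\<lambda>j. (set_sign s j *\<^sub>R X j \<omega>, \<tau> j \<omega>))" for s \<omega>
  have ym[measurable]: "y s \<in> measurable M S" for s
    unfolding y_def S_def by (rule measurable_PiM_single') (auto simp: space_pair_measure)
  have y0: "y {} \<omega> = (\<lambda>j. (X j \<omega>, \<tau> j \<omega>))" for \<omega> by (simp add: y_def set_sign_def)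
  have spS: "space S = UNIV" by (simp add: S_def space_PiM space_pair_measure)
  define B where "B m N \<delta> = y {} -` Ev m N \<delta> \<inter> space M" for m N \<delta>
  have Bm[measurable]: "B m N \<delta> \<in> sets M" for m N \<delta> unfolding B_def by measurable
  have Bs: "prob (y s -` Ev m N \<delta> \<inter> space M) = prob (B m N \<delta>)" for s m N \<delta>
  proof -
    have "distr M S (y s) = distr M S (y {})"
    proof -
      have "y {} = (\<lambda>\<omega> j. (X j \<omega>, \<tau> j \<omega>))" using y0 by (rule ext)
      moreover have "distr M S (y s) = distr M S (\<lambda>\<omega> j. (X j \<omega>, \<tau> j \<omega>))"
        using sym[of s] unfolding y_def S_def .
      ultimately show ?thesis by (simp only:)
    qed
    then have "measure (distr M S (y s)) (Ev m N \<delta>) = measure (distr M S (y {})) (Ev m N \<delta>)" by simp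
    then show ?thesis by (simp add: measure_distr B_def)
  qed
  have PB: "prob (B m N \<delta>) \<le> 4 / \<delta>\<^sup>2 * (\<Sum>j\<in>{m..<N}. (c j)\<^sup>2)" if \<delta>: "0 < \<delta>" for m N \<delta>
  proof -
    let ?J = "{m..<N}"
    have cnt: "(\<Sum>s\<in>Pow ?J. indicator (y s -` Ev m N \<delta> \<inter> space M) \<omega>) \<le> 4 * 2 ^ card ?J * (\<Sum>j\<in>?J. (c j)\<^sup>2) / \<delta>\<^sup>2"
      if \<omega>: "\<omega> \<in> space M" for \<omega>
    proof -
      have "(\<Sum>s\<in>Pow ?J. indicator (y s -` Ev m N \<delta> \<inter> space M) \<omega>) =
        (\<Sum>s\<in>Pow ?J. if \<omega> \<in> y s -` Ev m N \<delta> \<inter> space M then 1 else 0)"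
        by (intro sum.cong) (auto simp: indicator_def)
      also have "\<dots> = (\<Sum>s\<in>{s\<in>Pow ?J. \<omega> \<in> y s -` Ev m N \<delta> \<inter> space M}. 1)"
        by (rule sum.inter_filter[symmetric]) simp
      also have "\<dots> = real (card {s\<in>Pow ?J. \<omega> \<in> y s -` Ev m N \<delta> \<inter> space M})"
        by (simp only: sum_constant mult_1_right)
      also have "{s\<in>Pow ?J. \<omega> \<in> y s -` Ev m N \<delta> \<inter> space M} = {s\<in>Pow ?J. \<exists>n\<in>{m..N}. \<exists>i\<in>{m..<N}.
         \<delta> < norm (\<Sum>j\<in>{m..<n}. if \<tau> j \<omega> \<le> \<tau> i \<omega> then set_sign s j *\<^sub>R X j \<omega> else 0)}"
        using \<omega> by (simp add: Ev_def y_def spS cong: if_cong)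
      also have "real (card \<dots>) \<le> 4 * 2 ^ card ?J * (\<Sum>j\<in>?J. (norm (X j \<omega>))\<^sup>2) / \<delta>\<^sup>2"
        using two_parameter_sign_count[OF \<delta>, of m N "\<lambda>j. \<tau> j \<omega>" "\<lambda>j. X j \<omega>"] \<delta>
        by (simp only: pos_le_divide_eq zero_less_power)
      also have "\<dots> \<le> 4 * 2 ^ card ?J * (\<Sum>j\<in>?J. (c j)\<^sup>2) / \<delta>\<^sup>2"
        using bd[OF \<omega>] by (intro divide_right_mono mult_left_mono sum_mono power_mono) auto
      finally show ?thesis .
    qed
    \<comment> \<open>All patterns give the same probability; exchanging the sum over patterns with
      the mean leads to the count for fixed \<open>\<omega>\<close>.\<close>
    have "2 ^ card ?J * prob (B m N \<delta>) = (\<Sum>s\<in>Pow ?J. prob (y s -` Ev m N \<delta> \<inter> space M))"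
      by (simp add: Bs card_Pow)
    also have "\<dots> = (LINT \<omega>|M. (\<Sum>s\<in>Pow ?J. indicator (y s -` Ev m N \<delta> \<inter> space M) \<omega>))"
      by (subst Bochner_Integration.integral_sum) (auto simp: integrable_indicator_iff emeasure_eq_measure Int_absorb1)
    also have "\<dots> \<le> (LINT \<omega>|M. 4 * 2 ^ card ?J * (\<Sum>j\<in>?J. (c j)\<^sup>2) / \<delta>\<^sup>2)"
      using cnt by (intro integral_mono) (auto simp: emeasure_eq_measure)
    also have "\<dots> = 2 ^ card ?J * (4 / \<delta>\<^sup>2 * (\<Sum>j\<in>?J. (c j)\<^sup>2))" by (simp add: prob_space)
    finally show ?thesis by (rule mult_left_le_imp_le) simp
  qed
  define r where "r m = suminf (\<lambda>j. (c j)\<^sup>2) - (\<Sum>j<m. (c j)\<^sup>2)" for m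
  have rlim: "r \<longlonglongrightarrow> 0"
  proof -
    have "(\<lambda>m. suminf (\<lambda>j. (c j)\<^sup>2) - (\<Sum>j<m. (c j)\<^sup>2)) \<longlonglongrightarrow> suminf (\<lambda>j. (c j)\<^sup>2) - suminf (\<lambda>j. (c j)\<^sup>2)"
      by (intro tendsto_intros summable_LIMSEQ sm)
    then show ?thesis by (simp add: r_def[abs_def])
  qed
  have tail: "(\<Sum>j\<in>{m..<N}. (c j)\<^sup>2) \<le> r m" for m N
  proof (cases "m \<le> N")
    case True
    have "(\<Sum>j<N. (c j)\<^sup>2) = (\<Sum>j<m. (c j)\<^sup>2) + (\<Sum>j\<in>{m..<N}. (c j)\<^sup>2)"
      using True by (simp add: lessThan_atLeast0 sum.atLeastLessThan_concat)
    moreover have "(\<Sum>j<N. (c j)\<^sup>2) \<le> suminf (\<lambda>j. (c j)\<^sup>2)" by (intro sum_le_suminf sm) auto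
    ultimately show ?thesis by (simp add: r_def)
  next
    case False
    then show ?thesis using sum_le_suminf[OF sm, of "{..<m}"] by (simp add: r_def)
  qed
  \<comment> \<open>At a fixed level, some block starting at \<open>m\<close> exceeds it with
    probability at most a multiple of \<open>r m\<close>. As \<open>m\<close> grows this tends to 0,
    so almost surely some start is good for every block length.\<close>
  have null: "AE \<omega> in M. \<exists>m. \<forall>N. \<omega> \<notin> B m N \<delta>" if \<delta>: "0 < \<delta>" for \<delta>
  proof -
    have PU: "prob (\<Union>N. B m N \<delta>) \<le> 4 / \<delta>\<^sup>2 * r m" for m
    proof -
      have inc: "incseq (\<lambda>N. B m N \<delta>)"
        unfolding incseq_def B_def Ev_def by (auto; meson atLeastAtMost_iff atLeastLessThan_iff order_trans less_le_trans)
      have "(\<lambda>N. prob (B m N \<delta>)) \<longlonglongrightarrow> prob (\<Union>N. B m N \<delta>)"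
        by (rule finite_Lim_measure_incseq[OF _ inc]) auto
      moreover have "prob (B m N \<delta>) \<le> 4 / \<delta>\<^sup>2 * r m" for N
        using PB[OF \<delta>, of m N] mult_left_mono[OF tail[of m N], of "4 / \<delta>\<^sup>2"] by simp
      ultimately show ?thesis by (intro LIMSEQ_le_const2) auto
    qed
    have "(\<lambda>m. 4 / \<delta>\<^sup>2 * r m) \<longlonglongrightarrow> 4 / \<delta>\<^sup>2 * 0" by (intro tendsto_intros rlim)
    moreover have "prob (\<Inter>m. \<Union>N. B m N \<delta>) \<le> 4 / \<delta>\<^sup>2 * r m" for m
      by (rule order_trans[OF finite_measure_mono PU]) auto
    ultimately have "prob (\<Inter>m. \<Union>N. B m N \<delta>) \<le> 0"
      by (intro LIMSEQ_le_const[of "\<lambda>m. 4 / \<delta>\<^sup>2 * r m"]) auto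
    then have "(\<Inter>m. \<Union>N. B m N \<delta>) \<in> null_sets M"
      by (intro null_setsI) (auto simp: emeasure_eq_measure measure_le_0_iff)
    from AE_not_in[OF this] show ?thesis by eventually_elim auto
  qed
  have "AE \<omega> in M. \<forall>k::nat. \<exists>m. \<forall>N. \<omega> \<notin> B m N (1 / real (Suc k))"
    unfolding AE_all_countable by (intro allI null) simp
  then show ?thesis
    using AE_space
  proof eventually_elim
    case (elim \<omega>)
    \<comment> \<open>For arbitrary real \<open>t\<close> the block sum equals the one at the latest
      time of the block not exceeding \<open>t\<close>, so the tests at block times control all
      \<open>t\<close>. If there is no such time, the sum is 0.\<close>
    have small: "norm (\<Sum>j\<in>{m..<n}. if \<tau> j \<omega> \<le> t then X j \<omega> else 0) \<le> \<delta>"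
      if nB: "\<And>N. \<omega> \<notin> B m N \<delta>" and \<delta>: "0 < \<delta>" and "m \<le> n" for m n \<delta> t
    proof (cases "\<exists>j\<in>{m..<n}. \<tau> j \<omega> \<le> t")
      case False
      then have "(\<Sum>j\<in>{m..<n}. if \<tau> j \<omega> \<le> t then X j \<omega> else 0) = 0" by (intro sum.neutral) auto
      then show ?thesis using \<delta> by simp
    next
      case True
      define I where "I = {j\<in>{m..<n}. \<tau> j \<omega> \<le> t}"
      have I: "finite I" "I \<noteq> {}" using True by (auto simp: I_def)
      obtain i where i: "i \<in> I" "\<And>j. j \<in> I \<Longrightarrow> \<tau> j \<omega> \<le> \<tau> i \<omega>"
      proof -
        have "Max ((\<lambda>j. \<tau> j \<omega>) ` I) \<in> (\<lambda>j. \<tau> j \<omega>) ` I" using I by (intro Max_in) auto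
        then obtain i where "i \<in> I" "\<tau> i \<omega> = Max ((\<lambda>j. \<tau> j \<omega>) ` I)" by auto
        then show ?thesis using I by (intro that[of i]) auto
      qed
      have "(\<Sum>j\<in>{m..<n}. if \<tau> j \<omega> \<le> t then X j \<omega> else 0) = (\<Sum>j\<in>{m..<n}. if \<tau> j \<omega> \<le> \<tau> i \<omega> then X j \<omega> else 0)"
        using i by (intro sum.cong) (auto simp: I_def)
      moreover have "norm (\<Sum>j\<in>{m..<n}. if \<tau> j \<omega> \<le> \<tau> i \<omega> then X j \<omega> else 0) \<le> \<delta>"
      proof (rule ccontr)
        assume "\<not> ?thesis"
        then have "\<exists>i\<in>{m..<n}. \<delta> < norm (\<Sum>j\<in>{m..<n}. if \<tau> j \<omega> \<le> \<tau> i \<omega> then X j \<omega> else 0)"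
          using i(1) by (intro bexI[of _ i]) (auto simp: I_def)
        then have "\<exists>k\<in>{m..n}. \<exists>i\<in>{m..<n}. \<delta> < norm (\<Sum>j\<in>{m..<k}. if \<tau> j \<omega> \<le> \<tau> i \<omega> then X j \<omega> else 0)"
          using \<open>m \<le> n\<close> by - (rule bexI[where x=n], assumption, simp)
        then have "\<omega> \<in> B m n \<delta>" using elim(2)
          by (simp add: B_def Ev_def y0 spS cong: if_cong)
        then show False using nB by blast
      qed
      ultimately show ?thesis by simp
    qed
    have "uniformly_Cauchy_on UNIV (\<lambda>n t. \<Sum>j<n. if \<tau> j \<omega> \<le> t then X j \<omega> else 0)"
      unfolding uniformly_Cauchy_on_def
    proof (intro allI impI)
      fix e :: real assume e: "0 < e"
      obtain k :: nat where k: "1 / real (Suc k) < e / 2" using nat_approx_posE[of "e / 2"] e by auto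
      obtain m where m: "\<And>N. \<omega> \<notin> B m N (1 / real (Suc k))" using elim(1) by blast
      show "\<exists>M. \<forall>x\<in>UNIV. \<forall>a\<ge>M. \<forall>n\<ge>M. dist (\<Sum>j<a. if \<tau> j \<omega> \<le> x then X j \<omega> else 0) (\<Sum>j<n. if \<tau> j \<omega> \<le> x then X j \<omega> else 0) < e"
      proof (intro exI[of _ m] ballI allI impI)
        fix t a n assume "m \<le> a" "m \<le> n"
        have sp: "(\<Sum>j<a. if \<tau> j \<omega> \<le> t then X j \<omega> else 0) = (\<Sum>j<m. if \<tau> j \<omega> \<le> t then X j \<omega> else 0) +
           (\<Sum>j\<in>{m..<a}. if \<tau> j \<omega> \<le> t then X j \<omega> else 0)" if "m \<le> a" for a
          using that by (simp add: lessThan_atLeast0 sum.atLeastLessThan_concat)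
        have "dist (\<Sum>j<a. if \<tau> j \<omega> \<le> t then X j \<omega> else 0) (\<Sum>j<n. if \<tau> j \<omega> \<le> t then X j \<omega> else 0) =
          norm ((\<Sum>j\<in>{m..<a}. if \<tau> j \<omega> \<le> t then X j \<omega> else 0) - (\<Sum>j\<in>{m..<n}. if \<tau> j \<omega> \<le> t then X j \<omega> else 0))"
          unfolding sp[OF \<open>m \<le> a\<close>] sp[OF \<open>m \<le> n\<close>] by (simp add: dist_norm)
        also have "\<dots> \<le> 1 / real (Suc k) + 1 / real (Suc k)"
          by (intro order_trans[OF norm_triangle_ineq4] add_mono small m \<open>m \<le> a\<close> \<open>m \<le> n\<close>) auto
        also have "\<dots> < e" using k by simp
        finally show "dist (\<Sum>j<a. if \<tau> j \<omega> \<le> t then X j \<omega> else 0) (\<Sum>j<n. if \<tau> j \<omega> \<le> t then X j \<omega> else 0) < e" .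
      qed
    qed
    then show ?case by (rule Cauchy_uniformly_convergent)
  qed
qed

section \<open>Convergence of the series\<close>

text \<open>The sums of the differences \<open>g j - f j\<close> stop changing from an index common
  to all \<open>t\<close>, so adding them preserves uniform convergence.\<close>

lemma uniformly_convergent_on_sum_eventually_eq:
  fixes f g :: "nat \<Rightarrow> 'a \<Rightarrow> 'b::real_normed_vector"
  assumes conv: "uniformly_convergent_on S (\<lambda>n t. \<Sum>j<n. f j t)"
    and ev: "eventually (\<lambda>j. \<forall>t\<in>S. f j t = g j t) sequentially"
  shows "uniformly_convergent_on S (\<lambda>n t. \<Sum>j<n. g j t)"
proof -
  obtain N where N: "\<And>j t. j \<ge> N \<Longrightarrow> t \<in> S \<Longrightarrow> f j t = g j t"
    using ev by (auto simp: eventually_sequentially)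
  obtain l where l: "uniform_limit S (\<lambda>n t. \<Sum>j<n. f j t) l sequentially"
    using conv by (auto simp: uniformly_convergent_on_def)
  have "uniform_limit S (\<lambda>n t. \<Sum>j<n. g j t - f j t) (\<lambda>t. \<Sum>j<N. g j t - f j t) sequentially"
  proof (rule uniform_limitI)
    fix e :: real assume "0 < e"
    have eq: "(\<Sum>j<n. g j t - f j t) = (\<Sum>j<N. g j t - f j t)" if "n \<ge> N" "t \<in> S" for n t
      using that N by (intro sum.mono_neutral_right) auto
    show "\<forall>\<^sub>F n in sequentially. \<forall>t\<in>S. dist (\<Sum>j<n. g j t - f j t) (\<Sum>j<N. g j t - f j t) < e"
      using eventually_ge_at_top[of N]
    proof eventually_elim
      case (elim n)
      show ?case
      proof
        fix t assume "t \<in> S"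
        show "dist (\<Sum>j<n. g j t - f j t) (\<Sum>j<N. g j t - f j t) < e"
          using \<open>0 < e\<close> by (simp only: eq[OF elim \<open>t \<in> S\<close>] dist_self)
      qed
    qed
  qed
  from uniform_limit_add[OF l this]
  have "uniform_limit S (\<lambda>n t. \<Sum>j<n. g j t) (\<lambda>t. l t + (\<Sum>j<N. g j t - f j t)) sequentially"
    by (simp add: sum.distrib[symmetric])
  then show ?thesis by (auto simp: uniformly_convergent_on_def)
qed

text \<open>This is the Moore-Osgood exchange of limits. Each summand is eventually constant along
  \<open>F\<close>, so the inner limits are trivial and the series of their values is Cauchy by
  uniformity. It serves for right limits, left limits and continuity at a fixed time.\<close>

lemma uniform_limit_sum_tendsto:
  fixes f :: "nat \<Rightarrow> real \<Rightarrow> 'b::banach"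
  assumes ul: "uniform_limit S (\<lambda>n t. \<Sum>j<n. f j t) L sequentially"
    and F: "F \<noteq> bot" "eventually (\<lambda>t. t \<in> S) F"
    and stat: "\<And>j. eventually (\<lambda>t. f j t = l j) F"
  obtains a where "(\<lambda>n. \<Sum>j<n. l j) \<longlonglongrightarrow> a" "(L \<longlongrightarrow> a) F"
proof -
  have evn: "eventually (\<lambda>t. (\<Sum>j<n. f j t) = (\<Sum>j<n. l j)) F" for n
  proof -
    have "eventually (\<lambda>t. \<forall>j\<in>{..<n}. f j t = l j) F" by (intro eventually_ball_finite ballI stat) auto
    then show ?thesis by eventually_elim auto
  qed
  have "Cauchy (\<lambda>n. \<Sum>j<n. l j)"
  proof (rule metric_CauchyI)
    fix e :: real assume "0 < e"
    have "uniformly_Cauchy_on S (\<lambda>n t. \<Sum>j<n. f j t)"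
      using ul by (intro uniformly_convergent_Cauchy) (auto simp: uniformly_convergent_on_def)
    then obtain N where N: "\<And>t m n. t \<in> S \<Longrightarrow> m \<ge> N \<Longrightarrow> n \<ge> N \<Longrightarrow> dist (\<Sum>j<m. f j t) (\<Sum>j<n. f j t) < e"
      unfolding uniformly_Cauchy_on_def using \<open>0 < e\<close> by meson
    show "\<exists>N. \<forall>m\<ge>N. \<forall>n\<ge>N. dist (\<Sum>j<m. l j) (\<Sum>j<n. l j) < e"
    proof (intro exI[of _ N] allI impI)
      fix m n assume mn: "N \<le> m" "N \<le> n"
      have "eventually (\<lambda>t. dist (\<Sum>j<m. l j) (\<Sum>j<n. l j) < e) F"
        using evn[of m] evn[of n] F(2)
      proof eventually_elim
        case (elim t)
        then show ?case using N[of t m n] mn by simp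
      qed
      then show "dist (\<Sum>j<m. l j) (\<Sum>j<n. l j) < e"
        using F(1) by (simp add: eventually_const_iff)
    qed
  qed
  then obtain a where a: "(\<lambda>n. \<Sum>j<n. l j) \<longlonglongrightarrow> a" using Cauchy_convergent convergent_def by blast
  moreover have "(L \<longlongrightarrow> a) F"
    by (rule swap_uniform_limit'[OF _ a ul F(2)]) (auto intro!: always_eventually tendsto_eventually evn)
  ultimately show ?thesis by (rule that)
qed

lemma eventually_indicator_at_right:
  fixes \<tau> t :: real
  shows "eventually (\<lambda>s. indicator {0<..s} \<tau> = (indicator {0<..t} \<tau> :: real)) (at_right t)"
proof (cases "\<tau> \<le> t")
  case True
  show ?thesis
    using eventually_at_right_less[of t] by eventually_elim (use True in \<open>auto simp: indicator_def\<close>)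
next
  case False
  then have "eventually (\<lambda>s. s \<in> {t<..<\<tau>}) (at_right t)" by (intro eventually_at_right_real) auto
  then show ?thesis by eventually_elim (use False in \<open>auto simp: indicator_def\<close>)
qed

text \<open>From the left a jump exactly at \<open>t\<close> is not seen, hence the open interval in
  the limit.\<close>

lemma eventually_indicator_at_left:
  fixes \<tau> t :: real
  shows "eventually (\<lambda>s. indicator {0<..s} \<tau> = (indicator {0<..<t} \<tau> :: real)) (at_left t)"
proof (cases "\<tau> < t")
  case True
  then have "eventually (\<lambda>s. s \<in> {\<tau><..<t}) (at_left t)" by (intro eventually_at_left_real) auto
  then show ?thesis by eventually_elim (use True in \<open>auto simp: indicator_def\<close>)
next
  case False
  have "eventually (\<lambda>s. s \<in> {t - 1<..<t}) (at_left t)" by (intro eventually_at_left_real) auto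
  then show ?thesis by eventually_elim (use False in \<open>auto simp: indicator_def\<close>)
qed

lemma eventually_indicator_at:
  fixes \<tau> t :: real
  assumes "\<tau> \<noteq> t"
  shows "eventually (\<lambda>s. indicator {0<..s} \<tau> = (indicator {0<..t} \<tau> :: real)) (at t within S)"
proof (cases "\<tau> < t")
  case True
  then have "eventually (\<lambda>s. \<tau> < s) (at t within S)" by (intro order_tendstoD[OF tendsto_ident_at])
  then show ?thesis by eventually_elim (use True in \<open>auto simp: indicator_def\<close>)
next
  case False
  then have "t < \<tau>" using assms by simp
  then have "eventually (\<lambda>s. s < \<tau>) (at t within S)" by (intro order_tendstoD[OF tendsto_ident_at])
  then show ?thesis by eventually_elim (use \<open>t < \<tau>\<close> in \<open>auto simp: indicator_def\<close>)
qed

text \<open>Serves to build the law of a tuple, component by component, from disjoint parts of one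
  independent family.\<close>

lemma (in prob_space) distr_pair_indep_restrict:
  assumes ind: "indep_vars M' X I" and AB: "A \<inter> B = {}" "A \<subseteq> I" "B \<subseteq> I"
    and f[measurable]: "f \<in> measurable (PiM A M') S" and g[measurable]: "g \<in> measurable (PiM B M') T"
  shows "distr M (S \<Otimes>\<^sub>M T) (\<lambda>\<omega>. (f (restrict (\<lambda>i. X i \<omega>) A), g (restrict (\<lambda>i. X i \<omega>) B))) =
    distr M S (\<lambda>\<omega>. f (restrict (\<lambda>i. X i \<omega>) A)) \<Otimes>\<^sub>M distr M T (\<lambda>\<omega>. g (restrict (\<lambda>i. X i \<omega>) B))"
proof -
  let ?A = "\<lambda>\<omega>. restrict (\<lambda>i. X i \<omega>) A" and ?B = "\<lambda>\<omega>. restrict (\<lambda>i. X i \<omega>) B"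
  have iv: "indep_var (PiM A M') ?A (PiM B M') ?B" by (rule indep_var_restrict[OF ind AB])
  have [measurable]: "?A \<in> measurable M (PiM A M')" "?B \<in> measurable M (PiM B M')"
    using iv by (auto dest: indep_var_rv1 indep_var_rv2)
  have eq: "distr M (PiM A M' \<Otimes>\<^sub>M PiM B M') (\<lambda>\<omega>. (?A \<omega>, ?B \<omega>)) = distr M (PiM A M') ?A \<Otimes>\<^sub>M distr M (PiM B M') ?B"
    using iv by (simp add: indep_var_distribution_eq)
  have "distr M (S \<Otimes>\<^sub>M T) (\<lambda>\<omega>. (f (?A \<omega>), g (?B \<omega>))) =
     distr (distr M (PiM A M' \<Otimes>\<^sub>M PiM B M') (\<lambda>\<omega>. (?A \<omega>, ?B \<omega>))) (S \<Otimes>\<^sub>M T) (\<lambda>(x, y). (f x, g y))"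
    by (subst distr_distr) (auto simp: comp_def)
  also have "\<dots> = distr (distr M (PiM A M') ?A) S f \<Otimes>\<^sub>M distr (distr M (PiM B M') ?B) T g"
    unfolding eq
  proof (rule pair_measure_distr[symmetric])
    have "prob_space (distr (distr M (PiM B M') ?B) T g)"
      by (intro prob_space.prob_space_distr prob_space_distr) auto
    then show "sigma_finite_measure (distr (distr M (PiM B M') ?B) T g)"
      by (simp add: prob_space_def finite_measure_def)
  qed auto
  also have "\<dots> = distr M S (\<lambda>\<omega>. f (?A \<omega>)) \<Otimes>\<^sub>M distr M T (\<lambda>\<omega>. g (?B \<omega>))"
    by (simp add: distr_distr comp_def)
  finally show ?thesis .
qed

section \<open>The random variables of the series and their joint law\<close>

locale tempered_series = tempered_data sg Qk p \<alpha> T + prob_space P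
  for sg :: "'a::euclidean_space measure" and Qk :: "'a \<Rightarrow> real measure" and p \<alpha> T :: real and P :: "'w measure" +
  fixes E E' Tj U :: "nat \<Rightarrow> 'w \<Rightarrow> real" and V :: "nat \<Rightarrow> 'w \<Rightarrow> 'a"
  assumes E_rv: "\<forall>j. distributed P lborel (E j) (exponential_density 1)"
    and E'_rv: "\<forall>j. distributed P lborel (E' j) (exponential_density 1)"
    and Tj_meas: "\<forall>j. Tj j \<in> borel_measurable P"
    and Tj_distr: "\<forall>j. distr P borel (Tj j) = uniform_measure lborel {0<..<T}"
    and U_meas: "\<forall>j. U j \<in> borel_measurable P"
    and U_distr: "\<forall>j. distr P borel (U j) = uniform_measure lborel {0<..<1::real}"
    and V_meas: "\<forall>j. V j \<in> borel_measurable P"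
    and V_distr: "\<forall>j. distr P borel (V j) =
        scale_measure (ennreal (1 / measure sg (space sg))) (Q_measure sg Qk)"
    and indep: "prob_space.indep_sets P
        (\<lambda>(k, j). if k = (0::nat) then gen_events P (E j)
                  else if k = 1 then gen_events P (E' j)
                  else if k = 2 then gen_events P (Tj j)
                  else if k = 3 then gen_events P (U j)
                  else gen_events P (V j))
        ({0..<5} \<times> UNIV)"
begin

lemma rv_measurable[measurable]:
  "E j \<in> borel_measurable P" "E' j \<in> borel_measurable P" "Tj j \<in> borel_measurable P"
  "U j \<in> borel_measurable P" "V j \<in> borel_measurable P"
  using E_rv E'_rv Tj_meas U_meas V_meas by (auto simp: distributed_def)

lemma distr_E: "distr P borel (E j) = exp_law"
  and distr_E': "distr P borel (E' j) = exp_law"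
proof -
  have *: "distr P borel X = exp_law"
    if "distributed P lborel X (exponential_density 1)" for X
  proof -
    have "distr P borel X = distr P lborel X" by (rule distr_cong) auto
    then show ?thesis using that by (simp add: distributed_def)
  qed
  show "distr P borel (E j) = exp_law"
    "distr P borel (E' j) = exp_law"
    using E_rv E'_rv by (auto intro: *)
qed

lemma distr_V: "distr P borel (V j) = VL"
  using V_distr by (simp add: VL_def ns_def)

text \<open>All variables are embedded in one type, since independence of a family requires a common codomain.\<close>

definition X0 :: "nat \<times> nat \<Rightarrow> 'w \<Rightarrow> real \<times> 'a" where
  "X0 = (\<lambda>(k, j) \<omega>. if k = 0 then (E j \<omega>, 0) else if k = 1 then (E' j \<omega>, 0) else if k = 2 then (Tj j \<omega>, 0)
      else if k = 3 then (U j \<omega>, 0) else (0, V j \<omega>))"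

lemma indep_X0: "indep_vars (\<lambda>_. borel \<Otimes>\<^sub>M borel) X0 ({0..<5} \<times> UNIV)"
  unfolding indep_vars_def2
proof (intro conjI ballI)
  fix i :: "nat \<times> nat"
  show "X0 i \<in> measurable P (borel \<Otimes>\<^sub>M borel)"
    by (cases i) (auto simp: X0_def)
next
  \<comment> \<open>Composition with a measurable map generates no new events, so independence
    passes from the given variables to the embedded ones.\<close>
  have vim: "{(\<lambda>\<omega>. f (X \<omega>)) -` A \<inter> space P |A. A \<in> sets (borel \<Otimes>\<^sub>M borel)} \<subseteq> gen_events P X"
    if f: "f \<in> measurable borel (borel \<Otimes>\<^sub>M borel)" for X :: "'w \<Rightarrow> 'b::topological_space" and f :: "'b \<Rightarrow> real \<times> 'a"
  proof safe
    fix A :: "(real \<times> 'a) set" assume "A \<in> sets (borel \<Otimes>\<^sub>M borel)"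
    then have "f -` A \<in> sets borel" using measurable_sets[OF f] by simp
    then show "(\<lambda>\<omega>. f (X \<omega>)) -` A \<inter> space P \<in> gen_events P X"
      unfolding gen_events_def by (intro CollectI exI[of _ "f -` A"]) auto
  qed
  have v1: "{(\<lambda>\<omega>. (X \<omega>, 0)) -` A \<inter> space P |A. A \<in> sets (borel \<Otimes>\<^sub>M (borel :: 'a measure))} \<subseteq> gen_events P X" for X :: "'w \<Rightarrow> real"
    by (rule vim) measurable
  have v2: "{(\<lambda>\<omega>. (0, X \<omega>)) -` A \<inter> space P |A. A \<in> sets ((borel :: real measure) \<Otimes>\<^sub>M (borel :: 'a measure))} \<subseteq> gen_events P X" for X :: "'w \<Rightarrow> 'a"
    by (rule vim) measurable
  show "indep_sets (\<lambda>i. {X0 i -` A \<inter> space P |A. A \<in> sets (borel \<Otimes>\<^sub>M borel)}) ({0..<5} \<times> UNIV)"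
  proof (rule indep_sets_mono_sets[OF indep])
    fix i :: "nat \<times> nat"
    obtain k j where i: "i = (k, j)" by (cases i)
    show "{X0 i -` A \<inter> space P |A. A \<in> sets (borel \<Otimes>\<^sub>M borel)} \<subseteq>
      (case i of (k, j) \<Rightarrow> if k = (0::nat) then gen_events P (E j)
                  else if k = 1 then gen_events P (E' j)
                  else if k = 2 then gen_events P (Tj j)
                  else if k = 3 then gen_events P (U j)
                  else gen_events P (V j))"
      unfolding i X0_def split using v1[of "E j"] v1[of "E' j"] v1[of "Tj j"] v1[of "U j"] v2[of "V j"] by auto
  qed
qed

text \<open>The mark of an arrival: its time, followed by the components in the order in which
  \<open>jump\<close> reads them.\<close>

definition Y :: "nat \<Rightarrow> 'w \<Rightarrow> real \<times> 'a \<times> real \<times> real" where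
  "Y j \<omega> = (Tj j \<omega>, V j \<omega>, U j \<omega>, E j \<omega>)"

definition \<nu> :: "(real \<times> 'a \<times> real \<times> real) measure" where
  "\<nu> = uniform_measure lborel {0<..<T} \<Otimes>\<^sub>M mark_law"

lemma sets_\<nu>[measurable_cong]: "sets \<nu> = sets (borel \<Otimes>\<^sub>M (borel \<Otimes>\<^sub>M (borel \<Otimes>\<^sub>M borel)))"
  unfolding \<nu>_def by (intro sets_pair_measure_cong sets_mark_law) auto

lemma prob_space_\<nu>: "prob_space \<nu>"
proof -
  interpret u: prob_space "uniform_measure lborel {0<..<T}" using T_pos by (rule prob_space_unif)
  interpret m: prob_space mark_law by (rule prob_space_mark_law)
  interpret pair_prob_space "uniform_measure lborel {0<..<T}" mark_law ..
  show ?thesis unfolding \<nu>_def by unfold_locales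
qed

lemma law_EU: "distr P (borel \<Otimes>\<^sub>M borel) (\<lambda>\<omega>. (U j \<omega>, E j \<omega>)) = unif_exp"
  using distr_pair_indep_restrict[OF indep_X0, of "{(3, j)}" "{(0, j)}" "\<lambda>h. fst (h (3, j))" borel "\<lambda>h. fst (h (0, j))" borel]
  by (simp add: X0_def distr_E U_distr)

lemma law_V: "distr P (borel \<Otimes>\<^sub>M (borel \<Otimes>\<^sub>M borel)) (\<lambda>\<omega>. (V j \<omega>, U j \<omega>, E j \<omega>)) = mark_law"
  using distr_pair_indep_restrict[OF indep_X0, of "{(4, j)}" "{(3, j), (0, j)}" "\<lambda>h. snd (h (4, j))" borel
      "\<lambda>h. (fst (h (3, j)), fst (h (0, j)))" "borel \<Otimes>\<^sub>M borel"]
  by (simp add: X0_def law_EU distr_V mark_law_def)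

lemma law_Y: "distr P (borel \<Otimes>\<^sub>M (borel \<Otimes>\<^sub>M (borel \<Otimes>\<^sub>M borel))) (Y j) = \<nu>"
  using distr_pair_indep_restrict[OF indep_X0, of "{(2, j)}" "{(4, j), (3, j), (0, j)}" "\<lambda>h. fst (h (2, j))" borel
      "\<lambda>h. (snd (h (4, j)), fst (h (3, j)), fst (h (0, j)))" "borel \<Otimes>\<^sub>M (borel \<Otimes>\<^sub>M borel)"]
  by (simp add: X0_def law_V Tj_distr \<nu>_def Y_def[abs_def])

lemma law_marked_Y: "distr P (borel \<Otimes>\<^sub>M \<nu>) (\<lambda>\<omega>. (E' j \<omega>, Y j \<omega>)) = exp_law \<Otimes>\<^sub>M \<nu>"
proof -
  have "distr P (borel \<Otimes>\<^sub>M \<nu>) (\<lambda>\<omega>. (E' j \<omega>, Y j \<omega>)) =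
     distr P (borel \<Otimes>\<^sub>M (borel \<Otimes>\<^sub>M (borel \<Otimes>\<^sub>M (borel \<Otimes>\<^sub>M borel)))) (\<lambda>\<omega>. (E' j \<omega>, Y j \<omega>))"
    by (rule distr_cong) (auto intro!: sets_pair_measure_cong sets_\<nu>)
  also have "\<dots> = exp_law \<Otimes>\<^sub>M \<nu>"
    using distr_pair_indep_restrict[OF indep_X0, of "{(1, j)}" "{(2, j), (4, j), (3, j), (0, j)}" "\<lambda>h. fst (h (1, j))" borel
      "\<lambda>h. (fst (h (2, j)), snd (h (4, j)), fst (h (3, j)), fst (h (0, j)))" "borel \<Otimes>\<^sub>M (borel \<Otimes>\<^sub>M (borel \<Otimes>\<^sub>M borel))"]
    by (simp add: X0_def distr_E' law_Y[unfolded Y_def[abs_def]] Y_def[abs_def])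
  finally show ?thesis .
qed

text \<open>The family is grouped by the index \<open>j\<close>: the blocks
  \<open>{0..<5} \<times> {j}\<close> are disjoint, hence independent, and \<open>f j\<close> reads
  the pair off its block.\<close>

lemma indep_marked_Y: "indep_vars (\<lambda>_. borel \<Otimes>\<^sub>M \<nu>) (\<lambda>j \<omega>. (E' j \<omega>, Y j \<omega>)) UNIV"
proof -
  define K :: "nat \<Rightarrow> (nat \<times> nat) set" where "K j = {0..<5} \<times> {j}" for j
  have r: "indep_vars (\<lambda>j. PiM (K j) (\<lambda>_. borel \<Otimes>\<^sub>M borel)) (\<lambda>j \<omega>. restrict (\<lambda>i. X0 i \<omega>) (K j)) UNIV"
    by (rule indep_vars_restrict[OF indep_X0]) (auto simp: K_def disjoint_family_on_def)
  define f :: "nat \<Rightarrow> (nat \<times> nat \<Rightarrow> real \<times> 'a) \<Rightarrow> real \<times> real \<times> 'a \<times> real \<times> real"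
    where "f j h = (fst (h (1, j)), fst (h (2, j)), snd (h (4, j)), fst (h (3, j)), fst (h (0, j)))" for j h
  have sb: "sets (borel \<Otimes>\<^sub>M \<nu>) = sets (borel \<Otimes>\<^sub>M (borel \<Otimes>\<^sub>M (borel \<Otimes>\<^sub>M (borel \<Otimes>\<^sub>M borel))))"
    by (intro sets_pair_measure_cong sets_\<nu>) auto
  have fm: "f j \<in> measurable (PiM (K j) (\<lambda>_. borel \<Otimes>\<^sub>M borel)) (borel \<Otimes>\<^sub>M \<nu>)" for j
  proof -
    have c: "(\<lambda>h. h (k, j)) \<in> measurable (PiM (K j) (\<lambda>_. borel \<Otimes>\<^sub>M borel)) (borel \<Otimes>\<^sub>M (borel :: 'a measure))" if "k < 5" for k
      by (rule measurable_component_singleton) (use that in \<open>auto simp: K_def\<close>)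
    show ?thesis unfolding f_def measurable_cong_sets[OF refl sb]
      by (intro measurable_Pair measurable_compose[OF c measurable_fst] measurable_compose[OF c measurable_snd]) auto
  qed
  have "indep_vars (\<lambda>_. borel \<Otimes>\<^sub>M \<nu>) (\<lambda>j \<omega>. f j (restrict (\<lambda>i. X0 i \<omega>) (K j))) UNIV"
    by (rule indep_vars_compose2[OF r]) (rule fm)
  moreover have "f j (restrict (\<lambda>i. X0 i \<omega>) (K j)) = (E' j \<omega>, Y j \<omega>)" for j \<omega>
    by (simp add: f_def K_def X0_def Y_def)
  ultimately show ?thesis by simp
qed

sublocale marked_arrivals P E' Y \<nu>
  by (intro marked_arrivals.intro marked_arrivals_axioms.intro prob_space_axioms prob_space_\<nu> indep_marked_Y law_marked_Y)

end

context tempered_series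
begin

definition X :: "nat \<Rightarrow> 'w \<Rightarrow> 'a" where
  "X j \<omega> = J (arrival (Suc j) \<omega>) (snd (Y j \<omega>))"

lemma series_term_eq:
  "series_term p \<alpha> T (measure sg (space sg)) E E' Tj U V j t \<omega> = indicator {0<..t} (Tj j \<omega>) *\<^sub>R X j \<omega>"
  by (simp add: series_term_def X_def jump_def Y_def cT_def ns_def arrival_def lessThan_Suc_atMost)

lemma snd_\<nu>[measurable]: "snd \<in> measurable \<nu> mark_law"
  unfolding \<nu>_def by (rule measurable_snd)

lemma fst_\<nu>[measurable]: "fst \<in> borel_measurable \<nu>"
  using measurable_fst[of "uniform_measure lborel {0<..<T}" mark_law] unfolding \<nu>_def
  by (simp cong: measurable_cong_sets)

lemma X_measurable[measurable]: "X j \<in> borel_measurable P"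
proof -
  have "(\<lambda>\<omega>. (arrival (Suc j) \<omega>, snd (Y j \<omega>))) \<in> measurable P (borel \<Otimes>\<^sub>M mark_law)" by measurable
  from measurable_compose[OF this J_measurable(1)] show ?thesis by (simp add: X_def[abs_def])
qed

abbreviation S :: "nat \<Rightarrow> real \<Rightarrow> 'w \<Rightarrow> 'a" where
  "S n t \<omega> \<equiv> \<Sum>j<n. indicator {0<..t} (Tj j \<omega>) *\<^sub>R X j \<omega>"

text \<open>The bound of \<open>norm_J_le\<close> at arrival \<open>(j + 1) / 2\<close>:
  deterministic, and almost surely valid for all but finitely many jumps.\<close>

definition cb :: "nat \<Rightarrow> real" where "cb j = \<kappa> * (real (Suc j) / 2) powr (- 1 / \<alpha>)"

lemma norm_J_cb:
  assumes "real (Suc j) / 2 < x"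
  shows "norm (J x m) \<le> cb j"
proof -
  have "norm (J x m) \<le> \<kappa> * x powr (- 1 / \<alpha>)" using assms by (intro norm_J_le) auto
  also have "\<dots> \<le> cb j" unfolding cb_def
    using assms alpha by (intro mult_left_mono kappa_nonneg powr_mono2') auto
  finally show ?thesis .
qed

lemma cb_nonneg: "0 \<le> cb j" using kappa_nonneg by (simp add: cb_def)

lemma summable_powr_Suc:
  assumes "1 < b"
  shows "summable (\<lambda>j. (real (Suc j) / 2) powr (- b))"
proof -
  have "summable (\<lambda>j. real j powr (- b))" using assms by (simp add: summable_real_powr_iff)
  then have "summable (\<lambda>j. real (Suc j) powr (- b))" by (subst summable_Suc_iff)
  then have "summable (\<lambda>j. real (Suc j) powr (- b) / 2 powr (- b))" by (rule summable_divide)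
  then show ?thesis by (simp add: powr_divide)
qed

lemma summable_cb: "\<alpha> < 1 \<Longrightarrow> summable cb"
  unfolding cb_def[abs_def] using summable_powr_Suc[of "1 / \<alpha>"] alpha by (intro summable_mult) simp

text \<open>The exponent \<open>2 / \<alpha>\<close> is above 1 for all \<alpha> < 2, whereas
  \<open>summable_cb\<close> needs \<alpha> < 1; the gap is bridged by the random signs, for which
  squares suffice.\<close>

lemma summable_cb_square: "summable (\<lambda>j. (cb j)\<^sup>2)"
proof -
  have "(cb j)\<^sup>2 = \<kappa>\<^sup>2 * (real (Suc j) / 2) powr (- (2 / \<alpha>))" for j
    by (simp add: cb_def power_mult_distrib power2_eq_square powr_add[symmetric] del: of_nat_Suc)
  then show ?thesis using summable_powr_Suc[of "2 / \<alpha>"] alpha by (simp add: summable_mult del: of_nat_Suc)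
qed

lemma AE_arrival_Suc: "AE \<omega> in P. eventually (\<lambda>j. real (Suc j) / 2 < arrival (Suc j) \<omega>) sequentially"
  using AE_arrival_linear
proof eventually_elim
  case (elim \<omega>)
  show ?case using eventually_compose_filterlim[OF elim filterlim_Suc] by simp
qed

lemma AE_Tj: "AE \<omega> in P. \<forall>j. 0 < Tj j \<omega> \<and> Tj j \<omega> < T"
proof -
  have "AE \<omega> in P. 0 < Tj j \<omega> \<and> Tj j \<omega> < T" for j
  proof -
    have "AE x in distr P borel (Tj j). 0 < x \<and> x < T"
      unfolding Tj_distr[rule_format] by (rule AE_uniform_greaterThanLessThan)
    then show ?thesis by (subst (asm) AE_distr_iff) auto
  qed
  then show ?thesis by (simp add: AE_all_countable)
qed

lemma AE_Tj_neq: "AE \<omega> in P. \<forall>j. Tj j \<omega> \<noteq> s"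
proof -
  have "AE \<omega> in P. Tj j \<omega> \<noteq> s" for j
  proof -
    have "AE x in uniform_measure lborel {0<..<T}. x \<noteq> s"
      using AE_lborel_singleton[of s] T_pos by (intro AE_uniform_measureI) (auto elim: eventually_mono)
    then have "AE x in distr P borel (Tj j). x \<noteq> s" unfolding Tj_distr[rule_format] .
    then show ?thesis by (subst (asm) AE_distr_iff) auto
  qed
  then show ?thesis by (simp add: AE_all_countable)
qed

section \<open>Changing the signs of individual jumps\<close>

definition reflect :: "real \<times> real \<times> 'a \<times> real \<times> real \<Rightarrow> real \<times> real \<times> 'a \<times> real \<times> real" where
  "reflect = (\<lambda>(g, t, v, z). (g, t, - v, z))"

lemma reflect_measurable[measurable]: "reflect \<in> measurable (borel \<Otimes>\<^sub>M \<nu>) (borel \<Otimes>\<^sub>M \<nu>)"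
proof -
  have sb: "sets (borel \<Otimes>\<^sub>M \<nu>) = sets (borel \<Otimes>\<^sub>M (borel \<Otimes>\<^sub>M (borel \<Otimes>\<^sub>M (borel \<Otimes>\<^sub>M borel))))"
    by (intro sets_pair_measure_cong sets_\<nu>) auto
  show ?thesis unfolding measurable_cong_sets[OF sb sb] reflect_def by measurable
qed

lemma distr_reflect:
  assumes sym: "distr VL borel uminus = VL"
  shows "distr (exp_law \<Otimes>\<^sub>M \<nu>) (borel \<Otimes>\<^sub>M \<nu>) reflect =
     exp_law \<Otimes>\<^sub>M \<nu>"
proof -
  interpret \<nu>: prob_space \<nu> by (rule prob_space_\<nu>)
  interpret m: prob_space mark_law by (rule prob_space_mark_law)
  let ?u = "uniform_measure lborel {0<..<T}" and ?e = exp_law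
  have mm: "(\<lambda>(v, z). (- v, z)) \<in> measurable mark_law mark_law"
    unfolding measurable_cong_sets[OF sets_mark_law sets_mark_law] by measurable
  have "distr ?u ?u (\<lambda>x. x) \<Otimes>\<^sub>M distr mark_law mark_law (\<lambda>(v, z). (- v, z)) =
     distr (?u \<Otimes>\<^sub>M mark_law) (?u \<Otimes>\<^sub>M mark_law) (\<lambda>(t, y). (t, case y of (v, z) \<Rightarrow> (- v, z)))"
    by (rule pair_measure_distr) (use mm in \<open>auto simp: distr_mark_law_uminus[OF sym] m.sigma_finite_measure_axioms\<close>)
  then have 1: "distr \<nu> \<nu> (\<lambda>(t, y). (t, case y of (v, z) \<Rightarrow> (- v, z))) = \<nu>"
    by (simp add: distr_id distr_mark_law_uminus[OF sym] \<nu>_def)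
  have nm: "(\<lambda>(t, y). (t, case y of (v, z) \<Rightarrow> (- v, z))) \<in> measurable \<nu> \<nu>"
    unfolding measurable_cong_sets[OF sets_\<nu> sets_\<nu>] by measurable
  have "distr ?e ?e (\<lambda>x. x) \<Otimes>\<^sub>M distr \<nu> \<nu> (\<lambda>(t, y). (t, case y of (v, z) \<Rightarrow> (- v, z))) =
     distr (?e \<Otimes>\<^sub>M \<nu>) (?e \<Otimes>\<^sub>M \<nu>) (\<lambda>(g, q). (g, case q of (t, y) \<Rightarrow> (t, case y of (v, z) \<Rightarrow> (- v, z))))"
    by (rule pair_measure_distr) (use nm in \<open>auto simp: 1 \<nu>.sigma_finite_measure_axioms\<close>)
  then have "?e \<Otimes>\<^sub>M \<nu> = distr (?e \<Otimes>\<^sub>M \<nu>) (?e \<Otimes>\<^sub>M \<nu>) (\<lambda>(g, q). (g, case q of (t, y) \<Rightarrow> (t, case y of (v, z) \<Rightarrow> (- v, z))))"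
    by (simp add: distr_id 1)
  also have "\<dots> = distr (?e \<Otimes>\<^sub>M \<nu>) (borel \<Otimes>\<^sub>M \<nu>) reflect"
    by (rule distr_cong) (auto simp: reflect_def intro!: sets_pair_measure_cong)
  finally show ?thesis by simp
qed

text \<open>The jumps are dependent through the common arrivals, so the signs are put into the
  independent pairs of gap and mark. Each reflected pair keeps its law, and the law of an
  independent sequence is determined by its marginals; the gaps, and with them the arrivals, are
  untouched.\<close>

lemma joint_law_reflect:
  assumes sym: "distr VL borel uminus = VL"
  shows "distr P (PiM UNIV (\<lambda>_. borel \<Otimes>\<^sub>M \<nu>)) (\<lambda>\<omega> j. if j \<in> s then reflect (E' j \<omega>, Y j \<omega>) else (E' j \<omega>, Y j \<omega>)) =
     distr P (PiM UNIV (\<lambda>_. borel \<Otimes>\<^sub>M \<nu>)) (\<lambda>\<omega> j. (E' j \<omega>, Y j \<omega>))"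
proof -
  define Z where "Z j \<omega> = (E' j \<omega>, Y j \<omega>)" for j \<omega>
  define R where "R j z = (if j \<in> s then reflect z else z)" for j z
  have Rm[measurable]: "R j \<in> measurable (borel \<Otimes>\<^sub>M \<nu>) (borel \<Otimes>\<^sub>M \<nu>)" for j
    unfolding R_def by (cases "j \<in> s") auto
  have iZ: "indep_vars (\<lambda>_. borel \<Otimes>\<^sub>M \<nu>) Z UNIV"
    unfolding Z_def[abs_def] by (rule indep_marked_Y)
  then have Zm[measurable]: "Z j \<in> measurable P (borel \<Otimes>\<^sub>M \<nu>)" for j by (auto simp: indep_vars_def)
  have iR: "indep_vars (\<lambda>_. borel \<Otimes>\<^sub>M \<nu>) (\<lambda>j \<omega>. R j (Z j \<omega>)) UNIV"
    by (rule indep_vars_compose2[OF iZ]) (rule Rm)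
  have lZ: "distr P (borel \<Otimes>\<^sub>M \<nu>) (Z j) = exp_law \<Otimes>\<^sub>M \<nu>" for j
    unfolding Z_def[abs_def] by (rule law_marked_Y)
  have lR: "distr P (borel \<Otimes>\<^sub>M \<nu>) (\<lambda>\<omega>. R j (Z j \<omega>)) = exp_law \<Otimes>\<^sub>M \<nu>" for j
  proof -
    have "distr P (borel \<Otimes>\<^sub>M \<nu>) (\<lambda>\<omega>. R j (Z j \<omega>)) = distr (distr P (borel \<Otimes>\<^sub>M \<nu>) (Z j)) (borel \<Otimes>\<^sub>M \<nu>) (R j)"
      by (simp add: distr_distr comp_def)
    also have "\<dots> = exp_law \<Otimes>\<^sub>M \<nu>"
    proof (cases "j \<in> s")
      case True
      then have "R j = reflect" by (simp add: R_def fun_eq_iff)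
      then show ?thesis unfolding lZ by (simp add: distr_reflect[OF sym])
    next
      case False
      then have "R j = (\<lambda>z. z)" by (simp add: R_def fun_eq_iff)
      then have "distr (distr P (borel \<Otimes>\<^sub>M \<nu>) (Z j)) (borel \<Otimes>\<^sub>M \<nu>) (R j) = distr P (borel \<Otimes>\<^sub>M \<nu>) (Z j)"
        by (simp add: distr_distr comp_def)
      then show ?thesis by (simp only: lZ)
    qed
    finally show ?thesis .
  qed
  have "distr P (PiM UNIV (\<lambda>_. borel \<Otimes>\<^sub>M \<nu>)) (\<lambda>\<omega>. \<lambda>j\<in>UNIV. R j (Z j \<omega>)) = PiM UNIV (\<lambda>j. distr P (borel \<Otimes>\<^sub>M \<nu>) (\<lambda>\<omega>. R j (Z j \<omega>)))"
    using iR by (subst (asm) indep_vars_iff_distr_eq_PiM') auto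
  also have "\<dots> = PiM UNIV (\<lambda>j. distr P (borel \<Otimes>\<^sub>M \<nu>) (Z j))" by (simp add: lR lZ)
  also have "\<dots> = distr P (PiM UNIV (\<lambda>_. borel \<Otimes>\<^sub>M \<nu>)) (\<lambda>\<omega>. \<lambda>j\<in>UNIV. Z j \<omega>)"
    using iZ by (subst (asm) indep_vars_iff_distr_eq_PiM') auto
  finally show ?thesis by (simp add: R_def Z_def restrict_UNIV)
qed

lemma AE_uniformly_convergent:
  assumes cases: "\<alpha> < 1 \<or> distr VL borel uminus = VL"
  shows "AE \<omega> in P. uniformly_convergent_on {0..T} (\<lambda>n t. S n t \<omega>)"
  using cases
proof
  assume a: "\<alpha> < 1"
  show ?thesis
    using AE_arrival_Suc
  proof eventually_elim
    case (elim \<omega>)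
    show ?case
    proof (rule Weierstrass_m_test'_ev[OF _ summable_cb[OF a]])
      show "\<forall>\<^sub>F n in sequentially. \<forall>t\<in>{0..T}. norm (indicator {0<..t} (Tj n \<omega>) *\<^sub>R X n \<omega>) \<le> cb n"
        using elim
      proof eventually_elim
        case (elim n)
        then show ?case using norm_J_cb[OF elim] cb_nonneg[of n] by (auto simp: X_def indicator_def)
      qed
    qed
  qed
next
  assume sym: "distr VL borel uminus = VL"
  \<comment> \<open>A jump with an early arrival is not bounded by \<open>cb j\<close> and is set to
    0; by \<open>AE_arrival_Suc\<close> this almost surely concerns finitely many indices.\<close>
  define X' where "X' j \<omega> = (if real (Suc j) / 2 < arrival (Suc j) \<omega> then X j \<omega> else 0)" for j \<omega>
  have X'm[measurable]: "X' j \<in> borel_measurable P" for j unfolding X'_def by measurable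
  \<comment> \<open>The map from sequences of gap and mark to sequences of jump and time. Applied to
    the reflected pairs it yields the signed jumps, because the cut-off depends on the gaps
    only.\<close>
  define \<Psi> where "\<Psi> z j = (if real (Suc j) / 2 < (\<Sum>i<Suc j. fst (z i)) then J (\<Sum>i<Suc j. fst (z i)) (snd (snd (z j))) else 0,
      fst (snd (z j)))" for z :: "nat \<Rightarrow> real \<times> real \<times> 'a \<times> real \<times> real" and j
  have \<Psi>m: "\<Psi> \<in> measurable (PiM UNIV (\<lambda>_. borel \<Otimes>\<^sub>M \<nu>)) (PiM UNIV (\<lambda>_. borel \<Otimes>\<^sub>M borel))"
  proof (rule measurable_PiM_single')
    fix j :: nat
    have c: "(\<lambda>z. z i) \<in> measurable (PiM UNIV (\<lambda>_. borel \<Otimes>\<^sub>M \<nu>)) (borel \<Otimes>\<^sub>M \<nu>)" for i :: nat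
      by (rule measurable_component_singleton) simp
    have c1: "(\<lambda>z. fst (z i)) \<in> borel_measurable (PiM UNIV (\<lambda>_. borel \<Otimes>\<^sub>M \<nu>))" for i :: nat
      using measurable_compose[OF c measurable_fst] .
    have c2: "(\<lambda>z. snd (z i)) \<in> measurable (PiM UNIV (\<lambda>_. borel \<Otimes>\<^sub>M \<nu>)) \<nu>" for i :: nat
      using measurable_compose[OF c measurable_snd] .
    have s: "(\<lambda>z. (\<Sum>i<Suc j. fst (z i)) :: real) \<in> borel_measurable (PiM UNIV (\<lambda>_. borel \<Otimes>\<^sub>M \<nu>))"
      by (intro borel_measurable_sum c1)
    have "(\<lambda>z. ((\<Sum>i<Suc j. fst (z i)) :: real, snd (snd (z j)))) \<in> measurable (PiM UNIV (\<lambda>_. borel \<Otimes>\<^sub>M \<nu>)) (borel \<Otimes>\<^sub>M mark_law)"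
      by (intro measurable_Pair s measurable_compose[OF c2 snd_\<nu>])
    from measurable_compose[OF this J_measurable(1)]
    have Jm: "(\<lambda>z. J (\<Sum>i<Suc j. fst (z i)) (snd (snd (z j)))) \<in> borel_measurable (PiM UNIV (\<lambda>_. borel \<Otimes>\<^sub>M \<nu>))" by simp
    show "(\<lambda>z. \<Psi> z j) \<in> measurable (PiM UNIV (\<lambda>_. borel \<Otimes>\<^sub>M \<nu>)) (borel \<Otimes>\<^sub>M borel)"
      unfolding \<Psi>_def
      by (intro measurable_Pair measurable_If Jm measurable_compose[OF c2 fst_\<nu>] measurable_const
          predE[OF borel_measurable_pred_less[OF measurable_const s]]) simp_all
  qed (auto simp: space_pair_measure)
  have "AE \<omega> in P. uniformly_convergent_on UNIV (\<lambda>n t. \<Sum>j<n. if Tj j \<omega> \<le> t then X' j \<omega> else 0)"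
  proof (rule AE_uniformly_convergent_symmetric[OF _ _ _ summable_cb_square])
    show "norm (X' j \<omega>) \<le> cb j" for j \<omega>
      using norm_J_cb cb_nonneg by (auto simp: X'_def X_def)
    fix s :: "nat set"
    have e1: "\<Psi> (\<lambda>j. if j \<in> s then reflect (E' j \<omega>, Y j \<omega>) else (E' j \<omega>, Y j \<omega>)) = (\<lambda>j. (set_sign s j *\<^sub>R X' j \<omega>, Tj j \<omega>))" for \<omega>
    proof
      fix j
      have f: "fst (if i \<in> s then reflect (E' i \<omega>, Y i \<omega>) else (E' i \<omega>, Y i \<omega>)) = E' i \<omega>" for i
        by (simp add: reflect_def split_beta)
      show "\<Psi> (\<lambda>j. if j \<in> s then reflect (E' j \<omega>, Y j \<omega>) else (E' j \<omega>, Y j \<omega>)) j = (set_sign s j *\<^sub>R X' j \<omega>, Tj j \<omega>)"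
        unfolding \<Psi>_def f arrival_def[symmetric]
        by (auto simp: set_sign_def X'_def X_def reflect_def Y_def jump_uminus)
    qed
    have e2: "\<Psi> (\<lambda>j. (E' j \<omega>, Y j \<omega>)) = (\<lambda>j. (X' j \<omega>, Tj j \<omega>))" for \<omega>
      by (rule ext) (simp add: \<Psi>_def arrival_def[symmetric] X'_def X_def Y_def)
    have Z[measurable]: "(\<lambda>\<omega>. (E' j \<omega>, Y j \<omega>)) \<in> measurable P (borel \<Otimes>\<^sub>M \<nu>)" for j by measurable
    have mz: "(\<lambda>\<omega> j. (E' j \<omega>, Y j \<omega>)) \<in> measurable P (PiM UNIV (\<lambda>_. borel \<Otimes>\<^sub>M \<nu>))"
      by (rule measurable_PiM_single') (auto dest: measurable_space[OF Z])
    have Z': "(\<lambda>\<omega>. if j \<in> s then reflect (E' j \<omega>, Y j \<omega>) else (E' j \<omega>, Y j \<omega>)) \<in> measurable P (borel \<Otimes>\<^sub>M \<nu>)" for j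
      by (cases "j \<in> s") auto
    have mr: "(\<lambda>\<omega> j. if j \<in> s then reflect (E' j \<omega>, Y j \<omega>) else (E' j \<omega>, Y j \<omega>)) \<in> measurable P (PiM UNIV (\<lambda>_. borel \<Otimes>\<^sub>M \<nu>))"
      by (rule measurable_PiM_single') (use Z' measurable_space[OF Z'] in \<open>auto simp del: if_split\<close>)
    have "distr P (PiM UNIV (\<lambda>_. borel \<Otimes>\<^sub>M borel)) (\<lambda>\<omega> j. (set_sign s j *\<^sub>R X' j \<omega>, Tj j \<omega>)) =
      distr (distr P (PiM UNIV (\<lambda>_. borel \<Otimes>\<^sub>M \<nu>)) (\<lambda>\<omega> j. if j \<in> s then reflect (E' j \<omega>, Y j \<omega>) else (E' j \<omega>, Y j \<omega>))) (PiM UNIV (\<lambda>_. borel \<Otimes>\<^sub>M borel)) \<Psi>"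
      by (subst distr_distr[OF \<Psi>m mr]) (simp add: comp_def e1)
    also have "\<dots> = distr P (PiM UNIV (\<lambda>_. borel \<Otimes>\<^sub>M borel)) (\<lambda>\<omega> j. (X' j \<omega>, Tj j \<omega>))"
      unfolding joint_law_reflect[OF sym] by (subst distr_distr[OF \<Psi>m mz]) (simp add: comp_def e2)
    finally show "distr P (PiM UNIV (\<lambda>_. borel \<Otimes>\<^sub>M borel)) (\<lambda>\<omega> j. (set_sign s j *\<^sub>R X' j \<omega>, Tj j \<omega>)) = \<dots>" .
  qed auto
  then show ?thesis
    using AE_arrival_Suc AE_Tj
  proof eventually_elim
    case (elim \<omega>)
    \<comment> \<open>Return to the original series: the times are positive, so
      \<open>Tj j \<omega> \<le> t\<close> and membership in \<open>{0<..t}\<close> agree, and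
      \<open>X'\<close> differs from \<open>X\<close> at finitely many indices.\<close>
    have "uniformly_convergent_on {0..T} (\<lambda>n t. \<Sum>j<n. if Tj j \<omega> \<le> t then X' j \<omega> else 0)"
      using elim(1) by (auto simp: uniformly_convergent_on_def intro: uniform_limit_on_subset)
    then show ?case
    proof (rule uniformly_convergent_on_sum_eventually_eq)
      show "\<forall>\<^sub>F j in sequentially. \<forall>t\<in>{0..T}. (if Tj j \<omega> \<le> t then X' j \<omega> else 0) = indicator {0<..t} (Tj j \<omega>) *\<^sub>R X j \<omega>"
        using elim(2) by eventually_elim (use elim(3) in \<open>auto simp: X'_def indicator_def\<close>)
    qed
  qed
qed

end

section \<open>The limit process\<close>

lemma sum_eq_single:
  fixes f :: "'i \<Rightarrow> 'b::comm_monoid_add"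
  assumes "finite A" "k \<in> A" "\<And>i. i \<in> A \<Longrightarrow> i \<noteq> k \<Longrightarrow> f i = 0"
  shows "sum f A = f k"
  using assms by (subst sum.remove[of A k]) (auto intro: sum.neutral)

lemma step_mono:
  fixes ts :: "nat \<Rightarrow> real"
  assumes "\<And>k. k < n \<Longrightarrow> ts k \<le> ts (Suc k)" "i \<le> j" "j \<le> n"
  shows "ts i \<le> ts j"
  using assms(2,3)
proof (induction j rule: dec_induct)
  case (step m)
  then show ?case using assms(1)[of m] by simp
qed simp

context tempered_series
begin

text \<open>Defined for every outcome, so that measurability comes without exceptional sets; for
  times in \<open>{0..T}\<close> it is almost surely the sum of the series, simultaneously in all
  these times.\<close>

definition L :: "real \<Rightarrow> 'w \<Rightarrow> 'a" where
  "L t \<omega> = lim (\<lambda>n. S n t \<omega>)"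

lemma L_measurable[measurable]: "L t \<in> borel_measurable P"
  unfolding L_def by measurable

lemma L_0: "L 0 \<omega> = 0"
  by (simp add: L_def lim_const)

lemma integral_\<nu>_prod:
  fixes f :: "real \<Rightarrow> complex" and g :: "'a \<times> real \<times> real \<Rightarrow> complex"
  assumes f[measurable]: "f \<in> borel_measurable borel" and g[measurable]: "g \<in> borel_measurable mark_law"
    and fb: "\<And>t. norm (f t) \<le> 1" and gb: "\<And>m. norm (g m) \<le> C"
  shows "(LINT y|\<nu>. f (fst y) * g (snd y)) = (LINT t|uniform_measure lborel {0<..<T}. f t) * (LINT m|mark_law. g m)"
    and "integrable \<nu> (\<lambda>y. f (fst y) * g (snd y))"
proof -
  interpret u: prob_space "uniform_measure lborel {0<..<T}" using T_pos by (rule prob_space_unif)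
  interpret m: prob_space mark_law by (rule prob_space_mark_law)
  interpret pair_prob_space "uniform_measure lborel {0<..<T}" mark_law ..
  have i: "integrable (uniform_measure lborel {0<..<T} \<Otimes>\<^sub>M mark_law) (\<lambda>y. f (fst y) * g (snd y))"
  proof (rule integrable_const_bound[of _ C])
    show "AE y in uniform_measure lborel {0<..<T} \<Otimes>\<^sub>M mark_law. norm (f (fst y) * g (snd y)) \<le> C"
    proof (rule AE_I2)
      fix y
      have "norm (f (fst y) * g (snd y)) \<le> 1 * C"
        unfolding norm_mult by (intro mult_mono fb gb) auto
      then show "norm (f (fst y) * g (snd y)) \<le> C" by simp
    qed
    have "f \<in> borel_measurable (uniform_measure lborel {0<..<T})" by measurable
    from measurable_compose[OF measurable_fst this] measurable_compose[OF measurable_snd g]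
    show "(\<lambda>y. f (fst y) * g (snd y)) \<in> borel_measurable (uniform_measure lborel {0<..<T} \<Otimes>\<^sub>M mark_law)"
      by (rule borel_measurable_times)
  qed
  then show "integrable \<nu> (\<lambda>y. f (fst y) * g (snd y))" by (simp add: \<nu>_def)
  show "(LINT y|\<nu>. f (fst y) * g (snd y)) = (LINT t|uniform_measure lborel {0<..<T}. f t) * (LINT m|mark_law. g m)"
    unfolding \<nu>_def using integral_fst'[OF i] by simp
qed

lemma integral_uniform_indicator:
  assumes "0 \<le> a" "a \<le> b" "b \<le> T"
  shows "(LINT t|uniform_measure lborel {0<..<T}. (indicator {a<..b} t :: complex)) = complex_of_real ((b - a) / T)"
proof -
  have "emeasure (uniform_measure lborel {0<..<T}) {a<..b} = emeasure lborel ({0<..<T} \<inter> {a<..b}) / emeasure lborel {0<..<T}"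
    by (rule emeasure_uniform_measure) auto
  also have "emeasure lborel ({0<..<T} \<inter> {a<..b}) = emeasure lborel {a<..b}"
  proof (rule emeasure_eq_AE)
    show "AE x in lborel. (x \<in> {0<..<T} \<inter> {a<..b}) = (x \<in> {a<..b})"
      using AE_lborel_singleton[of T] by eventually_elim (use assms in auto)
  qed auto
  also have "emeasure lborel {a<..b} / emeasure lborel {0<..<T} = ennreal ((b - a) / T)"
    using assms T_pos by (simp add: divide_ennreal)
  finally have "measure (uniform_measure lborel {0<..<T}) {a<..b} = (b - a) / T"
    using assms T_pos by (simp add: measure_def)
  then show ?thesis by (simp only: integral_indicator_complex) simp
qed

section \<open>Characteristic functions and path properties of the limit\<close>

context
  assumes symm: "\<alpha> < 1 \<or> distr VL borel uminus = VL"
begin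

lemma AE_uniform_limit_L:
  "AE \<omega> in P. uniform_limit {0..T} (\<lambda>n t. S n t \<omega>) (\<lambda>t. L t \<omega>) sequentially"
  using AE_uniformly_convergent[OF symm]
proof eventually_elim
  case (elim \<omega>)
  then obtain l where l: "uniform_limit {0..T} (\<lambda>n t. S n t \<omega>) l sequentially"
    by (auto simp: uniformly_convergent_on_def)
  have "l t = L t \<omega>" if "t \<in> {0..T}" for t
    unfolding L_def by (rule limI[symmetric]) (rule tendsto_uniform_limitI[OF l that])
  then show ?case
    using l by (subst uniform_limit_cong'[where g="\<lambda>n t. S n t \<omega>" and i=l]) auto
qed

text \<open>For \<alpha> < 1 the drift decays fast enough, under symmetry it is 0. After the
  convergence of the series this is the second use of the case distinction.\<close>

lemma drift_integrable: "integrable halfline drift"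
  using symm
proof
  assume "distr VL borel uminus = VL"
  then have "drift = (\<lambda>_. 0)" using drift_eq_0 by (intro ext)
  then show ?thesis by simp
qed (rule integrable_drift)

definition b :: 'a where "b = (1 / T) *\<^sub>R (LINT x|halfline. drift x)"

abbreviation \<psi> :: "'a \<Rightarrow> complex" where "\<psi> \<equiv> lk_exponent (tempered_levy_measure sg Qk p \<alpha>) b"

text \<open>All increments are read off from one inner product: each jump is paired with the step
  function \<open>g\<close> of its time, whose value on the interval \<open>I k\<close> is
  \<open>z k\<close>. The times are uniform on \<open>{0<..<T}\<close>, so \<open>H - 1\<close> is
  the sum of the corresponding functions for the \<open>z k\<close>, weighted by the relative
  lengths of the intervals, and the product formula applies.\<close>

lemma expectation_increments:
  fixes ts :: "nat \<Rightarrow> real" and z :: "nat \<Rightarrow> 'a"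
  assumes mono: "\<And>k. k < n \<Longrightarrow> ts k \<le> ts (Suc k)" and ts0: "0 \<le> ts 0" and tsn: "ts n \<le> T"
  shows "(CLINT \<omega>|P. iexp (\<Sum>k<n. z k \<bullet> (L (ts (Suc k)) \<omega> - L (ts k) \<omega>))) =
     (\<Prod>k<n. exp (complex_of_real (ts (Suc k) - ts k) * \<psi> (z k)))"
proof -
  interpret \<nu>: prob_space \<nu> by (rule prob_space_\<nu>)
  interpret m: prob_space mark_law by (rule prob_space_mark_law)
  note tsm = step_mono[of n ts, OF mono]
  have tsb: "0 \<le> ts k" "ts k \<le> T" if "k \<le> n" for k
    using tsm[of 0 k] tsm[of k n] that ts0 tsn by auto
  define I where "I k = {ts k<..ts (Suc k)}" for k
  have disj: "i = k" if "t \<in> I i" "t \<in> I k" "i < n" "k < n" for i k t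
  proof (rule ccontr)
    assume "i \<noteq> k"
    then consider "Suc i \<le> k" | "Suc k \<le> i" by linarith
    then show False
    proof cases
      case 1
      then have "ts (Suc i) \<le> ts k" using tsm[of "Suc i" k] that by auto
      then show False using that by (auto simp: I_def)
    next
      case 2
      then have "ts (Suc k) \<le> ts i" using tsm[of "Suc k" i] that by auto
      then show False using that by (auto simp: I_def)
    qed
  qed
  define g where "g t = (\<Sum>k<n. indicator (I k) t *\<^sub>R z k)" for t
  have gm[measurable]: "g \<in> borel_measurable borel" unfolding g_def I_def by measurable
  \<comment> \<open>At most one of the disjoint intervals contains \<open>t\<close>, and off all of
    them both sides vanish. This linearity of \<open>iexp - 1\<close> in the indicators makes the
    exponent additive over the intervals.\<close>
  have ident: "iexp (g t \<bullet> x) - 1 = (\<Sum>k<n. indicator (I k) t * (iexp (z k \<bullet> x) - 1))" for t x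
  proof (cases "\<exists>k<n. t \<in> I k")
    case True
    then obtain k where k: "k < n" "t \<in> I k" by auto
    have "g t = indicator (I k) t *\<^sub>R z k" unfolding g_def
      using k disj by (intro sum_eq_single) (auto simp: indicator_def)
    moreover have "(\<Sum>k<n. indicator (I k) t * (iexp (z k \<bullet> x) - 1)) = indicator (I k) t * (iexp (z k \<bullet> x) - 1)"
      using k disj by (intro sum_eq_single) (auto simp: indicator_def)
    ultimately show ?thesis using k by simp
  next
    case False
    then have "g t = 0" "(\<Sum>k<n. indicator (I k) t * (iexp (z k \<bullet> x) - 1)) = 0"
      by (auto simp: g_def indicator_def intro!: sum.neutral)
    then show ?thesis by simp
  qed
  define h where "h x y = iexp (g (fst y) \<bullet> J x (snd y))" for x and y :: "real \<times> 'a \<times> real \<times> real"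
  have hm: "(\<lambda>(x, y). h x y) \<in> borel_measurable (borel \<Otimes>\<^sub>M \<nu>)"
  proof -
    have 1: "(\<lambda>q. (fst q, snd (snd q))) \<in> measurable (borel \<Otimes>\<^sub>M \<nu>) (borel \<Otimes>\<^sub>M mark_law)"
      by (intro measurable_Pair measurable_fst measurable_compose[OF measurable_snd snd_\<nu>])
    have 2: "(\<lambda>q. J (fst q) (snd (snd q))) \<in> borel_measurable (borel \<Otimes>\<^sub>M \<nu>)"
      using measurable_compose[OF 1 J_measurable(1)] by simp
    have 3: "(\<lambda>q. g (fst (snd q))) \<in> borel_measurable (borel \<Otimes>\<^sub>M \<nu>)"
      by (rule measurable_compose[OF measurable_compose[OF measurable_snd fst_\<nu>] gm])
    have e: "(\<lambda>r. iexp r) \<in> borel_measurable borel" by measurable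
    have "(\<lambda>q. g (fst (snd q)) \<bullet> J (fst q) (snd (snd q))) \<in> borel_measurable (borel \<Otimes>\<^sub>M \<nu>)"
      by (rule borel_measurable_inner[OF 3 2])
    from measurable_compose[OF this e] show ?thesis unfolding h_def split_beta by simp
  qed
  have hb: "norm (h x y) \<le> 1" for x y unfolding h_def by (simp add: norm_exp_i_times)
  define Hz where "Hz w x = (LINT m|mark_law. iexp (w \<bullet> J x m))" for w x
  have Hzm[measurable]: "Hz w \<in> borel_measurable borel" for w
  proof -
    have e: "(\<lambda>x. iexp (w \<bullet> x)) \<in> borel_measurable borel" by measurable
    from measurable_compose[OF J_measurable(1) e] show ?thesis
      unfolding Hz_def by (intro m.borel_measurable_lebesgue_integral) (simp add: split_beta)
  qed
  \<comment> \<open>The probability that a time mark falls into the interval; its denominator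
    cancels the factor \<open>T\<close> in \<open>jump_exponent\<close>.\<close>
  define \<Delta> where "\<Delta> k = (ts (Suc k) - ts k) / T" for k
  define H where "H x = (LINT y|\<nu>. h x y)" for x
  have Heq: "H x - 1 = (\<Sum>k<n. complex_of_real (\<Delta> k) * (Hz (z k) x - 1))" for x
  proof -
    have im: "integrable mark_law (\<lambda>m. iexp (w \<bullet> J x m))" for w
    proof -
      have e: "(\<lambda>x. iexp (w \<bullet> x)) \<in> borel_measurable borel" by measurable
      show ?thesis
        by (rule m.integrable_const_bound[of _ 1]) (auto simp: norm_exp_i_times intro: measurable_compose[OF J_measurable(2) e])
    qed
    have gk: "(\<lambda>m. iexp (w \<bullet> J x m) - 1) \<in> borel_measurable mark_law" for w
      using im[of w] by (intro borel_measurable_diff) (auto dest: borel_measurable_integrable)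
    have gkb: "norm (iexp (w \<bullet> J x m) - 1) \<le> 2" for w m
      using norm_triangle_ineq4[of "iexp (w \<bullet> J x m)" 1] by (simp add: norm_exp_i_times)
    have Im: "(\<lambda>t. indicator (I k) t :: complex) \<in> borel_measurable borel" for k
      unfolding I_def by measurable
    note P = integral_\<nu>_prod[OF Im gk _ gkb]
    have hx: "h x \<in> borel_measurable \<nu>"
      using measurable_compose[OF measurable_Pair1'[of x borel \<nu>] hm] by simp
    have ih: "integrable \<nu> (h x)"
      by (rule \<nu>.integrable_const_bound[of _ 1]) (use hb hx in auto)
    have "H x - 1 = (LINT y|\<nu>. h x y - 1)"
      using ih by (simp add: H_def \<nu>.prob_space)
    also have "\<dots> = (LINT y|\<nu>. (\<Sum>k<n. indicator (I k) (fst y) * (iexp (z k \<bullet> J x (snd y)) - 1)))"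
      unfolding h_def ident ..
    also have "\<dots> = (\<Sum>k<n. LINT y|\<nu>. indicator (I k) (fst y) * (iexp (z k \<bullet> J x (snd y)) - 1))"
      by (intro Bochner_Integration.integral_sum P(2)) (auto simp: indicator_def)
    also have "\<dots> = (\<Sum>k<n. complex_of_real (\<Delta> k) * (Hz (z k) x - 1))"
    proof (intro sum.cong refl)
      fix k assume k: "k \<in> {..<n}"
      have "(LINT y|\<nu>. indicator (I k) (fst y) * (iexp (z k \<bullet> J x (snd y)) - 1)) =
        (LINT t|uniform_measure lborel {0<..<T}. indicator (I k) t) * (LINT m|mark_law. iexp (z k \<bullet> J x m) - 1)"
        by (rule P(1)) (auto simp: indicator_def)
      also have "(LINT t|uniform_measure lborel {0<..<T}. indicator (I k) t) = complex_of_real (\<Delta> k)"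
        unfolding I_def \<Delta>_def using k tsb[of k] tsb[of "Suc k"] mono[of k] by (intro integral_uniform_indicator) auto
      also have "(LINT m|mark_law. iexp (z k \<bullet> J x m) - 1) = Hz (z k) x - 1"
        using im[of "z k"] m.prob_space by (simp add: Hz_def)
      finally show "(LINT y|\<nu>. indicator (I k) (fst y) * (iexp (z k \<bullet> J x (snd y)) - 1)) = complex_of_real (\<Delta> k) * (Hz (z k) x - 1)" .
    qed
    finally show ?thesis .
  qed
  have Hf: "H = (\<lambda>x. 1 + (\<Sum>k<n. complex_of_real (\<Delta> k) * (Hz (z k) x - 1)))"
  proof
    fix x show "H x = 1 + (\<Sum>k<n. complex_of_real (\<Delta> k) * (Hz (z k) x - 1))" using Heq[of x] by (simp add: algebra_simps)
  qed
  have Hm: "H \<in> borel_measurable borel" unfolding Hf by measurable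
  note ex = jump_exponent[OF drift_integrable, folded b_def Hz_def]
  have Hcont: "continuous_on {0<..} H"
    unfolding Hf Hz_def
    by (intro continuous_intros continuous_on_integral_J) (auto simp: norm_exp_i_times)
  have i1: "integrable halfline (\<lambda>x. complex_of_real (\<Delta> k) * (Hz (z k) x - 1))" for k
    by (intro integrable_mult_right ex(1))
  have Hint: "integrable halfline (\<lambda>x. H x - 1)"
    unfolding Heq by (intro Bochner_Integration.integrable_sum i1)
  have Hval: "(LINT x:{0<..}|lborel. H x - 1) = (\<Sum>k<n. complex_of_real (ts (Suc k) - ts k) * \<psi> (z k))"
  proof -
    have "(LINT x:{0<..}|lborel. H x - 1) = (LINT x|halfline. H x - 1)"
      using Hm by (intro integrable_halfline_iff(2)[symmetric] borel_measurable_diff borel_measurable_const)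
    also have "\<dots> = (\<Sum>k<n. LINT x|halfline. complex_of_real (\<Delta> k) * (Hz (z k) x - 1))"
      unfolding Heq by (intro Bochner_Integration.integral_sum i1)
    also have "\<dots> = (\<Sum>k<n. complex_of_real (ts (Suc k) - ts k) * \<psi> (z k))"
      using T_pos by (simp add: ex(2) \<Delta>_def)
    finally show ?thesis .
  qed
  have lim1: "(\<lambda>N. LINT \<omega>|P. (\<Prod>j<N. h (arrival (Suc j) \<omega>) (Y j \<omega>))) \<longlonglongrightarrow> exp (LINT x:{0<..}|lborel. H x - 1)"
    unfolding H_def
  proof (rule expectation_prod_arrivals_tendsto[OF hm hb])
    show "continuous_on {0<..} (\<lambda>x. LINT y|\<nu>. h x y)" using Hcont unfolding H_def .
    have "set_integrable lborel {0<..} (\<lambda>x. H x - 1)"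
      using Hint Hm by (subst integrable_halfline_iff(1)[symmetric]) auto
    then show "set_integrable lborel {0<..} (\<lambda>x. (LINT y|\<nu>. h x y) - 1)" unfolding H_def .
  qed
  have prod_eq: "(\<Prod>j<N. h (arrival (Suc j) \<omega>) (Y j \<omega>)) =
     iexp (\<Sum>k<n. z k \<bullet> (S N (ts (Suc k)) \<omega> - S N (ts k) \<omega>))" for N \<omega>
  proof -
    have ind: "indicator {0<..ts (Suc k)} t - indicator {0<..ts k} t = (indicator (I k) t :: real)" if "k < n" for k t
      using tsb[of k] mono[OF that] that by (auto simp: I_def indicator_def)
    have "(\<Sum>k<n. z k \<bullet> (S N (ts (Suc k)) \<omega> - S N (ts k) \<omega>)) =
       (\<Sum>k<n. \<Sum>j<N. indicator (I k) (Tj j \<omega>) * (z k \<bullet> X j \<omega>))"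
    proof (intro sum.cong refl)
      fix k assume "k \<in> {..<n}"
      then have k: "k < n" by simp
      show "z k \<bullet> (S N (ts (Suc k)) \<omega> - S N (ts k) \<omega>) =
        (\<Sum>j<N. indicator (I k) (Tj j \<omega>) * (z k \<bullet> X j \<omega>))"
        by (simp only: sum_subtractf[symmetric] scaleR_diff_left[symmetric] ind[OF k] inner_sum_right inner_scaleR_right)
    qed
    also have "\<dots> = (\<Sum>j<N. g (Tj j \<omega>) \<bullet> X j \<omega>)"
      by (subst sum.swap) (simp add: g_def inner_sum_left)
    finally have "iexp (\<Sum>k<n. z k \<bullet> (S N (ts (Suc k)) \<omega> - S N (ts k) \<omega>)) =
      iexp (\<Sum>j<N. g (Tj j \<omega>) \<bullet> X j \<omega>)" by simp
    also have "\<dots> = (\<Prod>j<N. iexp (g (Tj j \<omega>) \<bullet> X j \<omega>))"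
      by (simp add: exp_sum sum_distrib_left)
    also have "\<dots> = (\<Prod>j<N. h (arrival (Suc j) \<omega>) (Y j \<omega>))"
      by (simp add: h_def X_def Y_def)
    finally show ?thesis by simp
  qed
  \<comment> \<open>The same expectations, now computed from the almost sure convergence of the
    partial sums; the integrands have modulus 1, so dominated convergence applies.\<close>
  have lim2: "(\<lambda>N. LINT \<omega>|P. (\<Prod>j<N. h (arrival (Suc j) \<omega>) (Y j \<omega>))) \<longlonglongrightarrow>
      (CLINT \<omega>|P. iexp (\<Sum>k<n. z k \<bullet> (L (ts (Suc k)) \<omega> - L (ts k) \<omega>)))"
    unfolding prod_eq
  proof (rule integral_dominated_convergence[where w="\<lambda>_. 1"])
    show "AE \<omega> in P. (\<lambda>N. iexp (\<Sum>k<n. z k \<bullet> (S N (ts (Suc k)) \<omega> - S N (ts k) \<omega>)))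
       \<longlonglongrightarrow> iexp (\<Sum>k<n. z k \<bullet> (L (ts (Suc k)) \<omega> - L (ts k) \<omega>))"
      using AE_uniform_limit_L
    proof eventually_elim
      case (elim \<omega>)
      have l: "(\<lambda>N. S N (ts k) \<omega>) \<longlonglongrightarrow> L (ts k) \<omega>" if "k \<le> n" for k
        by (rule tendsto_uniform_limitI[OF elim]) (use tsb[OF that] in auto)
      show ?case by (intro tendsto_intros l) auto
    qed
    show "(\<lambda>\<omega>. iexp (\<Sum>k<n. z k \<bullet> (L (ts (Suc k)) \<omega> - L (ts k) \<omega>))) \<in> borel_measurable P" by measurable
    show "(\<lambda>\<omega>. iexp (\<Sum>k<n. z k \<bullet> (S N (ts (Suc k)) \<omega> - S N (ts k) \<omega>))) \<in> borel_measurable P" for N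
      by measurable
  qed (auto simp: norm_exp_i_times)
  have "(CLINT \<omega>|P. iexp (\<Sum>k<n. z k \<bullet> (L (ts (Suc k)) \<omega> - L (ts k) \<omega>))) = exp (LINT x:{0<..}|lborel. H x - 1)"
    by (rule LIMSEQ_unique[OF lim2 lim1])
  also have "\<dots> = (\<Prod>k<n. exp (complex_of_real (ts (Suc k) - ts k) * \<psi> (z k)))"
    unfolding Hval by (simp add: exp_sum)
  finally show ?thesis .
qed

lemma char_fun_increment:
  assumes "0 \<le> s" "s \<le> t" "t \<le> T"
  shows "char_fun (distr P borel (\<lambda>\<omega>. L t \<omega> - L s \<omega>)) z = exp (complex_of_real (t - s) * \<psi> z)"
proof -
  have "char_fun (distr P borel (\<lambda>\<omega>. L t \<omega> - L s \<omega>)) z = (CLINT \<omega>|P. iexp (z \<bullet> (L t \<omega> - L s \<omega>)))"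
    unfolding char_fun_def by (subst integral_distr) auto
  also have "\<dots> = exp (complex_of_real (t - s) * \<psi> z)"
    using expectation_increments[of 1 "\<lambda>k. if k = 0 then s else t" "\<lambda>_. z"] assms by simp
  finally show ?thesis .
qed

lemma char_fun_L:
  assumes "t \<in> {0..T}"
  shows "char_fun (distr P borel (L t)) z = exp (complex_of_real t * \<psi> z)"
  using char_fun_increment[of 0 t z] assms by (simp add: L_0)

lemma levy_process_L: "levy_process_on P T L"
  unfolding levy_process_on_def
proof (intro conjI ballI allI impI)
  show "AE \<omega> in P. L 0 \<omega> = 0" by (simp add: L_0)
next
  fix t show "L t \<in> borel_measurable P" by measurable
next
  fix n :: nat and ts :: "nat \<Rightarrow> real"
  assume as: "(\<forall>k<n. ts k < ts (Suc k)) \<and> 0 \<le> ts 0 \<and> ts n \<le> T"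
  have mono: "ts k \<le> ts (Suc k)" if "k < n" for k using as that by (auto intro: less_imp_le)
  have tsb: "0 \<le> ts k" "ts k \<le> T" if "k \<le> n" for k
    using step_mono[of n ts 0 k] step_mono[of n ts k n] mono that as by auto
  show "indep_vars (\<lambda>_. borel) (\<lambda>k \<omega>. L (ts (Suc k)) \<omega> - L (ts k) \<omega>) {..<n}"
  proof (rule indep_vars_char_funI)
    fix z :: "nat \<Rightarrow> 'a"
    show "(CLINT \<omega>|P. iexp (\<Sum>k<n. z k \<bullet> (L (ts (Suc k)) \<omega> - L (ts k) \<omega>))) =
      (\<Prod>k<n. char_fun (distr P borel (\<lambda>\<omega>. L (ts (Suc k)) \<omega> - L (ts k) \<omega>)) (z k))"
      using expectation_increments[of n ts z] mono as tsb by (simp add: char_fun_increment)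
  qed auto
next
  fix s t assume st: "0 \<le> s \<and> s \<le> t \<and> t \<le> T"
  show "distr P borel (\<lambda>\<omega>. L t \<omega> - L s \<omega>) = distr P borel (L (t - s))"
    by (rule finite_measure_eqI_char_fun)
       (use st in \<open>auto simp: char_fun_increment char_fun_L intro!: finite_measure_distr\<close>)
next
  fix s e :: real assume s: "s \<in> {0..T}" and e: "0 < e"
  \<comment> \<open>A fixed time \<open>s\<close> is almost surely none of the \<open>Tj j\<close>,
    so almost every path is continuous at \<open>s\<close>; dominated convergence of the indicators
    gives convergence in probability.\<close>
  show "((\<lambda>t. measure P {\<omega>\<in>space P. e < norm (L t \<omega> - L s \<omega>)}) \<longlongrightarrow> 0) (at s within {0..T})"
    unfolding tendsto_at_iff_sequentially comp_def
  proof (intro allI impI)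
    fix x :: "nat \<Rightarrow> real" assume x: "\<forall>i. x i \<in> {0..T} - {s}" and xs: "x \<longlonglongrightarrow> s"
    have fx: "filterlim x (at s within {0..T}) sequentially"
      using x xs by (auto simp: filterlim_at intro: always_eventually)
    \<comment> \<open>The sequence \<open>x\<close>, which approaches \<open>s\<close> without
      reaching it, shows that the filter is proper.\<close>
    then have nb: "at s within {0..T} \<noteq> bot"
      by (metis filterlim_def filtermap_bot_iff bot_unique sequentially_bot)
    have AEl: "AE \<omega> in P. (\<lambda>i. L (x i) \<omega>) \<longlonglongrightarrow> L s \<omega>"
      using AE_uniform_limit_L AE_Tj_neq[of s]
    proof eventually_elim
      case (elim \<omega>)
      obtain a where a: "(\<lambda>n. S n s \<omega>) \<longlonglongrightarrow> a"
        "((\<lambda>t. L t \<omega>) \<longlongrightarrow> a) (at s within {0..T})"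
      proof (rule uniform_limit_sum_tendsto[OF elim(1) nb])
        show "\<forall>\<^sub>F t in at s within {0..T}. t \<in> {0..T}" by (simp add: eventually_at_filter)
        show "\<forall>\<^sub>F t in at s within {0..T}. indicator {0<..t} (Tj j \<omega>) *\<^sub>R X j \<omega> = indicator {0<..s} (Tj j \<omega>) *\<^sub>R X j \<omega>" for j
          using eventually_indicator_at[of "Tj j \<omega>" s] elim(2) by (auto elim: eventually_mono)
      qed
      have "a = L s \<omega>"
        using LIMSEQ_unique[OF a(1) tendsto_uniform_limitI[OF elim(1) s]] .
      then show ?case using filterlim_compose[OF a(2) fx] by simp
    qed
    have "(\<lambda>i. LINT \<omega>|P. indicator {\<omega>\<in>space P. e < norm (L (x i) \<omega> - L s \<omega>)} \<omega>) \<longlonglongrightarrow> (LINT \<omega>|P. (0::real))"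
    proof (rule integral_dominated_convergence[where w="\<lambda>_. 1"])
      show "AE \<omega> in P. (\<lambda>i. indicator {\<omega>\<in>space P. e < norm (L (x i) \<omega> - L s \<omega>)} \<omega> :: real) \<longlonglongrightarrow> 0"
        using AEl
      proof eventually_elim
        case (elim \<omega>)
        then have "(\<lambda>i. norm (L (x i) \<omega> - L s \<omega>)) \<longlonglongrightarrow> 0"
          by (intro tendsto_norm_zero) (simp add: LIM_zero_iff)
        then have "eventually (\<lambda>i. norm (L (x i) \<omega> - L s \<omega>) < e) sequentially"
          using e by (rule order_tendstoD)
        then show ?case
          by (intro tendsto_eventually) (auto elim!: eventually_mono simp: indicator_def)
      qed
    qed (auto simp: indicator_def)
    moreover have "(LINT \<omega>|P. indicator {\<omega>\<in>space P. e < norm (L (x i) \<omega> - L s \<omega>)} \<omega>) = measure P {\<omega>\<in>space P. e < norm (L (x i) \<omega> - L s \<omega>)}" for i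
      by (subst Bochner_Integration.integral_indicator) (rule arg_cong[where f="measure P"], auto)
    ultimately show "(\<lambda>i. measure P {\<omega>\<in>space P. e < norm (L (x i) \<omega> - L s \<omega>)}) \<longlonglongrightarrow> 0"
      by simp
  qed
next
  show "AE \<omega> in P. (\<forall>t\<in>{0..<T}. continuous (at_right t) (\<lambda>s. L s \<omega>)) \<and>
                  (\<forall>t\<in>{0<..T}. \<exists>l. ((\<lambda>s. L s \<omega>) \<longlongrightarrow> l) (at_left t))"
    using AE_uniform_limit_L
  proof eventually_elim
    case (elim \<omega>)
    show ?case
    proof (intro conjI ballI)
      fix t assume t: "t \<in> {0..<T}"
      obtain a where a: "(\<lambda>n. S n t \<omega>) \<longlonglongrightarrow> a"
        "((\<lambda>s. L s \<omega>) \<longlongrightarrow> a) (at_right t)"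
      proof (rule uniform_limit_sum_tendsto[OF elim])
        show "at_right t \<noteq> bot" by simp
        have "\<forall>\<^sub>F s in at_right t. s \<in> {t<..<T}" using t by (intro eventually_at_right_real) auto
        then show "\<forall>\<^sub>F s in at_right t. s \<in> {0..T}" by eventually_elim (use t in auto)
        show "\<forall>\<^sub>F s in at_right t. indicator {0<..s} (Tj j \<omega>) *\<^sub>R X j \<omega> = indicator {0<..t} (Tj j \<omega>) *\<^sub>R X j \<omega>" for j
          using eventually_indicator_at_right[of "Tj j \<omega>" t] by (auto elim: eventually_mono)
      qed
      have "a = L t \<omega>"
        using LIMSEQ_unique[OF a(1) tendsto_uniform_limitI[OF elim]] t by auto
      then show "continuous (at_right t) (\<lambda>s. L s \<omega>)"
        using a(2) by (simp add: continuous_within)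
    next
      fix t assume t: "t \<in> {0<..T}"
      \<comment> \<open>The left limit is the series with \<open>{0<..<t}\<close> in place of
        \<open>{0<..t}\<close>, that is, without a jump at time \<open>t\<close> itself.\<close>
      show "\<exists>l. ((\<lambda>s. L s \<omega>) \<longlongrightarrow> l) (at_left t)"
      proof (rule uniform_limit_sum_tendsto[OF elim])
        show "at_left t \<noteq> bot" by simp
        have "\<forall>\<^sub>F s in at_left t. s \<in> {0<..<t}" using t by (intro eventually_at_left_real) auto
        then show "\<forall>\<^sub>F s in at_left t. s \<in> {0..T}" by eventually_elim (use t in auto)
        show "\<forall>\<^sub>F s in at_left t. indicator {0<..s} (Tj j \<omega>) *\<^sub>R X j \<omega> = indicator {0<..<t} (Tj j \<omega>) *\<^sub>R X j \<omega>" for j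
          using eventually_indicator_at_left[of "Tj j \<omega>" t] by (auto elim: eventually_mono)
      qed blast
    qed
  qed
qed

end

end

text \<open>The formula for the characteristic functions is the Levy-Khintchine form with drift
  \<open>b\<close>, no Gaussian part and the tempered Levy measure, scaled by \<open>t\<close>. For
  1 \<le> T the choice \<open>t = 1\<close> gives the law of \<open>L 1\<close>.\<close>

theorem mainTheorem1:
  fixes sg :: "'a::euclidean_space measure"
    and Qk :: "'a \<Rightarrow> real measure"
    and p \<alpha> T :: real
    and P :: "'w measure"
    and E E' Tj U :: "nat \<Rightarrow> 'w \<Rightarrow> real"
    and V :: "nat \<Rightarrow> 'w \<Rightarrow> 'a"
  assumes p_pos: "0 < p" and alpha: "0 < \<alpha>" "\<alpha> < 2" and T_pos: "0 < T"
    and sigma_sets: "sets sg = sets borel"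
    and sigma_fin: "finite_measure sg"
    and sigma_supp: "emeasure sg (UNIV - sphere 0 1) = 0"
    and sigma_nz: "emeasure sg (sphere 0 1) \<noteq> 0"
    and Qk_prob: "\<forall>u\<in>sphere 0 1. prob_space (Qk u) \<and> sets (Qk u) = sets borel \<and>
                     emeasure (Qk u) {..0} = 0"
    and Qk_meas: "\<forall>A\<in>sets borel.
                     (\<lambda>u. emeasure (Qk u) A) \<in> borel_measurable (restrict_space borel (sphere 0 1))"
    and P: "prob_space P"
    and E_rv: "\<forall>j. distributed P lborel (E j) (exponential_density 1)"
    and E'_rv: "\<forall>j. distributed P lborel (E' j) (exponential_density 1)"
    and Tj_meas: "\<forall>j. Tj j \<in> borel_measurable P"
    and Tj_distr: "\<forall>j. distr P borel (Tj j) = uniform_measure lborel {0<..<T}"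
    and U_meas: "\<forall>j. U j \<in> borel_measurable P"
    and U_distr: "\<forall>j. distr P borel (U j) = uniform_measure lborel {0<..<1::real}"
    and V_meas: "\<forall>j. V j \<in> borel_measurable P"
    and V_distr: "\<forall>j. distr P borel (V j) =
        scale_measure (ennreal (1 / measure sg (space sg))) (Q_measure sg Qk)"
    and indep: "prob_space.indep_sets P
        (\<lambda>(k, j). if k = (0::nat) then gen_events P (E j)
                  else if k = 1 then gen_events P (E' j)
                  else if k = 2 then gen_events P (Tj j)
                  else if k = 3 then gen_events P (U j)
                  else gen_events P (V j))
        ({0..<5} \<times> UNIV)"
    and alpha_case: "\<alpha> < 1 \<or> (1 \<le> \<alpha> \<and>
        (\<forall>A\<in>sets borel. emeasure (Q_measure sg Qk) (uminus ` A) = emeasure (Q_measure sg Qk) A))"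
  shows "\<exists>L :: real \<Rightarrow> 'w \<Rightarrow> 'a.
     (AE \<omega> in P. uniform_limit {0..T}
        (\<lambda>n t. \<Sum>j<n. series_term p \<alpha> T (measure sg (space sg)) E E' Tj U V j t \<omega>)
        (\<lambda>t. L t \<omega>) sequentially) \<and>
     levy_process_on P T L \<and>
     (\<exists>b. \<forall>t\<in>{0..T}. \<forall>z.
        char_fun (distr P borel (L t)) z =
          exp (complex_of_real t * lk_exponent (tempered_levy_measure sg Qk p \<alpha>) b z))"
proof -
  interpret tempered_series sg Qk p \<alpha> T P E E' Tj U V
    by (intro tempered_series.intro tempered_data.intro tempered_series_axioms.intro) fact+
  have symm: "\<alpha> < 1 \<or> distr VL borel uminus = VL"
    using alpha_case distr_VL_uminus by blast
  show ?thesis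
  proof (intro exI[of _ L] conjI exI[of _ b] ballI allI)
    show "AE \<omega> in P. uniform_limit {0..T}
        (\<lambda>n t. \<Sum>j<n. series_term p \<alpha> T (measure sg (space sg)) E E' Tj U V j t \<omega>)
        (\<lambda>t. L t \<omega>) sequentially"
      unfolding series_term_eq by (rule AE_uniform_limit_L[OF symm])
    show "levy_process_on P T L" by (rule levy_process_L[OF symm])
    show "char_fun (distr P borel (L t)) z = exp (complex_of_real t * lk_exponent (tempered_levy_measure sg Qk p \<alpha>) b z)"
      if "t \<in> {0..T}" for t z
      by (rule char_fun_L[OF symm that])
  qed
qed

end
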